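(* Let $\pi:F\to M$ be a symmetric bundle, and let $\Omega$ be the curvature tensor of the unique linear connection on $F$ which is invariant under all symmetries $\sigma_{0_x}:F\to F$, $x\in M$. Then $\Omega$ is given by the $r$-component of the corresponding Lie triple system representation: for all sections $X,Y$ of $TM$ and all sections $\zeta$ of $F$, $$\Omega(X,Y)\zeta=r(X,Y)\zeta,$$ i.e., with respect to an arbitrary base point $o\in M$, $\Omega_o(v,w)z=r(v,w)z$ for all $v,w\in T_oM$ and $z\in F_o$.
   Context: $\mathbb K$ is a commutative topological ring with dense unit group and with $2$ invertible (e.g. $\mathbb K=\mathbb R$); manifolds are smooth manifolds over $\mathbb K$ modelled on topological $\mathbb K$-modules. Here a map $f$ on an open set is $C^1$ if there is a continuous map $f^{[1]}$ with $f(x+tv)-f(x)=t\,f^{[1]}(x,v,t)$ whenever both sides are defined, with differential $df(x)v=f^{[1]}(x,v,0)$; $C^k$ and smoothness are defined inductively. For $\mathbb K=\mathbb R$ in finite dimension these are the usual notions. **Symmetric space.** A manifold $M$ with a smooth map $\mu:M\times M\to M$, $\mu(x,y)=:\sigma_x(y)$, such that for all $x,y,z$: $\mu(x,x)=x$; $\mu(x,\mu(x,y))=y$; $\mu(x,\mu(y,z))=\mu(\mu(x,y),\mu(x,z))$; and $T_x(\sigma_x)=-\mathrm{id}_{T_xM}$. Homomorphisms are smooth maps commuting with product maps. **Symmetric bundle.** A vector bundle $\pi:F\to M$ such that (SB1) $(F,\mu)$ and $(M,\mu_M)$ are symmetric spaces and $\pi$ is a homomorphism; (SB2) for all $p,q\in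 M$ the induced map $F_p\oplus F_q\to F_{\mu_M(p,q)}$, $(v,w)\mapsto\mu(v,w)$ is linear. Then each $\sigma_{0_x}$ is an automorphism of the vector bundle $F$. **Linear connection.** A bundle chart identifies the fiber $(TF)_x$ of $TF\to M$ with $V\times E\times V\ni(u,v,z)$ ($u$ the point of $F_x$, $v$ the base component and $z$ the fiber component of the tangent vector). A linear connection is a choice of $\mathbb K$-module structure $L_x$ on each $(TF)_x$ which in bundle charts is the transport of the product structure under $(u,v,z)\mapsto(u,v,z+b_x(v,u))$ with $b_x$ bilinear and depending smoothly on $x$. It is invariant under a vector bundle automorphism $f$ if $Tf$ is linear on the fibers of $TF\to M$. A symmetric bundle carries exactly one linear connection invariant under all $\sigma_{0_x}$, $x\in M$. The horizontal lift of a vector field $X:M\to TM$ is the vector field $X_h$ on $F$ whose value at $u\in F_x$ is the sum, with respect to $L_x$, of the zero tangent vector at $u$ and the image of $X(x)$ under the differential of the zero section. The curvature is defined by $$\Omega(X,Y)=[X,Y]_h-[X_h,Y_h],$$ a vertical vector field on $F$, linear along the fibers, hence identified with a field of endomorphisms of the fibers. Sign convention: the Lie bracket of vector fields is given in charts by $[X,Y](x)=dX(x)Y(x)-dY(x)X(x)$. **Lts of a pointed symmetric space $(M,o)$.** The smooth vector fields $X:M\to TM$ which are homomorphisms of symmetric spaces ($TM$ carrying $T\mu$) form a Lie algebra; $\sigma_o$ acts on it by an involution, whose $-1$-eigenspace is mapped bijectively onto $T_oM$ by evaluation at $o$. Via this bijection, $[X,Y,Z]:=[[X,Y],Z]$ defines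 a Lie triple system on $T_oM$. **The $r$-component.** Applied to $(F,0_o)$ this gives a Lie triple system on $T_{0_o}F\cong T_oM\oplus F_o$ (where $T_oM$ is imbedded via the zero section and $F_o$ as the tangent space of the fiber), and $r(v,w)z:=[v,w,z]\in F_o$ for $v,w\in T_oM$, $z\in F_o$. *)

theory Defs
  imports "HOL-Analysis.Analysis" "HOL-Library.Function_Algebras"
begin

section \<open>Differential calculus over topological rings\<close>

locale topological_module = module scale
  for scale :: "'k::{comm_ring_1, topological_ab_group_add, topological_semigroup_mult}
      \<Rightarrow> 'e::{ab_group_add, t2_space} \<Rightarrow> 'e" +
  assumes continuous_add: "continuous_on UNIV (\<lambda>(x, y). x + y :: 'e)"
    and continuous_scale: "continuous_on UNIV (\<lambda>(t, x). scale t x)"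

definition prod_scale :: "('k \<Rightarrow> 'e \<Rightarrow> 'e) \<Rightarrow> ('k \<Rightarrow> 'f \<Rightarrow> 'f) \<Rightarrow> 'k \<Rightarrow> 'e \<times> 'f \<Rightarrow> 'e \<times> 'f"
  where "prod_scale s s' t = map_prod (s t) (s' t)"

text \<open>
  The domain \<open>D\<^sup>[\<^sup>1\<^sup>]\<close> of the extended difference quotient, and the relation ``\<open>g = f\<^sup>[\<^sup>1\<^sup>]\<close>''.
  Directions are restricted to a submodule \<open>W\<close>, which is the whole type except in the encoding of
  the iterated domains below.
\<close>

definition dq_domain :: "('k \<Rightarrow> 'd::plus \<Rightarrow> 'd) \<Rightarrow> 'd set \<Rightarrow> 'd set \<Rightarrow> ('d \<times> 'd \<times> 'k) set"
  where "dq_domain s W D = {(x, v, t). x \<in> D \<and> v \<in> W \<and> x + s t v \<in> D}"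

definition is_diff_quotient ::
  "('k::topological_space \<Rightarrow> 'd::{plus, topological_space} \<Rightarrow> 'd) \<Rightarrow>
   ('k \<Rightarrow> 'f::{minus, topological_space} \<Rightarrow> 'f) \<Rightarrow>
   'd set \<Rightarrow> 'd set \<Rightarrow> ('d \<Rightarrow> 'f) \<Rightarrow> ('d \<times> 'd \<times> 'k \<Rightarrow> 'f) \<Rightarrow> bool"
  where "is_diff_quotient s s' W D f g \<longleftrightarrow>
    continuous_on (dq_domain s W D) g \<and>
    (\<forall>(x, v, t) \<in> dq_domain s W D. f (x + s t v) - f x = s' t (g (x, v, t)))"

text \<open>
  The map \<open>f\<close> is \<open>C\<^sup>k\<^sup>+\<^sup>1\<close> if it is \<open>C\<^sup>1\<close> and \<open>f\<^sup>[\<^sup>1\<^sup>]\<close> is \<open>C\<^sup>k\<close>.  The domain of \<open>f\<^sup>[\<^sup>n\<^sup>]\<close> lies in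
  \<open>E\<^sup>[\<^sup>n\<^sup>]\<close>, where \<open>E\<^sup>[\<^sup>0\<^sup>] = E\<close> and \<open>E\<^sup>[\<^sup>n\<^sup>+\<^sup>1\<^sup>] = E\<^sup>[\<^sup>n\<^sup>] \<times> E\<^sup>[\<^sup>n\<^sup>] \<times> K\<close>.  As HOL has no recursion that changes the type,
  all \<open>E\<^sup>[\<^sup>n\<^sup>]\<close> are realised as subspaces of \<open>bool list \<Rightarrow> E \<times> K\<close> with the product topology: a point of
  \<open>E\<^sup>[\<^sup>n\<^sup>]\<close> is a full binary tree of depth \<open>n\<close> with elements of \<open>E\<close> at its leaves (the lists of length
  \<open>n\<close>) and elements of \<open>K\<close> at its inner nodes (the shorter lists); unused entries are 0.
\<close>

type_synonym ('k, 'e) tree_point = "bool list \<Rightarrow> 'e \<times> 'k"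

definition leaf :: "'e::zero \<Rightarrow> ('k::zero, 'e) tree_point"
  where "leaf x = (\<lambda>l. if l = [] then (x, 0) else (0, 0))"

definition leaf_value :: "('k, 'e) tree_point \<Rightarrow> 'e"
  where "leaf_value p = fst (p [])"

definition node ::
  "('k, 'e::zero) tree_point \<times> ('k, 'e) tree_point \<times> 'k \<Rightarrow> ('k, 'e) tree_point"
  where "node = (\<lambda>(p, q, t) l. case l of [] \<Rightarrow> (0, t) | b # l' \<Rightarrow> if b then q l' else p l')"

definition unnode ::
  "('k, 'e) tree_point \<Rightarrow> ('k, 'e) tree_point \<times> ('k, 'e) tree_point \<times> 'k"
  where "unnode p = (\<lambda>l. p (False # l), \<lambda>l. p (True # l), snd (p []))"

definition tree_scale :: "('k::times \<Rightarrow> 'e \<Rightarrow> 'e) \<Rightarrow> 'k \<Rightarrow> ('k, 'e) tree_point \<Rightarrow> ('k, 'e) tree_point"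
  where "tree_scale s t p = (\<lambda>l. prod_scale s (*) t (p l))"

text \<open>In \<open>Ck_tree s s' k W D f\<close>, the set \<open>W\<close> is the current module \<open>E\<^sup>[\<^sup>n\<^sup>]\<close> and \<open>D \<subseteq> W\<close>.\<close>

primrec Ck_tree ::
  "('k::{comm_ring_1, topological_space} \<Rightarrow> 'e::{ab_group_add, topological_space} \<Rightarrow> 'e) \<Rightarrow>
   ('k \<Rightarrow> 'f::{ab_group_add, topological_space} \<Rightarrow> 'f) \<Rightarrow> nat \<Rightarrow>
   ('k, 'e) tree_point set \<Rightarrow> ('k, 'e) tree_point set \<Rightarrow> (('k, 'e) tree_point \<Rightarrow> 'f) \<Rightarrow> bool"
  where
    "Ck_tree s s' 0 W D f \<longleftrightarrow> continuous_on D f"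
  | "Ck_tree s s' (Suc k) W D f \<longleftrightarrow>
      (\<exists>g. is_diff_quotient (tree_scale s) s' W D f g \<and>
        Ck_tree s s' k (node ` (W \<times> W \<times> UNIV)) (node ` dq_domain (tree_scale s) W D) (g \<circ> unnode))"

definition Ck ::
  "('k::{comm_ring_1, topological_space} \<Rightarrow> 'e::{ab_group_add, topological_space} \<Rightarrow> 'e) \<Rightarrow>
   ('k \<Rightarrow> 'f::{ab_group_add, topological_space} \<Rightarrow> 'f) \<Rightarrow> nat \<Rightarrow> 'e set \<Rightarrow> ('e \<Rightarrow> 'f) \<Rightarrow> bool"
  where "Ck s s' k U f \<longleftrightarrow> Ck_tree s s' k (range leaf) (leaf ` U) (f \<circ> leaf_value)"

text \<open>
  Over a field, being \<open>C\<^sup>k\<close> is a local property.  Over a ring such as the dual numbers it is not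
  (\<open>x\<close> and \<open>x + t v\<close> may be far apart for a nilpotent \<open>t\<close>), and then it is the local notion which is
  stable under composition in varying charts; manifolds are based on it.
\<close>

definition locally_smooth ::
  "('k::{comm_ring_1, topological_space} \<Rightarrow> 'e::{ab_group_add, topological_space} \<Rightarrow> 'e) \<Rightarrow>
   ('k \<Rightarrow> 'f::{ab_group_add, topological_space} \<Rightarrow> 'f) \<Rightarrow> 'e set \<Rightarrow> ('e \<Rightarrow> 'f) \<Rightarrow> bool"
  where "locally_smooth s s' U f \<longleftrightarrow>
    (\<forall>x\<in>U. \<exists>W. open W \<and> x \<in> W \<and> W \<subseteq> U \<and> (\<forall>k. Ck s s' k W f))"

text \<open>\<open>df(x)v = f\<^sup>[\<^sup>1\<^sup>](x,v,0)\<close>, computed in any open neighbourhood of \<open>x\<close> on which \<open>f\<close> is \<open>C\<^sup>1\<close>.\<close>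

definition differential ::
  "('k::{zero, topological_space} \<Rightarrow> 'e::{plus, topological_space} \<Rightarrow> 'e) \<Rightarrow>
   ('k \<Rightarrow> 'f::{minus, topological_space} \<Rightarrow> 'f) \<Rightarrow> ('e \<Rightarrow> 'f) \<Rightarrow> 'e \<Rightarrow> 'e \<Rightarrow> 'f"
  where "differential s s' f x v =
    (THE y. \<exists>W g. open W \<and> x \<in> W \<and> is_diff_quotient s s' UNIV W f g \<and> y = g (x, v, 0))"

section \<open>Manifolds\<close>

text \<open>
  A manifold is a type with an atlas; a chart is a pair of a domain and a map, whose values
  outside the domain are irrelevant.  Its topology is the one determined by the atlas: \<open>O\<close> is open
  iff \<open>\<phi>(O \<inter> U)\<close> is open for all charts \<open>(U, \<phi>)\<close>.
\<close>

type_synonym ('m, 'e) chart = "'m set \<times> ('m \<Rightarrow> 'e)"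

record ('k, 'm, 'e) mfd =
  scal :: "'k \<Rightarrow> 'e \<Rightarrow> 'e"
  atlas :: "('m, 'e) chart set"

definition local_dom :: "('m, 'e) chart \<Rightarrow> ('n, 'f) chart \<Rightarrow> ('m \<Rightarrow> 'n) \<Rightarrow> 'e set"
  where "local_dom c c' f = snd c ` (fst c \<inter> f -` fst c')"

definition local_map :: "('m, 'e) chart \<Rightarrow> ('n, 'f) chart \<Rightarrow> ('m \<Rightarrow> 'n) \<Rightarrow> 'e \<Rightarrow> 'f"
  where "local_map c c' f = snd c' \<circ> f \<circ> inv_into (fst c) (snd c)"

text \<open>Local smoothness includes that \<open>local_dom c c' f\<close> is open, i.e. the continuity of \<open>f\<close>.\<close>

definition smooth_map ::
  "('k::{comm_ring_1, topological_space}, 'm, 'e::{ab_group_add, topological_space}) mfd \<Rightarrow>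
   ('k, 'n, 'f::{ab_group_add, topological_space}) mfd \<Rightarrow> ('m \<Rightarrow> 'n) \<Rightarrow> bool"
  where "smooth_map M N f \<longleftrightarrow>
    (\<forall>c\<in>atlas M. \<forall>c'\<in>atlas N. locally_smooth (scal M) (scal N) (local_dom c c' f) (local_map c c' f))"

text \<open>The last condition says that all chart transitions are smooth, on open domains.\<close>

definition smooth_manifold ::
  "('k::{comm_ring_1, topological_ab_group_add, topological_semigroup_mult}, 'm,
    'e::{ab_group_add, t2_space}) mfd \<Rightarrow> bool"
  where "smooth_manifold M \<longleftrightarrow>
    topological_module (scal M) \<and>
    (\<forall>c\<in>atlas M. inj_on (snd c) (fst c) \<and> open (snd c ` fst c)) \<and>
    (\<Union>c\<in>atlas M. fst c) = UNIV \<and>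
    smooth_map M M id"

definition compatible_chart ::
  "('k::{comm_ring_1, topological_ab_group_add, topological_semigroup_mult}, 'm,
    'e::{ab_group_add, t2_space}) mfd \<Rightarrow> ('m, 'e) chart \<Rightarrow> bool"
  where "compatible_chart M c \<longleftrightarrow> smooth_manifold (M\<lparr>atlas := insert c (atlas M)\<rparr>)"

definition prod_chart :: "('m, 'e) chart \<Rightarrow> ('n, 'f) chart \<Rightarrow> ('m \<times> 'n, 'e \<times> 'f) chart"
  where "prod_chart c c' = (fst c \<times> fst c', map_prod (snd c) (snd c'))"

definition prod_mfd :: "('k, 'm, 'e) mfd \<Rightarrow> ('k, 'n, 'f) mfd \<Rightarrow> ('k, 'm \<times> 'n, 'e \<times> 'f) mfd"
  where "prod_mfd M N = \<lparr>scal = prod_scale (scal M) (scal N),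
    atlas = {prod_chart c c' | c c'. c \<in> atlas M \<and> c' \<in> atlas N}\<rparr>"

subsection \<open>Tangent bundle\<close>

text \<open>
  The tangent space at \<open>p\<close> is identified with the model module by means of a chosen chart
  \<open>chart_at M p\<close>; so the tangent bundle is \<open>'m \<times> 'e\<close> as a set, but carries the manifold structure
  of the charts \<open>T\<phi>\<close>, which is not that of a product.  If \<open>f\<close> maps \<open>p\<close> into the domain of \<open>c'\<close>, then
  \<open>local_diff M N c c' f p v\<close> is the image under \<open>T\<^sub>pf\<close>, seen in \<open>c'\<close>, of the tangent vector which
  is \<open>v\<close> in \<open>c\<close>; and \<open>chart_vec M c p v\<close> represents in the chart \<open>c\<close> the tangent vector \<open>(p, v)\<close>.
\<close>

definition chart_at :: "('k, 'm, 'e) mfd \<Rightarrow> 'm \<Rightarrow> ('m, 'e) chart"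
  where "chart_at M p = (SOME c. c \<in> atlas M \<and> p \<in> fst c)"

definition local_diff ::
  "('k::{comm_ring_1, topological_space}, 'm, 'e::{ab_group_add, topological_space}) mfd \<Rightarrow>
   ('k, 'n, 'f::{ab_group_add, topological_space}) mfd \<Rightarrow>
   ('m, 'e) chart \<Rightarrow> ('n, 'f) chart \<Rightarrow> ('m \<Rightarrow> 'n) \<Rightarrow> 'm \<Rightarrow> 'e \<Rightarrow> 'f"
  where "local_diff M N c c' f p v =
    differential (scal M) (scal N) (local_map c c' f) (snd c p) v"

definition tangent_map ::
  "('k::{comm_ring_1, topological_space}, 'm, 'e::{ab_group_add, topological_space}) mfd \<Rightarrow>
   ('k, 'n, 'f::{ab_group_add, topological_space}) mfd \<Rightarrow>
   ('m \<Rightarrow> 'n) \<Rightarrow> 'm \<times> 'e \<Rightarrow> 'n \<times> 'f"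
  where "tangent_map M N f =
    (\<lambda>(p, v). (f p, local_diff M N (chart_at M p) (chart_at N (f p)) f p v))"

definition chart_vec ::
  "('k::{comm_ring_1, topological_space}, 'm, 'e::{ab_group_add, topological_space}) mfd \<Rightarrow>
   ('m, 'e) chart \<Rightarrow> 'm \<Rightarrow> 'e \<Rightarrow> 'e"
  where "chart_vec M c p v = local_diff M M (chart_at M p) c id p v"

definition tangent_mfd ::
  "('k::{comm_ring_1, topological_space}, 'm, 'e::{ab_group_add, topological_space}) mfd \<Rightarrow>
   ('k, 'm \<times> 'e, 'e \<times> 'e) mfd"
  where "tangent_mfd M = \<lparr>scal = prod_scale (scal M) (scal M),
    atlas = {(fst c \<times> UNIV, \<lambda>(p, v). (snd c p, chart_vec M c p v)) | c. c \<in> atlas M}\<rparr>"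

subsection \<open>Vector fields\<close>

text \<open>A vector field is given by its principal part \<open>X\<close>, that is, it is the map \<open>p \<mapsto> (p, X p)\<close>.\<close>

definition vector_field ::
  "('k::{comm_ring_1, topological_space}, 'm, 'e::{ab_group_add, topological_space}) mfd \<Rightarrow>
   ('m \<Rightarrow> 'e) \<Rightarrow> bool"
  where "vector_field M X \<longleftrightarrow> smooth_map M (tangent_mfd M) (\<lambda>p. (p, X p))"

definition field_in_chart ::
  "('k::{comm_ring_1, topological_space}, 'm, 'e::{ab_group_add, topological_space}) mfd \<Rightarrow>
   ('m, 'e) chart \<Rightarrow> ('m \<Rightarrow> 'e) \<Rightarrow> 'e \<Rightarrow> 'e"
  where "field_in_chart M c X x = (let p = inv_into (fst c) (snd c) x in chart_vec M c p (X p))"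

text \<open>Sign convention: \<open>[X,Y](x) = dX(x)Y(x) - dY(x)X(x)\<close>, the negative of the usual bracket.\<close>

definition lie_bracket ::
  "('k::{comm_ring_1, topological_space}, 'm, 'e::{ab_group_add, topological_space}) mfd \<Rightarrow>
   ('m \<Rightarrow> 'e) \<Rightarrow> ('m \<Rightarrow> 'e) \<Rightarrow> 'm \<Rightarrow> 'e"
  where "lie_bracket M X Y p =
    (let c = chart_at M p; x = snd c p; X' = field_in_chart M c X; Y' = field_in_chart M c Y
     in differential (scal M) (scal M) X' x (Y' x) - differential (scal M) (scal M) Y' x (X' x))"

section \<open>Symmetric spaces\<close>

definition symmetric_space ::
  "('k::{comm_ring_1, topological_ab_group_add, topological_semigroup_mult}, 'm,
    'e::{ab_group_add, t2_space}) mfd \<Rightarrow> ('m \<Rightarrow> 'm \<Rightarrow> 'm) \<Rightarrow> bool"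
  where "symmetric_space M \<mu> \<longleftrightarrow>
    smooth_manifold M \<and>
    smooth_map (prod_mfd M M) M (\<lambda>(x, y). \<mu> x y) \<and>
    (\<forall>x. \<mu> x x = x) \<and>
    (\<forall>x y. \<mu> x (\<mu> x y) = y) \<and>
    (\<forall>x y z. \<mu> x (\<mu> y z) = \<mu> (\<mu> x y) (\<mu> x z)) \<and>
    (\<forall>x v. tangent_map M M (\<mu> x) (x, v) = (x, - v))"

definition symmetric_hom ::
  "('k::{comm_ring_1, topological_space}, 'm, 'e::{ab_group_add, topological_space}) mfd \<Rightarrow>
   ('m \<Rightarrow> 'm \<Rightarrow> 'm) \<Rightarrow>
   ('k, 'n, 'f::{ab_group_add, topological_space}) mfd \<Rightarrow> ('n \<Rightarrow> 'n \<Rightarrow> 'n) \<Rightarrow> ('m \<Rightarrow> 'n) \<Rightarrow> bool"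
  where "symmetric_hom M \<mu> N \<nu> f \<longleftrightarrow>
    smooth_map M N f \<and> (\<forall>x y. f (\<mu> x y) = \<nu> (f x) (f y))"

text \<open>
  \<open>T\<mu>\<close> as a product map on \<open>TM\<close>.  The identification of \<open>TM \<times> TM\<close> with \<open>T(M \<times> M)\<close> is made in the
  product of the charts chosen at the two points, as \<open>chart_at\<close> for \<open>M \<times> M\<close> may differ from it.
\<close>

definition tangent_product ::
  "('k::{comm_ring_1, topological_space}, 'm, 'e::{ab_group_add, topological_space}) mfd \<Rightarrow>
   ('m \<Rightarrow> 'm \<Rightarrow> 'm) \<Rightarrow> 'm \<times> 'e \<Rightarrow> 'm \<times> 'e \<Rightarrow> 'm \<times> 'e"
  where "tangent_product M \<mu> = (\<lambda>(p, v) (q, w).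
    (\<mu> p q, local_diff (prod_mfd M M) M (prod_chart (chart_at M p) (chart_at M q))
       (chart_at M (\<mu> p q)) (\<lambda>(x, y). \<mu> x y) (p, q) (v, w)))"

definition derivations ::
  "('k::{comm_ring_1, topological_space}, 'm, 'e::{ab_group_add, topological_space}) mfd \<Rightarrow>
   ('m \<Rightarrow> 'm \<Rightarrow> 'm) \<Rightarrow> ('m \<Rightarrow> 'e) set"
  where "derivations M \<mu> =
    {X. symmetric_hom M \<mu> (tangent_mfd M) (tangent_product M \<mu>) (\<lambda>p. (p, X p))}"

text \<open>This is \<open>T\<sigma>\<^sub>a \<circ> X \<circ> \<sigma>\<^sub>a = -X\<close>, where \<open>\<sigma>\<^sub>a\<close> is its own inverse.\<close>

definition minus_derivations ::
  "('k::{comm_ring_1, topological_space}, 'm, 'e::{ab_group_add, topological_space}) mfd \<Rightarrow>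
   ('m \<Rightarrow> 'm \<Rightarrow> 'm) \<Rightarrow> 'm \<Rightarrow> ('m \<Rightarrow> 'e) set"
  where "minus_derivations M \<mu> a =
    {X \<in> derivations M \<mu>. \<forall>p. tangent_map M M (\<mu> a) (\<mu> a p, X (\<mu> a p)) = (p, - X p)}"

definition lts ::
  "('k::{comm_ring_1, topological_space}, 'm, 'e::{ab_group_add, topological_space}) mfd \<Rightarrow>
   ('m \<Rightarrow> 'm \<Rightarrow> 'm) \<Rightarrow> 'm \<Rightarrow> 'e \<Rightarrow> 'e \<Rightarrow> 'e \<Rightarrow> 'e"
  where "lts M \<mu> a u v w =
    (let ext = the_inv_into (minus_derivations M \<mu> a) (\<lambda>X. X a)
     in lie_bracket M (lie_bracket M (ext u) (ext v)) (ext w) a)"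

section \<open>Symmetric bundles\<close>

record ('k, 'm, 'e, 'b, 'v) vbundle =
  base :: "('k, 'm, 'e) mfd"
  fibre_scal :: "'k \<Rightarrow> 'v \<Rightarrow> 'v"
  batlas :: "('b, 'e \<times> 'v) chart set"
  proj :: "'b \<Rightarrow> 'm"
  fzero :: "'m \<Rightarrow> 'b"
  fadd :: "'b \<Rightarrow> 'b \<Rightarrow> 'b"
  fsmult :: "'k \<Rightarrow> 'b \<Rightarrow> 'b"

definition total :: "('k, 'm, 'e, 'b, 'v) vbundle \<Rightarrow> ('k, 'b, 'e \<times> 'v) mfd"
  where "total F = \<lparr>scal = prod_scale (scal (base F)) (fibre_scal F), atlas = batlas F\<rparr>"

definition bundle_chart ::
  "('k::{comm_ring_1, topological_ab_group_add, topological_semigroup_mult}, 'm,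
    'e::{ab_group_add, t2_space}, 'b, 'v::{ab_group_add, t2_space}) vbundle \<Rightarrow>
   ('b, 'e \<times> 'v) chart \<Rightarrow> bool"
  where "bundle_chart F c \<longleftrightarrow> (\<exists>U \<phi>.
    compatible_chart (base F) (U, \<phi>) \<and>
    fst c = proj F -` U \<and>
    snd c ` fst c = \<phi> ` U \<times> UNIV \<and>
    (\<forall>u\<in>fst c. fst (snd c u) = \<phi> (proj F u)) \<and>
    (\<forall>x\<in>U. snd (snd c (fzero F x)) = 0) \<and>
    (\<forall>u\<in>fst c. \<forall>u'\<in>fst c. proj F u = proj F u' \<longrightarrow>
      snd (snd c (fadd F u u')) = snd (snd c u) + snd (snd c u')) \<and>
    (\<forall>t. \<forall>u\<in>fst c. snd (snd c (fsmult F t u)) = fibre_scal F t (snd (snd c u))))"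

definition vector_bundle ::
  "('k::{comm_ring_1, topological_ab_group_add, topological_semigroup_mult}, 'm,
    'e::{ab_group_add, t2_space}, 'b, 'v::{ab_group_add, t2_space}) vbundle \<Rightarrow> bool"
  where "vector_bundle F \<longleftrightarrow>
    smooth_manifold (base F) \<and>
    topological_module (fibre_scal F) \<and>
    smooth_manifold (total F) \<and>
    (\<forall>c\<in>batlas F. bundle_chart F c) \<and>
    (\<forall>x. proj F (fzero F x) = x) \<and>
    (\<forall>u u'. proj F u = proj F u' \<longrightarrow> proj F (fadd F u u') = proj F u) \<and>
    (\<forall>t u. proj F (fsmult F t u) = proj F u)"

definition smooth_section ::
  "('k::{comm_ring_1, topological_space}, 'm, 'e::{ab_group_add, topological_space}, 'b,
    'v::{ab_group_add, topological_space}) vbundle \<Rightarrow> ('m \<Rightarrow> 'b) \<Rightarrow> bool"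
  where "smooth_section F \<zeta> \<longleftrightarrow> smooth_map (base F) (total F) \<zeta> \<and> (\<forall>x. proj F (\<zeta> x) = x)"

definition symmetric_bundle ::
  "('k::{comm_ring_1, topological_ab_group_add, topological_semigroup_mult}, 'm,
    'e::{ab_group_add, t2_space}, 'b, 'v::{ab_group_add, t2_space}) vbundle \<Rightarrow>
   ('b \<Rightarrow> 'b \<Rightarrow> 'b) \<Rightarrow> ('m \<Rightarrow> 'm \<Rightarrow> 'm) \<Rightarrow> bool"
  where "symmetric_bundle F \<mu> \<mu>M \<longleftrightarrow>
    vector_bundle F \<and>
    symmetric_space (total F) \<mu> \<and> symmetric_space (base F) \<mu>M \<and>
    symmetric_hom (total F) \<mu> (base F) \<mu>M (proj F) \<and>
    (\<forall>v v' w w'. proj F v = proj F v' \<and> proj F w = proj F w' \<longrightarrow>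
      \<mu> (fadd F v v') (fadd F w w') = fadd F (\<mu> v w) (\<mu> v' w')) \<and>
    (\<forall>t v w. \<mu> (fsmult F t v) (fsmult F t w) = fsmult F t (\<mu> v w))"

text \<open>
  \<open>vertical F u z\<close> is the vertical tangent vector at \<open>u\<close> corresponding to \<open>z\<close> in the fibre of \<open>u\<close>
  under the identification of the fibre with its tangent space at \<open>u\<close>.  All charts of the total
  space being bundle charts, this vector has components 0 and the fibre coordinate of \<open>z\<close>.
\<close>

definition vertical ::
  "('k, 'm, 'e::zero, 'b, 'v) vbundle \<Rightarrow> 'b \<Rightarrow> 'b \<Rightarrow> 'e \<times> 'v"
  where "vertical F u z = (0, snd (snd (chart_at (total F) u) z))"

definition fibre_part ::
  "('k, 'm, 'e::zero, 'b, 'v) vbundle \<Rightarrow> 'b \<Rightarrow> 'e \<times> 'v \<Rightarrow> 'b"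
  where "fibre_part F u \<xi> = (THE z. proj F z = proj F u \<and> vertical F u z = \<xi>)"

subsection \<open>Linear connections\<close>

record ('k, 'b, 'h) connection =
  cadd :: "'b \<times> 'h \<Rightarrow> 'b \<times> 'h \<Rightarrow> 'b \<times> 'h"
  csmult :: "'k \<Rightarrow> 'b \<times> 'h \<Rightarrow> 'b \<times> 'h"

text \<open>The coordinates \<open>(u, v, z)\<close> of a tangent vector of \<open>F\<close> in a bundle chart.\<close>

definition tangent_coords ::
  "('k::{comm_ring_1, topological_space}, 'm, 'e::{ab_group_add, topological_space}, 'b,
    'v::{ab_group_add, topological_space}) vbundle \<Rightarrow>
   ('b, 'e \<times> 'v) chart \<Rightarrow> 'b \<times> ('e \<times> 'v) \<Rightarrow> 'v \<times> 'e \<times> 'v"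
  where "tangent_coords F c = (\<lambda>(u, \<xi>). (snd (snd c u), chart_vec (total F) c u \<xi>))"

definition linear_connection ::
  "('k::{comm_ring_1, topological_space}, 'm, 'e::{ab_group_add, topological_space}, 'b,
    'v::{ab_group_add, topological_space}) vbundle \<Rightarrow>
   ('k, 'b, 'e \<times> 'v) connection \<Rightarrow> bool"
  where "linear_connection F L \<longleftrightarrow>
    (\<forall>\<xi> \<eta>. proj F (fst \<xi>) = proj F (fst \<eta>) \<longrightarrow> proj F (fst (cadd L \<xi> \<eta>)) = proj F (fst \<xi>)) \<and>
    (\<forall>t \<xi>. proj F (fst (csmult L t \<xi>)) = proj F (fst \<xi>)) \<and>
    (\<forall>c\<in>batlas F. \<exists>b.
      (let sE = scal (base F); sV = fibre_scal F; D = fst ` snd c ` fst c;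
           \<Theta> = (\<lambda>\<xi>. case tangent_coords F c \<xi> of
                 (u, v, z) \<Rightarrow> (u, v, z + b (fst (snd c (fst \<xi>))) v u))
       in (\<forall>x\<in>D. (\<forall>u. module_hom sE sV (\<lambda>v. b x v u)) \<and> (\<forall>v. module_hom sV sV (b x v))) \<and>
          locally_smooth (prod_scale sE (prod_scale sE sV)) sV (D \<times> UNIV) (\<lambda>(x, v, u). b x v u) \<and>
          (\<forall>\<xi> \<eta>. fst \<xi> \<in> fst c \<and> proj F (fst \<xi>) = proj F (fst \<eta>) \<longrightarrow>
            \<Theta> (cadd L \<xi> \<eta>) = \<Theta> \<xi> + \<Theta> \<eta>) \<and>
          (\<forall>t \<xi>. fst \<xi> \<in> fst c \<longrightarrow>
            \<Theta> (csmult L t \<xi>) = prod_scale sV (prod_scale sE sV) t (\<Theta> \<xi>))))"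

definition invariant_connection ::
  "('k::{comm_ring_1, topological_space}, 'm, 'e::{ab_group_add, topological_space}, 'b,
    'v::{ab_group_add, topological_space}) vbundle \<Rightarrow>
   ('k, 'b, 'e \<times> 'v) connection \<Rightarrow> ('b \<Rightarrow> 'b) \<Rightarrow> bool"
  where "invariant_connection F L f \<longleftrightarrow>
    (let Tf = tangent_map (total F) (total F) f
     in (\<forall>\<xi> \<eta>. proj F (fst \<xi>) = proj F (fst \<eta>) \<longrightarrow> Tf (cadd L \<xi> \<eta>) = cadd L (Tf \<xi>) (Tf \<eta>)) \<and>
        (\<forall>t \<xi>. Tf (csmult L t \<xi>) = csmult L t (Tf \<xi>)))"

definition horizontal_lift ::
  "('k::{comm_ring_1, topological_space}, 'm, 'e::{ab_group_add, topological_space}, 'b,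
    'v::{ab_group_add, topological_space}) vbundle \<Rightarrow>
   ('k, 'b, 'e \<times> 'v) connection \<Rightarrow> ('m \<Rightarrow> 'e) \<Rightarrow> 'b \<Rightarrow> 'e \<times> 'v"
  where "horizontal_lift F L X u =
    snd (cadd L (u, 0) (tangent_map (base F) (total F) (fzero F) (proj F u, X (proj F u))))"

definition curvature_field ::
  "('k::{comm_ring_1, topological_space}, 'm, 'e::{ab_group_add, topological_space}, 'b,
    'v::{ab_group_add, topological_space}) vbundle \<Rightarrow>
   ('k, 'b, 'e \<times> 'v) connection \<Rightarrow> ('m \<Rightarrow> 'e) \<Rightarrow> ('m \<Rightarrow> 'e) \<Rightarrow> 'b \<Rightarrow> 'e \<times> 'v"
  where "curvature_field F L X Y u =
    horizontal_lift F L (lie_bracket (base F) X Y) u -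
    lie_bracket (total F) (horizontal_lift F L X) (horizontal_lift F L Y) u"

text \<open>\<open>\<Omega>(X,Y)\<close> as a field of endomorphisms of the fibres, and its value \<open>\<Omega>\<^sub>a(v,w)z\<close> at a point.\<close>

definition curvature ::
  "('k::{comm_ring_1, topological_space}, 'm, 'e::{ab_group_add, topological_space}, 'b,
    'v::{ab_group_add, topological_space}) vbundle \<Rightarrow>
   ('k, 'b, 'e \<times> 'v) connection \<Rightarrow> ('m \<Rightarrow> 'e) \<Rightarrow> ('m \<Rightarrow> 'e) \<Rightarrow> 'b \<Rightarrow> 'b"
  where "curvature F L X Y u = fibre_part F u (curvature_field F L X Y u)"

definition curvature_at ::
  "('k::{comm_ring_1, topological_space}, 'm, 'e::{ab_group_add, topological_space}, 'b,
    'v::{ab_group_add, topological_space}) vbundle \<Rightarrow>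
   ('k, 'b, 'e \<times> 'v) connection \<Rightarrow> 'm \<Rightarrow> 'e \<Rightarrow> 'e \<Rightarrow> 'b \<Rightarrow> 'b"
  where "curvature_at F L a v w z =
    (THE z'. \<forall>X Y. vector_field (base F) X \<and> vector_field (base F) Y \<and> X a = v \<and> Y a = w \<longrightarrow>
      curvature F L X Y z = z')"

subsection \<open>The component \<open>r\<close> of the Lie triple system at a zero vector\<close>

definition r_component ::
  "('k::{comm_ring_1, topological_space}, 'm, 'e::{ab_group_add, topological_space}, 'b,
    'v::{ab_group_add, topological_space}) vbundle \<Rightarrow>
   ('b \<Rightarrow> 'b \<Rightarrow> 'b) \<Rightarrow> 'm \<Rightarrow> 'e \<Rightarrow> 'e \<Rightarrow> 'b \<Rightarrow> 'b"
  where "r_component F \<mu> a v w z =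
    (let T0 = (\<lambda>x. snd (tangent_map (base F) (total F) (fzero F) (a, x)))
     in fibre_part F (fzero F a)
          (lts (total F) \<mu> (fzero F a) (T0 v) (T0 w) (vertical F (fzero F a) z)))"

end

theory Submission
  imports Defs
begin

text \<open>
  Both sides are computed in one bundle chart around the base point.  There the product of the zero
  vector over \<open>x\<close> with the vector \<open>u\<close> over \<open>q\<close> has the form \<open>(m(x,q), n(x,q)u)\<close>, with \<open>n(x,q)\<close> linear, and
  horizontal vectors at \<open>(q,u)\<close> are those of the form \<open>(w, -b_q(w,u))\<close>.  From the horizontal lifts one finds,
  with \<open>b = b_o\<close> and \<open>\<partial>_v b\<close> for the derivative of the field \<open>q \<mapsto> b_q\<close> at \<open>o\<close> along \<open>v\<close>,

    \<open>\<Omega>(v,w)z = (\<partial>_w b)(v,z) - (\<partial>_v b)(w,z) - b(v, b(w,z)) + b(w, b(v,z))\<close>  (\<open>bracket_hlift\<close>).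

  For the triple product, let \<open>V\<close>, \<open>W\<close> and \<open>Z\<close> be the derivations of \<open>F\<close> in the minus-one eigenspace at the
  zero vector over \<open>o\<close>, with values the horizontal vectors of \<open>v\<close> and \<open>w\<close> and the vertical vector of \<open>z\<close>.
  The bracket \<open>[V,W]\<close> is an even derivation, so it vanishes at the zero vector; along the fibre over \<open>o\<close>
  it is vertical and linear.  Hence \<open>[[V,W],Z]\<close> at the zero vector, which is the derivative of \<open>[V,W]\<close> in the
  direction of \<open>Z\<close>, is the value of \<open>[V,W]\<close> at \<open>z\<close> (\<open>lts_in_chart\<close>).

  It remains to find \<open>[V,W]\<close> over \<open>o\<close>.  The derivation \<open>V\<close> is half the derivative in the direction \<open>v\<close>, at
  \<open>x = o\<close>, of the family of automorphisms formed by the symmetry at the zero vector over \<open>o\<close> followed by the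
  symmetry at the zero vector over \<open>x\<close> (\<open>ext_field\<close>).  Thus \<open>[V,W]\<close> over \<open>o\<close> involves the mixed second
  derivatives of \<open>m\<close> and \<open>n\<close> at \<open>(o,o)\<close>.  Those of \<open>m\<close> are symmetric, because the symmetry at \<open>x\<close> has
  differential minus the identity at \<open>x\<close>, for all \<open>x\<close> near \<open>o\<close> (\<open>second_m_sym\<close>).  Those of \<open>n\<close> follow from the
  invariance of the connection: it holds under the symmetries at all \<open>x\<close>, so that it may be differentiated
  with respect to \<open>x\<close> (\<open>second_n\<close>).  The outcome is the above expression for \<open>\<Omega>\<close> (\<open>bracket_deriv\<close>).

  That \<open>V\<close> exists is a consequence of the distributive law for the product \<open>T\<mu>\<close> on the tangent bundle, by
  which symmetries of \<open>TM\<close> are automorphisms (\<open>tmul_distrib\<close>, \<open>ext_minus_derivations\<close>).  The calculus behind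
  all this rests on the density of the units: it makes differentials unique and second differentials
  symmetric (\<open>agree_on_units_imp_eq\<close>, \<open>second_differential_symmetric\<close>).
\<close>

section \<open>Topological modules and continuous linear maps\<close>

text \<open>
  The tree spaces contain copies of the ring of scalars, which need not be Hausdorff; so no separation
  axiom is included here.
\<close>

locale cont_module = module scale
  for scale :: "'k::{comm_ring_1, topological_ab_group_add, topological_semigroup_mult}
      \<Rightarrow> 'e::{ab_group_add, topological_space} \<Rightarrow> 'e" +
  assumes cont_add: "continuous_on UNIV (\<lambda>(x, y). x + y :: 'e)"
    and cont_scale: "continuous_on UNIV (\<lambda>(t, x). scale t x)"
begin

lemma continuous_on_plus:
  assumes "continuous_on S f" "continuous_on S g"
  shows "continuous_on S (\<lambda>x. f x + g x :: 'e)"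
  using continuous_on_compose2[OF cont_add continuous_on_Pair[OF assms]] by simp

lemma continuous_on_scale:
  assumes "continuous_on S f" "continuous_on S g"
  shows "continuous_on S (\<lambda>x. scale (f x) (g x))"
  using continuous_on_compose2[OF cont_scale continuous_on_Pair[OF assms]] by simp

lemma continuous_on_uminus:
  assumes "continuous_on S f"
  shows "continuous_on S (\<lambda>x. - f x :: 'e)"
  using continuous_on_scale[OF continuous_on_const assms, of "- 1"] by simp

lemma continuous_on_minus:
  assumes "continuous_on S f" "continuous_on S g"
  shows "continuous_on S (\<lambda>x. f x - g x :: 'e)"
  using continuous_on_plus[OF assms(1) continuous_on_uminus[OF assms(2)]] by simp

end

lemma cont_module_ring:
  "cont_module ((*) :: 'k::{comm_ring_1, topological_ab_group_add, topological_semigroup_mult} \<Rightarrow> 'k \<Rightarrow> 'k)"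
proof
  show "continuous_on UNIV (\<lambda>(x, y). x + y :: 'k)"
    by (auto simp: case_prod_unfold intro!: continuous_intros)
  show "continuous_on UNIV (\<lambda>(x, y). x * y :: 'k)"
    unfolding case_prod_unfold continuous_on_def
    by (intro ballI tendsto_mult) (auto intro!: tendsto_intros tendsto_fst tendsto_snd tendsto_ident_at)
qed (auto simp: algebra_simps)

lemma cont_module_prod:
  assumes "cont_module s" "cont_module s'"
  shows "cont_module (prod_scale s s')"
proof -
  interpret A: cont_module s by fact
  interpret B: cont_module s' by fact
  show ?thesis
  proof
    show "continuous_on UNIV (\<lambda>(x, y). x + y :: 'b \<times> 'c)"
      unfolding case_prod_unfold plus_prod_def
      by (intro continuous_on_Pair A.continuous_on_plus B.continuous_on_plus continuous_intros)
    show "continuous_on UNIV (\<lambda>(t, x). prod_scale s s' t x)"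
      unfolding case_prod_unfold prod_scale_def map_prod_def
      by (intro continuous_on_Pair A.continuous_on_scale B.continuous_on_scale continuous_intros)
  qed (auto simp: prod_scale_def A.scale_right_distrib B.scale_right_distrib
        A.scale_left_distrib B.scale_left_distrib)
qed

lemma cont_module_tree:
  fixes s :: "'k::{comm_ring_1, topological_ab_group_add, topological_semigroup_mult}
      \<Rightarrow> 'e::{ab_group_add, topological_space} \<Rightarrow> 'e"
  assumes "cont_module s"
  shows "cont_module (tree_scale s)"
proof -
  interpret A: cont_module "prod_scale s ((*) :: 'k \<Rightarrow> 'k \<Rightarrow> 'k)"
    by (rule cont_module_prod[OF assms cont_module_ring])
  show ?thesis
  proof
    show "continuous_on UNIV (\<lambda>(x, y). x + y :: ('k, 'e) tree_point)"
      unfolding case_prod_unfold plus_fun_def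
      by (intro continuous_on_coordinatewise_then_product A.continuous_on_plus)
        (rule continuous_on_product_then_coordinatewise, intro continuous_intros)+
    show "continuous_on UNIV (\<lambda>(t, x). tree_scale s t x)"
      unfolding case_prod_unfold tree_scale_def
      by (intro continuous_on_coordinatewise_then_product A.continuous_on_scale)
        ((rule continuous_on_product_then_coordinatewise)?, intro continuous_intros)+
  qed (auto simp: tree_scale_def A.scale_right_distrib A.scale_left_distrib)
qed

definition continuous_linear ::
  "('k \<Rightarrow> 'e::{plus, topological_space} \<Rightarrow> 'e) \<Rightarrow>
   ('k \<Rightarrow> 'f::{plus, topological_space} \<Rightarrow> 'f) \<Rightarrow> ('e \<Rightarrow> 'f) \<Rightarrow> bool"
  where "continuous_linear s s' A \<longleftrightarrow>
    (\<forall>x y. A (x + y) = A x + A y) \<and> (\<forall>t x. A (s t x) = s' t (A x)) \<and> continuous_on UNIV A"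

lemma continuous_linearD:
  assumes "continuous_linear s s' A"
  shows "A (x + y) = A x + A y" "A (s t x) = s' t (A x)" "continuous_on S A"
  using assms continuous_on_subset[of UNIV A S] by (auto simp: continuous_linear_def)

lemma continuous_linear_diff:
  fixes A :: "'e::{ab_group_add, topological_space} \<Rightarrow> 'f::{ab_group_add, topological_space}"
  assumes "continuous_linear s s' A"
  shows "A (x - y) = A x - A y" "A 0 = 0"
proof -
  interpret additive A using assms by unfold_locales (simp add: continuous_linear_def)
  show "A (x - y) = A x - A y" "A 0 = 0" by (fact diff zero)+
qed

lemma continuous_linear_comp:
  assumes "continuous_linear s s' A" "continuous_linear s' s'' B"
  shows "continuous_linear s s'' (B \<circ> A)"
  using assms continuous_on_compose[of UNIV A B] continuous_on_subset[of UNIV B "range A"]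
  unfolding continuous_linear_def by (auto simp: comp_def)

lemma continuous_linear_Pair:
  assumes "continuous_linear s s' A" "continuous_linear s s'' B"
  shows "continuous_linear s (prod_scale s' s'') (\<lambda>x. (A x, B x))"
  using assms unfolding continuous_linear_def
  by (auto simp: prod_scale_def intro: continuous_on_Pair)

lemma continuous_linear_id: "continuous_linear s s (\<lambda>x. x)"
  by (simp add: continuous_linear_def)

lemma continuous_linear_fst: "continuous_linear (prod_scale s s') s fst"
  and continuous_linear_snd: "continuous_linear (prod_scale s s') s' snd"
  by (auto simp: continuous_linear_def prod_scale_def intro!: continuous_intros)

lemma continuous_linear_inl: "cont_module s' \<Longrightarrow> continuous_linear s (prod_scale s s') (\<lambda>x. (x, 0))"
  and continuous_linear_inr: "cont_module s \<Longrightarrow> continuous_linear s' (prod_scale s s') (\<lambda>x. (0, x))"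
  by (auto simp: continuous_linear_def prod_scale_def cont_module_def module.scale_zero_right
      intro!: continuous_intros)

section \<open>The tree encoding\<close>

lemma unnode_node [simp]: "unnode (node p) = p"
  by (cases p) (simp add: unnode_def node_def)

lemma leaf_value_leaf [simp]: "leaf_value (leaf x) = x"
  by (simp add: leaf_def leaf_value_def)

lemma (in cont_module) leaf_linear: "continuous_linear scale (tree_scale scale) leaf"
  unfolding continuous_linear_def
proof (intro conjI allI)
  show "continuous_on UNIV (leaf :: 'e \<Rightarrow> ('k, 'e) tree_point)"
  proof (rule continuous_on_coordinatewise_then_product)
    show "continuous_on UNIV (\<lambda>x. (leaf x :: ('k, 'e) tree_point) l)" for l
      unfolding leaf_def by (cases "l = []") (auto intro!: continuous_intros)
  qed
qed (auto simp: leaf_def tree_scale_def prod_scale_def plus_fun_def)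

lemma continuous_on_tree_coord: "continuous_on S (\<lambda>p :: ('k::topological_space, 'e::topological_space) tree_point. p l)"
  by (rule continuous_on_product_then_coordinatewise) (rule continuous_on_id)

lemma leaf_value_linear: "continuous_linear (tree_scale s) s leaf_value"
  unfolding continuous_linear_def leaf_value_def
  by (auto simp: tree_scale_def prod_scale_def plus_fun_def
      intro!: continuous_on_fst continuous_on_tree_coord)

definition point_part :: "('k, 'e) tree_point \<Rightarrow> ('k, 'e) tree_point"
  where "point_part p = (\<lambda>l. p (False # l))"

definition dir_part :: "('k, 'e) tree_point \<Rightarrow> ('k, 'e) tree_point"
  where "dir_part p = (\<lambda>l. p (True # l))"

definition param_part :: "('k, 'e) tree_point \<Rightarrow> 'k"
  where "param_part p = snd (p [])"

lemma unnode_parts: "unnode p = (point_part p, dir_part p, param_part p)"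
  by (simp add: unnode_def point_part_def dir_part_def param_part_def)

lemma parts_node [simp]:
  "point_part (node (a, b, t)) = a" "dir_part (node (a, b, t)) = b" "param_part (node (a, b, t)) = t"
  using unnode_node[of "(a, b, t)"] by (auto simp: unnode_parts)

lemma parts_linear:
  fixes s :: "'k::{comm_ring_1, topological_space} \<Rightarrow> 'e::{ab_group_add, topological_space} \<Rightarrow> 'e"
  shows "continuous_linear (tree_scale s) (tree_scale s) point_part"
    and "continuous_linear (tree_scale s) (tree_scale s) dir_part"
    and "continuous_linear (tree_scale s) (*) param_part"
  by (auto simp: continuous_linear_def point_part_def dir_part_def param_part_def tree_scale_def
      prod_scale_def plus_fun_def
      intro!: continuous_on_coordinatewise_then_product continuous_on_snd continuous_on_tree_coord)

lemma (in cont_module) node_linear: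
  "continuous_linear (prod_scale (tree_scale scale) (prod_scale (tree_scale scale) (*)))
    (tree_scale scale) node"
  unfolding continuous_linear_def
proof (intro conjI allI)
  show "continuous_on UNIV (node :: ('k, 'e) tree_point \<times> ('k, 'e) tree_point \<times> 'k \<Rightarrow> _)"
  proof (rule continuous_on_coordinatewise_then_product)
    show "continuous_on UNIV (\<lambda>x. (node x :: ('k, 'e) tree_point) l)" for l
    proof (cases l)
      case Nil
      then show ?thesis unfolding node_def case_prod_unfold
        by (auto intro!: continuous_intros)
    next
      case (Cons c l')
      have "continuous_on UNIV (\<lambda>x. fst x l')" "continuous_on UNIV (\<lambda>x. fst (snd x) l')"
        by (rule continuous_on_product_then_coordinatewise, intro continuous_intros)+
      then show ?thesis unfolding node_def case_prod_unfold Cons by (cases c) auto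
    qed
  qed
qed (auto simp: node_def tree_scale_def prod_scale_def plus_fun_def fun_eq_iff split: list.split)

text \<open>
  The modules \<open>E\<^sup>[\<^sup>n\<^sup>]\<close> are images of such projections.  They serve to move values of difference quotients
  into \<open>E\<^sup>[\<^sup>n\<^sup>]\<close>: on its own, a difference quotient of a map into a submodule is only known to take values there
  for invertible parameters.
\<close>

definition submodule_retraction ::
  "('k \<Rightarrow> 'e::{plus, topological_space} \<Rightarrow> 'e) \<Rightarrow> 'e set \<Rightarrow> ('e \<Rightarrow> 'e) \<Rightarrow> bool"
  where "submodule_retraction s W P \<longleftrightarrow>
    continuous_linear s s P \<and> range P \<subseteq> W \<and> (\<forall>x\<in>W. P x = x)"

lemma (in cont_module) retraction_leaf:
  "submodule_retraction (tree_scale scale) (range leaf) (leaf \<circ> leaf_value)"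
  using continuous_linear_comp[OF leaf_value_linear leaf_linear]
  by (auto simp: submodule_retraction_def)

lemma (in cont_module) retraction_node:
  assumes "submodule_retraction (tree_scale scale) W P"
  shows "submodule_retraction (tree_scale scale) (node ` (W \<times> W \<times> UNIV))
    (\<lambda>p. node (P (point_part p), P (dir_part p), param_part p))"
proof -
  have P: "continuous_linear (tree_scale scale) (tree_scale scale) P"
    using assms by (simp add: submodule_retraction_def)
  have "continuous_linear (tree_scale scale) (tree_scale scale)
      (node \<circ> (\<lambda>p. ((P \<circ> point_part) p, (P \<circ> dir_part) p, param_part p)))"
    by (intro continuous_linear_comp[OF _ node_linear] continuous_linear_Pair
        continuous_linear_comp[OF _ P] parts_linear)
  then show ?thesis
    using assms by (auto simp: submodule_retraction_def comp_def)
qed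

section \<open>Rules for maps of class \<open>C\<^sup>k\<close> on trees\<close>

lemma dq_domain_mono: "D \<subseteq> D' \<Longrightarrow> dq_domain s W D \<subseteq> dq_domain s W D'"
  by (auto simp: dq_domain_def)

lemma Ck_tree_subset:
  "Ck_tree s s' k W D f \<Longrightarrow> D' \<subseteq> D \<Longrightarrow> Ck_tree s s' k W D' f"
proof (induction k arbitrary: W D D' f)
  case 0
  then show ?case by (auto intro: continuous_on_subset)
next
  case (Suc k)
  from Suc.prems obtain g where g: "is_diff_quotient (tree_scale s) s' W D f g"
    "Ck_tree s s' k (node ` (W \<times> W \<times> UNIV)) (node ` dq_domain (tree_scale s) W D) (g \<circ> unnode)"
    by auto
  have "is_diff_quotient (tree_scale s) s' W D' f g"
    using g(1) dq_domain_mono[OF Suc.prems(2), of "tree_scale s" W]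
    unfolding is_diff_quotient_def by (blast intro: continuous_on_subset)
  moreover have "Ck_tree s s' k (node ` (W \<times> W \<times> UNIV)) (node ` dq_domain (tree_scale s) W D') (g \<circ> unnode)"
    by (rule Suc.IH[OF g(2)]) (intro image_mono dq_domain_mono Suc.prems)
  ultimately show ?case by auto
qed

lemma Ck_tree_cong:
  assumes "Ck_tree s s' k W D f" "\<And>x. x \<in> D \<Longrightarrow> f x = f' x"
  shows "Ck_tree s s' k W D f'"
proof (cases k)
  case 0
  then show ?thesis using assms by (simp cong: continuous_on_cong)
next
  case (Suc j)
  have "is_diff_quotient (tree_scale s) s' W D f' g" if "is_diff_quotient (tree_scale s) s' W D f g" for g
    using that assms(2) unfolding is_diff_quotient_def dq_domain_def by auto
  then show ?thesis using assms(1) unfolding Suc by auto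
qed

lemma Ck_tree_post_linear:
  assumes A: "continuous_linear s' s'' A"
  shows "Ck_tree s s' k W D f \<Longrightarrow> Ck_tree s s'' k W D (A \<circ> f)"
proof (induction k arbitrary: W D f)
  case 0
  then show ?case
    using continuous_on_compose[of D f A] continuous_linearD(3)[OF A] by auto
next
  case (Suc k)
  from Suc.prems obtain g where g: "is_diff_quotient (tree_scale s) s' W D f g"
    "Ck_tree s s' k (node ` (W \<times> W \<times> UNIV)) (node ` dq_domain (tree_scale s) W D) (g \<circ> unnode)"
    by auto
  have "is_diff_quotient (tree_scale s) s'' W D (A \<circ> f) (A \<circ> g)"
    unfolding is_diff_quotient_def
  proof (intro conjI ballI, goal_cases)
    case 1
    show ?case using g(1) continuous_on_compose[of _ g A] continuous_linearD(3)[OF A]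
      unfolding is_diff_quotient_def by blast
  next
    case (2 p)
    then show ?case using g(1)
      by (cases p) (auto simp: is_diff_quotient_def continuous_linear_diff[OF A, symmetric]
          continuous_linearD(2)[OF A, symmetric])
  qed
  with Suc.IH[OF g(2)] show ?case
    unfolding Ck_tree.simps by (intro exI[of _ "A \<circ> g"]) (simp add: comp_def)
qed

lemma (in cont_module) Ck_tree_add:
  "Ck_tree s scale k W D f \<Longrightarrow> Ck_tree s scale k W D f' \<Longrightarrow> Ck_tree s scale k W D (\<lambda>x. f x + f' x)"
proof (induction k arbitrary: W D f f')
  case 0
  then show ?case by (auto intro: continuous_on_plus)
next
  case (Suc k)
  from Suc.prems obtain g where g: "is_diff_quotient (tree_scale s) scale W D f g"
    "Ck_tree s scale k (node ` (W \<times> W \<times> UNIV)) (node ` dq_domain (tree_scale s) W D) (g \<circ> unnode)"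
    by auto
  from Suc.prems obtain g' where g': "is_diff_quotient (tree_scale s) scale W D f' g'"
    "Ck_tree s scale k (node ` (W \<times> W \<times> UNIV)) (node ` dq_domain (tree_scale s) W D) (g' \<circ> unnode)"
    by auto
  have "is_diff_quotient (tree_scale s) scale W D (\<lambda>x. f x + f' x) (\<lambda>p. g p + g' p)"
    unfolding is_diff_quotient_def
  proof (intro conjI ballI, goal_cases)
    case 1
    show ?case using g(1) g'(1) unfolding is_diff_quotient_def by (intro continuous_on_plus) auto
  next
    case (2 p)
    then obtain x v t where p: "p = (x, v, t)" and
      "f (x + tree_scale s t v) - f x = scale t (g (x, v, t))"
      "f' (x + tree_scale s t v) - f' x = scale t (g' (x, v, t))"
      using bspec[OF conjunct2[OF g(1)[unfolded is_diff_quotient_def]], of p]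
        bspec[OF conjunct2[OF g'(1)[unfolded is_diff_quotient_def]], of p]
      by (cases p) auto
    then show ?case by (simp add: p scale_right_distrib add_diff_add del: scale_scale)
  qed
  with Suc.IH[OF g(2) g'(2)] show ?case
    by (auto simp: comp_def intro!: exI[of _ "\<lambda>p. g p + g' p"])
qed

lemma Ck_tree_Pair:
  assumes "cont_module s'" "cont_module s''" "Ck_tree s s' k W D f" "Ck_tree s s'' k W D g"
  shows "Ck_tree s (prod_scale s' s'') k W D (\<lambda>x. (f x, g x))"
  using cont_module.Ck_tree_add[OF cont_module_prod[OF assms(1,2)]
      Ck_tree_post_linear[OF continuous_linear_inl[OF assms(2)] assms(3)]
      Ck_tree_post_linear[OF continuous_linear_inr[OF assms(1)] assms(4)]]
  by (simp add: comp_def)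

lemma Ck_tree_linear:
  fixes s :: "'k::{comm_ring_1, topological_space} \<Rightarrow> 'e::{ab_group_add, topological_space} \<Rightarrow> 'e"
    and A :: "('k, 'e) tree_point \<Rightarrow> 'f::{ab_group_add, topological_space}"
  assumes "continuous_linear (tree_scale s) s' A"
  shows "Ck_tree s s' k W D A"
  using assms
proof (induction k arbitrary: W D A)
  case 0
  then show ?case by (simp add: continuous_linearD(3))
next
  case (Suc k)
  have "is_diff_quotient (tree_scale s) s' W D A (\<lambda>(x, v, t). A v)"
    unfolding is_diff_quotient_def
  proof (intro conjI ballI, goal_cases)
    case 1
    show ?case unfolding case_prod_unfold
      by (rule continuous_on_compose2[OF continuous_linearD(3)[OF Suc.prems, of UNIV]])
        (simp_all add: continuous_on_fst continuous_on_snd continuous_on_id)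
  qed (use Suc.prems in \<open>auto simp: continuous_linear_def\<close>)
  moreover have "(\<lambda>(x, v, t). A v) \<circ> unnode = A \<circ> dir_part"
    by (auto simp: unnode_parts)
  ultimately show ?case
    using Suc.IH[OF continuous_linear_comp[OF parts_linear(2) Suc.prems]]
    unfolding Ck_tree.simps by (intro exI[of _ "\<lambda>(x, v, t). A v"]) (simp add: comp_def)
qed

lemma (in cont_module) Ck_tree_const: "Ck_tree s scale k W D (\<lambda>x. c)"
proof (cases k)
  case 0
  then show ?thesis by simp
next
  case (Suc j)
  have 0: "Ck_tree s scale j W D (\<lambda>x. 0)" for W D
  proof (induction j arbitrary: W D)
    case (Suc j)
    then show ?case
      by (auto simp: is_diff_quotient_def comp_def intro!: exI[of _ "\<lambda>x. 0"])
  qed simp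
  then show ?thesis unfolding Suc
    by (auto simp: is_diff_quotient_def comp_def intro!: exI[of _ "\<lambda>x. 0"])
qed

text \<open>With parameter 1, the quotient yields \<open>f y = f x + g (x, y - x, 1)\<close>.\<close>

lemma is_diff_quotient_imp_continuous_on:
  assumes s: "cont_module s" and s': "cont_module s'"
    and g: "is_diff_quotient s s' W D f g" and W: "\<And>x y. x \<in> D \<Longrightarrow> y \<in> D \<Longrightarrow> y - x \<in> W"
  shows "continuous_on D f"
proof (cases "D = {}")
  case False
  then obtain x where x: "x \<in> D" by blast
  interpret s: cont_module s by (rule s)
  interpret s': cont_module s' by (rule s')
  have eq: "f x + g (x, y - x, 1) = f y" if "y \<in> D" for y
  proof -
    have "(x, y - x, 1) \<in> dq_domain s W D" using that x W by (simp add: dq_domain_def)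
    then have "f (x + s 1 (y - x)) - f x = s' 1 (g (x, y - x, 1))"
      using g unfolding is_diff_quotient_def by blast
    then show ?thesis by (simp add: algebra_simps)
  qed
  have "continuous_on D (\<lambda>y. f x + g (x, y - x, 1))"
  proof (intro s'.continuous_on_plus continuous_on_const)
    have "continuous_on (dq_domain s W D) g" using g by (simp add: is_diff_quotient_def)
    then show "continuous_on D (\<lambda>y. g (x, y - x, 1))"
      by (rule continuous_on_compose2)
        (auto intro!: continuous_intros s.continuous_on_minus simp: dq_domain_def x W)
  qed
  then show ?thesis by (simp add: eq cong: continuous_on_cong)
qed simp

lemma is_diff_quotient_tree_imp_continuous_on:
  assumes s: "cont_module s" and s': "cont_module s'"
    and g: "is_diff_quotient (tree_scale s) s' W D f g"
    and D: "D \<subseteq> W" and ret: "submodule_retraction (tree_scale s) W P"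
  shows "continuous_on D f"
proof -
  have P: "continuous_linear (tree_scale s) (tree_scale s) P"
    and W: "range P \<subseteq> W" "\<And>x. x \<in> W \<Longrightarrow> P x = x"
    using ret by (auto simp: submodule_retraction_def)
  have "y - x \<in> W" if "x \<in> D" "y \<in> D" for x y
  proof -
    have "P (y - x) = y - x"
      using that D W(2) by (simp add: continuous_linear_diff[OF P] subset_iff)
    then show ?thesis using W(1) by (metis rangeI subsetD)
  qed
  then show ?thesis
    using is_diff_quotient_imp_continuous_on[OF cont_module_tree[OF s] s' g] by simp
qed

lemma Ck_tree_Suc_imp:
  assumes s: "cont_module s" and s': "cont_module s'"
  shows "Ck_tree s s' (Suc k) W D f \<Longrightarrow> D \<subseteq> W \<Longrightarrow> submodule_retraction (tree_scale s) W P \<Longrightarrow>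
    Ck_tree s s' k W D f"
proof (induction k arbitrary: W D f P)
  case 0
  then obtain g where g: "is_diff_quotient (tree_scale s) s' W D f g" by auto
  with is_diff_quotient_tree_imp_continuous_on[OF s s' g 0(2,3)] show ?case by simp
next
  case (Suc k)
  from Suc.prems(1) obtain g where g: "is_diff_quotient (tree_scale s) s' W D f g"
    "Ck_tree s s' (Suc k) (node ` (W \<times> W \<times> UNIV)) (node ` dq_domain (tree_scale s) W D) (g \<circ> unnode)"
    by auto
  have "node ` dq_domain (tree_scale s) W D \<subseteq> node ` (W \<times> W \<times> UNIV)"
    using Suc.prems(2) by (auto simp: dq_domain_def)
  from Suc.IH[OF g(2) this cont_module.retraction_node[OF s Suc.prems(3)]] g(1)
  show ?case by (subst Ck_tree.simps) (rule exI[of _ g], rule conjI)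
qed

text \<open>
  The difference quotient of \<open>f \<circ> A\<close> is that of \<open>f\<close> after \<open>A \<times> A \<times> id\<close>, which again is linear.  The chain
  rule needs this for the projection of a node to its base point: that map stays among the trees over \<open>E\<close>,
  whereas the induction there is for maps from trees over \<open>E\<close> to trees over \<open>F\<close>.
\<close>

lemma Ck_tree_pre_linear:
  fixes s :: "'k::{comm_ring_1, topological_ab_group_add, topological_semigroup_mult}
      \<Rightarrow> 'e::{ab_group_add, topological_space} \<Rightarrow> 'e"
    and s' :: "'k \<Rightarrow> 'f::{ab_group_add, topological_space} \<Rightarrow> 'f"
    and s'' :: "'k \<Rightarrow> 'g::{ab_group_add, topological_space} \<Rightarrow> 'g"
  assumes s': "cont_module s'"
  shows "Ck_tree s' s'' k W' D' f \<Longrightarrow> continuous_linear (tree_scale s) (tree_scale s') A \<Longrightarrow>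
    A ` W \<subseteq> W' \<Longrightarrow> A ` D \<subseteq> D' \<Longrightarrow> Ck_tree s s'' k W D (f \<circ> A)"
proof (induction k arbitrary: W D f W' D' A)
  case 0
  then show ?case
    using continuous_on_subset[of D' f "A ` D"] continuous_on_compose[of D A f]
      continuous_linearD(3)[of "tree_scale s" "tree_scale s'" A D]
    by (simp add: comp_def)
next
  case (Suc k)
  from Suc.prems obtain f1 where f1: "is_diff_quotient (tree_scale s') s'' W' D' f f1"
    "Ck_tree s' s'' k (node ` (W' \<times> W' \<times> UNIV)) (node ` dq_domain (tree_scale s') W' D') (f1 \<circ> unnode)"
    by auto
  define h where "h = (\<lambda>(x, v, t :: 'k). (A x, A v, t))"
  have h: "h p \<in> dq_domain (tree_scale s') W' D'" if "p \<in> dq_domain (tree_scale s) W D" for p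
  proof (cases p)
    case (fields x v t)
    then have "x \<in> D" "v \<in> W" "x + tree_scale s t v \<in> D" using that by (auto simp: dq_domain_def)
    then have "A x \<in> D'" "A v \<in> W'" "A x + tree_scale s' t (A v) \<in> D'"
      using Suc.prems(3,4) unfolding continuous_linearD(1,2)[OF Suc.prems(2), symmetric] by blast+
    then show ?thesis unfolding h_def fields dq_domain_def by simp
  qed
  have "continuous_linear (tree_scale s) (tree_scale s')
      (node \<circ> (\<lambda>p. ((A \<circ> point_part) p, (A \<circ> dir_part) p, param_part p)))"
    by (intro continuous_linear_comp[OF _ cont_module.node_linear[OF s']] continuous_linear_Pair
        continuous_linear_comp[OF _ Suc.prems(2)] parts_linear)
  also have "(node \<circ> (\<lambda>p. ((A \<circ> point_part) p, (A \<circ> dir_part) p, param_part p))) = node \<circ> h \<circ> unnode"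
    by (auto simp: h_def unnode_parts)
  finally have "Ck_tree s s'' k (node ` (W \<times> W \<times> UNIV)) (node ` dq_domain (tree_scale s) W D)
      ((f1 \<circ> unnode) \<circ> (node \<circ> h \<circ> unnode))"
  proof (rule Suc.IH[OF f1(2)])
    show "(node \<circ> h \<circ> unnode) ` node ` (W \<times> W \<times> UNIV) \<subseteq> node ` (W' \<times> W' \<times> UNIV)"
      using Suc.prems(3) by (auto simp: h_def intro!: imageI)
  qed (use h in auto)
  then have "Ck_tree s s'' k (node ` (W \<times> W \<times> UNIV)) (node ` dq_domain (tree_scale s) W D)
      ((f1 \<circ> h) \<circ> unnode)"
    by (rule Ck_tree_cong) simp
  moreover have "is_diff_quotient (tree_scale s) s'' W D (f \<circ> A) (f1 \<circ> h)"
    unfolding is_diff_quotient_def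
  proof (intro conjI ballI, goal_cases)
    case 1
    have "continuous_on (dq_domain (tree_scale s) W D) h"
      unfolding h_def case_prod_unfold
      by (intro continuous_on_Pair continuous_on_compose2[OF continuous_linearD(3)[OF Suc.prems(2), of UNIV]])
        (simp_all add: continuous_on_fst continuous_on_snd continuous_on_id)
    moreover have "h ` dq_domain (tree_scale s) W D \<subseteq> dq_domain (tree_scale s') W' D'"
      using h by blast
    ultimately show ?case using f1(1) unfolding is_diff_quotient_def
      by (meson continuous_on_compose continuous_on_subset)
  next
    case (2 p)
    then obtain x v t where p: "p = (x, v, t)" "(x, v, t) \<in> dq_domain (tree_scale s) W D"
      by (cases p) auto
    have "f (A x + tree_scale s' t (A v)) - f (A x) = s'' t (f1 (A x, A v, t))"
      using f1(1) h[OF p(2)] by (auto simp: is_diff_quotient_def h_def)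
    then show ?case by (simp add: p h_def continuous_linearD(1,2)[OF Suc.prems(2)])
  qed
  ultimately show ?case by (subst Ck_tree.simps) (rule exI[of _ "f1 \<circ> h"], rule conjI)
qed

text \<open>
  Chain rule.  As \<open>(g \<circ> f)\<^sup>[\<^sup>1\<^sup>](x, v, t) = g\<^sup>[\<^sup>1\<^sup>](f x, f\<^sup>[\<^sup>1\<^sup>](x, v, t), t)\<close>, the induction hypothesis applies to \<open>g\<^sup>[\<^sup>1\<^sup>]\<close> and
  the map \<open>(x, v, t) \<mapsto> (f x, f\<^sup>[\<^sup>1\<^sup>](x, v, t), t)\<close>.
\<close>

lemma Ck_tree_comp:
  fixes s :: "'k::{comm_ring_1, topological_ab_group_add, topological_semigroup_mult}
      \<Rightarrow> 'e::{ab_group_add, topological_space} \<Rightarrow> 'e"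
    and s' :: "'k \<Rightarrow> 'f::{ab_group_add, topological_space} \<Rightarrow> 'f"
    and s'' :: "'k \<Rightarrow> 'g::{ab_group_add, topological_space} \<Rightarrow> 'g"
  assumes s: "cont_module s" and s': "cont_module s'"
  shows "Ck_tree s (tree_scale s') k W D f \<Longrightarrow> Ck_tree s' s'' k W' D' g \<Longrightarrow>
    f ` D \<subseteq> D' \<Longrightarrow> D \<subseteq> W \<Longrightarrow> D' \<subseteq> W' \<Longrightarrow>
    submodule_retraction (tree_scale s) W P \<Longrightarrow> submodule_retraction (tree_scale s') W' P' \<Longrightarrow>
    Ck_tree s s'' k W D (g \<circ> f)"
proof (induction k arbitrary: W D f W' D' g P P')
  case 0
  then show ?case using continuous_on_compose[of D f g] continuous_on_subset[of D' g "f ` D"] by auto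
next
  case (Suc k)
  interpret T: cont_module "tree_scale s'" by (rule cont_module_tree[OF s'])
  from Suc.prems(1) obtain f1 where f1: "is_diff_quotient (tree_scale s) (tree_scale s') W D f f1"
    "Ck_tree s (tree_scale s') k (node ` (W \<times> W \<times> UNIV)) (node ` dq_domain (tree_scale s) W D) (f1 \<circ> unnode)"
    by auto
  from Suc.prems(2) obtain g1 where g1: "is_diff_quotient (tree_scale s') s'' W' D' g g1"
    "Ck_tree s' s'' k (node ` (W' \<times> W' \<times> UNIV)) (node ` dq_domain (tree_scale s') W' D') (g1 \<circ> unnode)"
    by auto
  have P': "continuous_linear (tree_scale s') (tree_scale s') P'"
    and W': "range P' \<subseteq> W'" "\<And>x. x \<in> W' \<Longrightarrow> P' x = x"
    using Suc.prems(7) by (auto simp: submodule_retraction_def)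
  define dq where "dq = dq_domain (tree_scale s) W D"
  define W1 where "W1 = node ` (W \<times> W \<times> (UNIV :: 'k set))"
  \<comment> \<open>The difference quotient need not take values in \<open>W'\<close>, but may be replaced by its projection.\<close>
  define f1' where "f1' = P' \<circ> f1"
  have f1': "f (x + tree_scale s t v) = f x + tree_scale s' t (f1' (x, v, t))"
    if "(x, v, t) \<in> dq" for x v t
  proof -
    have D: "f x \<in> W'" "f (x + tree_scale s t v) \<in> W'"
      using that Suc.prems(3,5) by (auto simp: dq_def dq_domain_def)
    have "f (x + tree_scale s t v) - f x = tree_scale s' t (f1 (x, v, t))"
      using f1(1) that by (auto simp: is_diff_quotient_def dq_def)
    then have "P' (f (x + tree_scale s t v)) - P' (f x) = tree_scale s' t (f1' (x, v, t))"
      by (metis continuous_linear_diff(1)[OF P'] continuous_linearD(2)[OF P'] f1'_def comp_apply)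
    then show ?thesis using D W'(2) by (simp add: algebra_simps)
  qed
  define h where "h = (\<lambda>(x, v, t). (f x, f1' (x, v, t), t))"
  have h: "h p \<in> dq_domain (tree_scale s') W' D'" if "p \<in> dq" for p
  proof (cases p)
    case (fields x v t)
    have "f x \<in> D'" "f (x + tree_scale s t v) \<in> D'"
      using that Suc.prems(3) by (auto simp: dq_def dq_domain_def fields)
    moreover have "f1' p \<in> W'" using W'(1) by (auto simp: f1'_def)
    ultimately show ?thesis using f1'[of x v t] that
      by (simp add: h_def fields dq_domain_def)
  qed
  have sub: "node ` dq \<subseteq> W1" using Suc.prems(4) by (auto simp: dq_def dq_domain_def W1_def)
  have h_smooth: "Ck_tree s (tree_scale s') k W1 (node ` dq) (node \<circ> h \<circ> unnode)"
  proof -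
    have "Ck_tree s (tree_scale s') k W D f"
      by (rule Ck_tree_Suc_imp[OF s cont_module_tree[OF s'] Suc.prems(1,4,6)])
    then have "Ck_tree s (tree_scale s') k W1 (node ` dq) (f \<circ> point_part)"
      by (rule Ck_tree_pre_linear[OF s _ parts_linear(1)])
        (use Suc.prems(4) in \<open>auto simp: dq_def dq_domain_def W1_def\<close>)
    moreover have "Ck_tree s (tree_scale s') k W1 (node ` dq) (P' \<circ> (f1 \<circ> unnode))"
      by (rule Ck_tree_post_linear[OF P' f1(2)[folded dq_def W1_def]])
    ultimately have "Ck_tree s (tree_scale s') k W1 (node ` dq)
        (node \<circ> (\<lambda>p. ((f \<circ> point_part) p, (P' \<circ> (f1 \<circ> unnode)) p, param_part p)))"
      by (intro Ck_tree_post_linear[OF cont_module.node_linear[OF s']] Ck_tree_Pair cont_module_prod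
          cont_module_ring T.cont_module_axioms Ck_tree_linear[OF parts_linear(3)])
    then show ?thesis
      by (rule Ck_tree_cong) (auto simp: h_def f1'_def unnode_parts)
  qed
  have "Ck_tree s s'' k W1 (node ` dq) ((g1 \<circ> unnode) \<circ> (node \<circ> h \<circ> unnode))"
  proof (rule Suc.IH[OF h_smooth g1(2)])
    show "submodule_retraction (tree_scale s) W1
        (\<lambda>p. node (P (point_part p), P (dir_part p), param_part p))"
      unfolding W1_def by (rule cont_module.retraction_node[OF s Suc.prems(6)])
    show "submodule_retraction (tree_scale s') (node ` (W' \<times> W' \<times> UNIV))
        (\<lambda>p. node (P' (point_part p), P' (dir_part p), param_part p))"
      by (rule cont_module.retraction_node[OF s' Suc.prems(7)])
  qed (use sub h Suc.prems(5) in \<open>auto simp: dq_domain_def\<close>)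
  then have "Ck_tree s s'' k W1 (node ` dq) ((g1 \<circ> h) \<circ> unnode)"
    by (rule Ck_tree_cong) simp
  moreover have "is_diff_quotient (tree_scale s) s'' W D (g \<circ> f) (g1 \<circ> h)"
    unfolding is_diff_quotient_def
  proof (intro conjI ballI, goal_cases)
    case 1
    have "continuous_on dq f1'"
      using f1(1) continuous_on_compose[of dq f1 P'] continuous_linearD(3)[OF P']
      unfolding is_diff_quotient_def dq_def f1'_def by blast
    moreover have "continuous_on D f"
      by (rule is_diff_quotient_tree_imp_continuous_on[OF s cont_module_tree[OF s'] f1(1) Suc.prems(4,6)])
    then have "continuous_on dq (\<lambda>x. f (fst x))"
      by (rule continuous_on_compose2[OF _ continuous_on_fst[OF continuous_on_id]])
        (auto simp: dq_def dq_domain_def)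
    ultimately have "continuous_on dq h"
      unfolding h_def case_prod_unfold by (auto intro!: continuous_intros)
    moreover have "h ` dq \<subseteq> dq_domain (tree_scale s') W' D'"
      using h by blast
    ultimately show ?case using g1(1) unfolding is_diff_quotient_def dq_def[symmetric]
      by (meson continuous_on_compose continuous_on_subset)
  next
    case (2 p)
    then obtain x v t where p: "p = (x, v, t)" "(x, v, t) \<in> dq" by (cases p) (auto simp: dq_def)
    have "g (f x + tree_scale s' t (f1' (x, v, t))) - g (f x) = s'' t (g1 (f x, f1' (x, v, t), t))"
      using g1(1) h[OF p(2)] by (auto simp: is_diff_quotient_def h_def)
    then show ?case by (simp add: p f1'[OF p(2)] h_def)
  qed
  ultimately show ?case unfolding W1_def dq_def
    by (subst Ck_tree.simps) (rule exI[of _ "g1 \<circ> h"], rule conjI)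
qed

section \<open>Maps of class \<open>C\<^sup>k\<close> on open sets\<close>

lemma Ck_subset: "Ck s s' k U f \<Longrightarrow> U' \<subseteq> U \<Longrightarrow> Ck s s' k U' f"
  unfolding Ck_def by (erule Ck_tree_subset) (rule image_mono)

lemma Ck_cong: "Ck s s' k U f \<Longrightarrow> (\<And>x. x \<in> U \<Longrightarrow> f x = f' x) \<Longrightarrow> Ck s s' k U f'"
  unfolding Ck_def by (erule Ck_tree_cong) auto

lemma Ck_linear:
  assumes "continuous_linear s s' A"
  shows "Ck s s' k U A"
  unfolding Ck_def by (rule Ck_tree_linear[OF continuous_linear_comp[OF leaf_value_linear assms]])

lemma Ck_const:
  assumes "cont_module s'"
  shows "Ck s s' k U (\<lambda>x. c)"
  unfolding Ck_def comp_def by (rule cont_module.Ck_tree_const[OF assms])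

lemma Ck_add:
  assumes "cont_module s'" "Ck s s' k U f" "Ck s s' k U g"
  shows "Ck s s' k U (\<lambda>x. f x + g x)"
  using cont_module.Ck_tree_add[OF assms(1), of s k _ _ "f \<circ> leaf_value" "g \<circ> leaf_value"] assms(2,3)
  unfolding Ck_def by (simp add: comp_def)

lemma Ck_post_linear:
  assumes "continuous_linear s' s'' A" "Ck s s' k U f"
  shows "Ck s s'' k U (A \<circ> f)"
  using Ck_tree_post_linear[OF assms(1)] assms(2) unfolding Ck_def comp_assoc by blast

lemma Ck_comp:
  fixes s :: "'k::{comm_ring_1, topological_ab_group_add, topological_semigroup_mult}
      \<Rightarrow> 'e::{ab_group_add, topological_space} \<Rightarrow> 'e"
    and s' :: "'k \<Rightarrow> 'f::{ab_group_add, topological_space} \<Rightarrow> 'f"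
  assumes s: "cont_module s" and s': "cont_module s'"
    and f: "Ck s s' k U f" and g: "Ck s' s'' k V g" and sub: "f ` U \<subseteq> V"
  shows "Ck s s'' k U (g \<circ> f)"
proof -
  have "Ck_tree s (tree_scale s') k (range leaf) (leaf ` U) (leaf \<circ> (f \<circ> leaf_value))"
    using f unfolding Ck_def by (rule Ck_tree_post_linear[OF cont_module.leaf_linear[OF s']])
  then have "Ck_tree s s'' k (range leaf) (leaf ` U) ((g \<circ> leaf_value) \<circ> ((leaf :: 'f \<Rightarrow> ('k, 'f) tree_point) \<circ> (f \<circ> leaf_value)))"
  proof (rule Ck_tree_comp[OF s s'])
    show "Ck_tree s' s'' k (range leaf) (leaf ` V) (g \<circ> leaf_value)" using g by (simp add: Ck_def)
    show "submodule_retraction (tree_scale s) (range leaf) (leaf \<circ> leaf_value)"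
      by (rule cont_module.retraction_leaf[OF s])
    show "submodule_retraction (tree_scale s') (range leaf) (leaf \<circ> leaf_value)"
      by (rule cont_module.retraction_leaf[OF s'])
  qed (use sub in auto)
  then show ?thesis unfolding Ck_def by (rule Ck_tree_cong) auto
qed

lemma continuous_on_offset:
  assumes "cont_module s"
  shows "continuous_on UNIV (\<lambda>(x, v, t). x + s t v)"
proof -
  interpret cont_module s by fact
  show ?thesis unfolding case_prod_unfold
    by (intro continuous_on_plus continuous_on_scale) (auto intro!: continuous_intros)
qed

lemma open_dq_domain:
  assumes "cont_module s" "open W"
  shows "open (dq_domain s UNIV W)"
proof -
  have "dq_domain s UNIV W = (W \<times> UNIV) \<inter> (\<lambda>(x, v, t). x + s t v) -` W"
    by (auto simp: dq_domain_def)
  then show ?thesis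
    using assms open_vimage[OF assms(2) continuous_on_offset[OF assms(1)]]
    by (auto intro!: open_Int open_Times)
qed

text \<open>
  One level of the tree encoding is undone by composing with \<open>(x, v, t) \<mapsto> (leaf x, leaf v, t)\<close>.
\<close>

lemma Ck_Suc_diff_quotient:
  fixes s :: "'k::{comm_ring_1, topological_ab_group_add, topological_semigroup_mult}
      \<Rightarrow> 'e::{ab_group_add, topological_space} \<Rightarrow> 'e"
    and s' :: "'k \<Rightarrow> 'f::{ab_group_add, topological_space} \<Rightarrow> 'f"
  assumes s: "cont_module s" and s': "cont_module s'" and f: "Ck s s' (Suc k) U f"
  obtains g where "is_diff_quotient s s' UNIV U f g"
    and "Ck (prod_scale s (prod_scale s (*))) s' k (dq_domain s UNIV U) g"
proof -
  let ?dq = "dq_domain (tree_scale s) (range leaf) (leaf ` U)"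
  from f obtain G where G: "is_diff_quotient (tree_scale s) s' (range leaf) (leaf ` U) (f \<circ> leaf_value) G"
    "Ck_tree s s' k (node ` (range leaf \<times> range leaf \<times> UNIV)) (node ` ?dq) (G \<circ> unnode)"
    unfolding Ck_def by auto
  let ?S = "prod_scale s (prod_scale s ((*) :: 'k \<Rightarrow> _))"
  define A where "A = (\<lambda>(x :: 'e, v :: 'e, t :: 'k). (leaf x :: ('k, 'e) tree_point, leaf v :: ('k, 'e) tree_point, t))"
  have leaf: "continuous_linear s (tree_scale s) leaf"
    by (rule cont_module.leaf_linear[OF s])
  have A: "continuous_linear ?S (prod_scale (tree_scale s) (prod_scale (tree_scale s) (*))) A"
    using leaf unfolding A_def continuous_linear_def prod_scale_def case_prod_unfold
    by (auto intro!: continuous_on_Pair continuous_on_compose2[OF continuous_linearD(3)[OF leaf, of UNIV]]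
        continuous_on_fst continuous_on_snd continuous_on_id)
  have dq: "A p \<in> ?dq" if "p \<in> dq_domain s UNIV U" for p
    using that by (auto simp: A_def dq_domain_def continuous_linearD(1,2)[OF leaf, symmetric])
  have "is_diff_quotient s s' UNIV U f (G \<circ> A)"
    unfolding is_diff_quotient_def
  proof (intro conjI ballI, goal_cases)
    case 1
    have "A ` dq_domain s UNIV U \<subseteq> ?dq" using dq by blast
    then show ?case using G(1) continuous_linearD(3)[OF A]
      unfolding is_diff_quotient_def by (meson continuous_on_compose continuous_on_subset)
  next
    case (2 p)
    then obtain x v t where p: "p = (x, v, t)" by (cases p)
    have "(f \<circ> leaf_value) (leaf x + tree_scale s t (leaf v)) - (f \<circ> leaf_value) (leaf x) = s' t (G (A p))"
      using G(1) dq[OF 2] unfolding is_diff_quotient_def by (auto simp: p A_def)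
    then show ?case by (simp add: p flip: continuous_linearD(1,2)[OF leaf])
  qed
  moreover have "Ck ?S s' k (dq_domain s UNIV U) (G \<circ> A)"
  proof -
    have "continuous_linear (tree_scale ?S) (tree_scale s) (node \<circ> (A \<circ> leaf_value))"
      by (intro continuous_linear_comp[OF _ cont_module.node_linear[OF s]]
          continuous_linear_comp[OF leaf_value_linear A])
    from Ck_tree_pre_linear[OF s G(2) this, of "range leaf" "leaf ` dq_domain s UNIV U"]
    have "Ck_tree ?S s' k (range leaf) (leaf ` dq_domain s UNIV U) (G \<circ> unnode \<circ> (node \<circ> (A \<circ> leaf_value)))"
    proof this
      show "(node \<circ> (A \<circ> leaf_value)) ` range leaf \<subseteq> node ` (range leaf \<times> range leaf \<times> UNIV)"
        by (auto simp: A_def)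
      show "(node \<circ> (A \<circ> leaf_value)) ` leaf ` dq_domain s UNIV U \<subseteq> node ` ?dq"
        using dq by (auto simp: image_image)
    qed
    then show ?thesis unfolding Ck_def by (rule Ck_tree_cong) auto
  qed
  ultimately show ?thesis by (rule that)
qed

section \<open>Smoothness at a point\<close>

definition smooth_at ::
  "('k::{comm_ring_1, topological_space} \<Rightarrow> 'e::{ab_group_add, topological_space} \<Rightarrow> 'e) \<Rightarrow>
   ('k \<Rightarrow> 'f::{ab_group_add, topological_space} \<Rightarrow> 'f) \<Rightarrow> ('e \<Rightarrow> 'f) \<Rightarrow> 'e \<Rightarrow> bool"
  where "smooth_at s s' f x \<longleftrightarrow> (\<exists>W. open W \<and> x \<in> W \<and> (\<forall>k. Ck s s' k W f))"

lemma locally_smooth_iff: "locally_smooth s s' U f \<longleftrightarrow> open U \<and> (\<forall>x\<in>U. smooth_at s s' f x)"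
proof
  assume *: "locally_smooth s s' U f"
  show "open U \<and> (\<forall>x\<in>U. smooth_at s s' f x)"
  proof
    show "open U" by (rule iffD2[OF open_subopen]) (use * in \<open>unfold locally_smooth_def, blast\<close>)
    show "\<forall>x\<in>U. smooth_at s s' f x"
    proof
      fix x assume "x \<in> U"
      with * obtain W where "open W" "x \<in> W" "\<forall>k. Ck s s' k W f" unfolding locally_smooth_def by blast
      then show "smooth_at s s' f x" unfolding smooth_at_def by blast
    qed
  qed
next
  assume *: "open U \<and> (\<forall>x\<in>U. smooth_at s s' f x)"
  show "locally_smooth s s' U f" unfolding locally_smooth_def
  proof
    fix x assume "x \<in> U"
    with * obtain W where "open W" "x \<in> W" "\<forall>k. Ck s s' k W f" unfolding smooth_at_def by blast
    with * \<open>x \<in> U\<close> show "\<exists>W. open W \<and> x \<in> W \<and> W \<subseteq> U \<and> (\<forall>k. Ck s s' k W f)"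
      by (intro exI[of _ "W \<inter> U"]) (auto intro: Ck_subset[OF _ Int_lower1])
  qed
qed

lemma smooth_at_eventually:
  assumes "smooth_at s s' f x"
  shows "\<forall>\<^sub>F y in nhds x. smooth_at s s' f y"
  using assms unfolding smooth_at_def eventually_nhds by blast

lemma smooth_at_cong:
  assumes f: "smooth_at s s' f x" and eq: "\<forall>\<^sub>F y in nhds x. f y = f' y"
  shows "smooth_at s s' f' x"
proof -
  obtain W where W: "open W" "x \<in> W" "\<And>k. Ck s s' k W f" using f unfolding smooth_at_def by blast
  obtain T where T: "open T" "x \<in> T" "\<And>y. y \<in> T \<Longrightarrow> f y = f' y" using eq unfolding eventually_nhds by blast
  have "Ck s s' k (W \<inter> T) f'" for k
    using Ck_cong[OF Ck_subset[OF W(3)], of "W \<inter> T"] T(3) by auto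
  then show ?thesis unfolding smooth_at_def using W T by (intro exI[of _ "W \<inter> T"]) auto
qed

lemma smooth_at_linear:
  assumes "continuous_linear s s' A"
  shows "smooth_at s s' A x"
  using Ck_linear[OF assms] unfolding smooth_at_def by blast

lemma smooth_at_id: "smooth_at s s (\<lambda>x. x) x"
  by (rule smooth_at_linear[OF continuous_linear_id])

lemma smooth_at_const:
  assumes "cont_module s'"
  shows "smooth_at s s' (\<lambda>x. c) x"
  using Ck_const[OF assms] unfolding smooth_at_def by blast

lemma smooth_at_filterlim:
  fixes s :: "'k::{comm_ring_1, topological_ab_group_add, topological_semigroup_mult}
      \<Rightarrow> 'e::{ab_group_add, topological_space} \<Rightarrow> 'e"
    and s' :: "'k \<Rightarrow> 'f::{ab_group_add, topological_space} \<Rightarrow> 'f"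
  assumes "smooth_at s s' f x"
  shows "filterlim f (nhds (f x)) (nhds x)"
proof -
  obtain W where W: "open W" "x \<in> W" "Ck s s' 0 W f" using assms unfolding smooth_at_def by blast
  have "leaf_value ` leaf ` W = W" by force
  have "continuous_on UNIV (leaf :: 'e \<Rightarrow> ('k, 'e) tree_point)"
  proof (rule continuous_on_coordinatewise_then_product)
    show "continuous_on UNIV (\<lambda>x. (leaf x :: ('k, 'e) tree_point) l)" for l
      unfolding leaf_def by (cases "l = []") (auto intro!: continuous_intros)
  qed
  then have "continuous_on W (leaf :: 'e \<Rightarrow> ('k, 'e) tree_point)" by (rule continuous_on_subset) simp
  from continuous_on_compose[OF this, of "f \<circ> leaf_value"] W(3)
  have "continuous_on W f" by (auto simp: Ck_def comp_def)
  then have "(f \<longlongrightarrow> f x) (at x)"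
    using W by (metis continuous_on_def at_within_open)
  then show ?thesis by (simp add: tendsto_at_iff_tendsto_nhds)
qed

lemmas smooth_at_eventually_comp = eventually_compose_filterlim[OF _ smooth_at_filterlim]

lemma smooth_at_compose:
  assumes s: "cont_module s" and s': "cont_module s'"
    and g: "smooth_at s' s'' g (f x)" and f: "smooth_at s s' f x"
  shows "smooth_at s s'' (\<lambda>x. g (f x)) x"
proof -
  obtain V where V: "open V" "f x \<in> V" "\<And>k. Ck s' s'' k V g" using g unfolding smooth_at_def by blast
  obtain U where U: "open U" "x \<in> U" "\<And>k. Ck s s' k U f" using f unfolding smooth_at_def by blast
  have "\<forall>\<^sub>F y in nhds x. f y \<in> V"
    using eventually_nhds_in_open[OF V(1,2)] smooth_at_filterlim[OF f] by (rule eventually_compose_filterlim)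
  then obtain T where T: "open T" "x \<in> T" "\<And>y. y \<in> T \<Longrightarrow> f y \<in> V" unfolding eventually_nhds by blast
  have "Ck s s'' k (U \<inter> T) (g \<circ> f)" for k
    by (rule Ck_comp[OF s s' Ck_subset[OF U(3)] V(3)]) (use T in auto)
  then show ?thesis unfolding smooth_at_def comp_def using U T by (intro exI[of _ "U \<inter> T"]) auto
qed

lemma smooth_at_add:
  assumes "cont_module s'" "smooth_at s s' f x" "smooth_at s s' g x"
  shows "smooth_at s s' (\<lambda>x. f x + g x) x"
proof -
  obtain V where V: "open V" "x \<in> V" "\<And>k. Ck s s' k V g" using assms unfolding smooth_at_def by blast
  obtain U where U: "open U" "x \<in> U" "\<And>k. Ck s s' k U f" using assms unfolding smooth_at_def by blast
  have "Ck s s' k (U \<inter> V) (\<lambda>x. f x + g x)" for k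
    by (rule Ck_add[OF assms(1) Ck_subset[OF U(3)] Ck_subset[OF V(3)]]) auto
  then show ?thesis unfolding smooth_at_def using U V by (intro exI[of _ "U \<inter> V"]) auto
qed

lemma smooth_at_post_linear:
  assumes "continuous_linear s' s'' A" "smooth_at s s' f x"
  shows "smooth_at s s'' (\<lambda>x. A (f x)) x"
  using assms Ck_post_linear[OF assms(1)] unfolding smooth_at_def comp_def by blast

lemma smooth_at_Pair:
  assumes s': "cont_module s'" and s'': "cont_module s''"
    and f: "smooth_at s s' f x" and g: "smooth_at s s'' g x"
  shows "smooth_at s (prod_scale s' s'') (\<lambda>x. (f x, g x)) x"
proof -
  have "smooth_at s (prod_scale s' s'') (\<lambda>x. (f x, 0)) x"
    by (rule smooth_at_post_linear[OF continuous_linear_inl[OF s''] f])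
  moreover have "smooth_at s (prod_scale s' s'') (\<lambda>x. (0, g x)) x"
    by (rule smooth_at_post_linear[OF continuous_linear_inr[OF s'] g])
  ultimately show ?thesis
    using smooth_at_add[OF cont_module_prod[OF s' s''], of s "\<lambda>x. (f x, 0)" x "\<lambda>x. (0, g x)"] by simp
qed

lemma smooth_at_fst: "smooth_at s (prod_scale s' s'') f x \<Longrightarrow> smooth_at s s' (\<lambda>x. fst (f x)) x"
  and smooth_at_snd: "smooth_at s (prod_scale s' s'') f x \<Longrightarrow> smooth_at s s'' (\<lambda>x. snd (f x)) x"
  by (rule smooth_at_post_linear[OF continuous_linear_fst] smooth_at_post_linear[OF continuous_linear_snd]; assumption)+

lemma (in cont_module) continuous_linear_scale: "continuous_linear scale scale (scale t)"
  unfolding continuous_linear_def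
  by (auto simp: scale_right_distrib mult.commute intro!: continuous_on_scale continuous_intros)

lemma smooth_at_scale:
  assumes "cont_module s'" "smooth_at s s' f x"
  shows "smooth_at s s' (\<lambda>x. s' t (f x)) x"
  by (rule smooth_at_post_linear[OF cont_module.continuous_linear_scale[OF assms(1)] assms(2)])

lemma smooth_at_minus:
  assumes "cont_module s'" "smooth_at s s' f x"
  shows "smooth_at s s' (\<lambda>x. - f x) x"
proof -
  interpret cont_module s' by fact
  show ?thesis using smooth_at_scale[OF assms, of "- 1"] by simp
qed

lemma smooth_at_diff:
  assumes "cont_module s'" "smooth_at s s' f x" "smooth_at s s' g x"
  shows "smooth_at s s' (\<lambda>x. f x - g x) x"
  using smooth_at_add[OF assms(1,2) smooth_at_minus[OF assms(1,3)]] by simp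

section \<open>Differentials\<close>

text \<open>
  Differentials are unique because units accumulate at \<open>0\<close> and limits are unique in Hausdorff modules.
\<close>

locale calculus_module = topological_module scale
  for scale :: "'k::{comm_ring_1, topological_ab_group_add, topological_semigroup_mult}
      \<Rightarrow> 'e::{ab_group_add, t2_space} \<Rightarrow> 'e" +
  assumes dense_units: "closure {t :: 'k. t dvd 1} = UNIV"

lemma topological_module_cont_module: "topological_module s \<Longrightarrow> cont_module s"
  by (simp add: topological_module_def topological_module_axioms_def cont_module_def cont_module_axioms_def)

lemma calculus_module_cont_module: "calculus_module s \<Longrightarrow> cont_module s"
  by (simp add: calculus_module_def topological_module_cont_module)

lemma topological_module_prod:
  assumes "topological_module s" "topological_module s'"
  shows "topological_module (prod_scale s s')"
  using cont_module_prod[OF assms[THEN topological_module_cont_module]]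
  by (simp add: topological_module_def topological_module_axioms_def cont_module_def cont_module_axioms_def)

lemma calculus_module_prod:
  assumes "calculus_module s" "calculus_module s'"
  shows "calculus_module (prod_scale s s')"
  using assms topological_module_prod by (auto simp: calculus_module_def calculus_module_axioms_def)

text \<open>
  If \<open>p\<close> and \<open>q\<close> differed at \<open>a\<close>, they would differ on a neighbourhood of \<open>a\<close>, which contains a unit.
\<close>

lemma agree_on_units_imp_eq:
  fixes p q :: "'k::{comm_ring_1, topological_space} \<Rightarrow> 'f::t2_space"
  assumes dense: "closure {t :: 'k. t dvd 1} = UNIV"
    and T: "open T" "a \<in> T" and p: "continuous_on T p" and q: "continuous_on T q"
    and eq: "\<And>t. t \<in> T \<Longrightarrow> t dvd 1 \<Longrightarrow> p t = q t"
  shows "p a = q a"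
proof (rule ccontr)
  assume ne: "p a \<noteq> q a"
  have "open {(x :: 'f, y). x \<noteq> y}"
  proof -
    have "{(x :: 'f, y). x \<noteq> y} = - {y. \<exists>x :: 'f. y = (x, x)}" by auto
    then show ?thesis using closed_diagonal[where 'a = 'f] by (simp add: closed_def)
  qed
  then have "open (T \<inter> (\<lambda>t. (p t, q t)) -` {(x :: 'f, y). x \<noteq> y})"
    using continuous_on_open_vimage[OF T(1), of "\<lambda>t. (p t, q t)"] continuous_on_Pair[OF p q]
    by (auto simp: Int_commute)
  moreover have "a \<in> T \<inter> (\<lambda>t. (p t, q t)) -` {(x :: 'f, y). x \<noteq> y}" using ne T by auto
  moreover have "a \<in> closure {t :: 'k. t dvd 1}" using dense by simp
  ultimately obtain t where "t dvd 1" "t \<in> T" "p t \<noteq> q t"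
    unfolding closure_iff_nhds_not_empty by (force simp: disjoint_iff)
  with eq show False by blast
qed

lemma (in module) scale_unit_cancel: "t dvd 1 \<Longrightarrow> scale t x = scale t y \<Longrightarrow> x = y"
proof -
  assume "t dvd 1" and eq: "scale t x = scale t y"
  then obtain r where "1 = t * r" by (auto simp: dvd_def)
  then have "scale r (scale t z) = z" for z by (simp add: mult.commute)
  with eq show "x = y" by metis
qed

text \<open>
  For a unit \<open>t\<close>, division of the increment of \<open>f\<close> by \<open>t\<close> gives the value of the quotient; other parameters
  are limits of units.
\<close>

lemma diff_quotient_eqI:
  assumes s: "cont_module s" and s': "calculus_module s'"
    and W: "open W" and g: "is_diff_quotient s s' UNIV W f g" and p: "(x, v, a) \<in> dq_domain s UNIV W"
    and T: "open T" "a \<in> T" and y: "continuous_on T y"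
    and eq: "\<And>t. t \<in> T \<Longrightarrow> x + s t v \<in> W \<Longrightarrow> f (x + s t v) - f x = s' t (y t)"
  shows "g (x, v, a) = y a"
proof -
  interpret s: cont_module s by (rule s)
  interpret s': calculus_module s' by (rule s')
  have c: "continuous_on UNIV (\<lambda>t. (x, v, t))" by (intro continuous_intros)
  let ?T = "T \<inter> (\<lambda>t. (x, v, t)) -` dq_domain s UNIV W"
  show ?thesis
  proof (rule agree_on_units_imp_eq[OF s'.dense_units])
    show "open ?T" using T(1) open_vimage[OF open_dq_domain[OF s W] c] by blast
    show "a \<in> ?T" using p T by simp
    have "continuous_on (dq_domain s UNIV W) g" using g by (simp add: is_diff_quotient_def)
    then show "continuous_on ?T (\<lambda>t. g (x, v, t))"
      by (rule continuous_on_compose2[OF _ continuous_on_subset[OF c]]) auto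
    show "continuous_on ?T y" by (rule continuous_on_subset[OF y]) simp
    show "g (x, v, t) = y t" if "t \<in> ?T" "t dvd 1" for t
    proof -
      have "s' t (g (x, v, t)) = f (x + s t v) - f x"
        using that(1) g by (auto simp: is_diff_quotient_def)
      also have "\<dots> = s' t (y t)" using that(1) eq by (auto simp: dq_domain_def)
      finally show ?thesis using that(2) s'.scale_unit_cancel by blast
    qed
  qed
qed

lemma diff_quotient_unique:
  assumes s: "cont_module s" and s': "calculus_module s'"
    and W: "open W" "is_diff_quotient s s' UNIV W f g" "(x, v, a) \<in> dq_domain s UNIV W"
    and W': "open W'" "is_diff_quotient s s' UNIV W' f g'" "(x, v, a) \<in> dq_domain s UNIV W'"
  shows "g (x, v, a) = g' (x, v, a)"
proof (rule diff_quotient_eqI[OF s s' W])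
  have c: "continuous_on UNIV (\<lambda>t. (x, v, t))" by (intro continuous_intros)
  let ?T = "(\<lambda>t. (x, v, t)) -` dq_domain s UNIV W'"
  show "open ?T" using open_vimage[OF open_dq_domain[OF s W'(1)] c] .
  show "a \<in> ?T" using W' by simp
  have "continuous_on (dq_domain s UNIV W') g'" using W' by (simp add: is_diff_quotient_def)
  then show "continuous_on ?T (\<lambda>t. g' (x, v, t))"
    by (rule continuous_on_compose2[OF _ continuous_on_subset[OF c]]) auto
  show "f (x + s t v) - f x = s' t (g' (x, v, t))" if "t \<in> ?T" for t
    using that W'(2) by (auto simp: is_diff_quotient_def)
qed

lemma dq_domain_0: "cont_module s \<Longrightarrow> x \<in> W \<Longrightarrow> (x, v, 0) \<in> dq_domain s UNIV W"
  by (simp add: dq_domain_def cont_module_def module.scale_zero_left)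

lemma differential_diff_quotient:
  assumes s: "cont_module s" and s': "calculus_module s'"
    and W: "open W" "x \<in> W" "is_diff_quotient s s' UNIV W f g"
  shows "differential s s' f x v = g (x, v, 0)"
  unfolding differential_def
proof (rule the_equality)
  show "\<exists>W g'. open W \<and> x \<in> W \<and> is_diff_quotient s s' UNIV W f g' \<and> g (x, v, 0) = g' (x, v, 0)"
    using W by blast
  show "y = g (x, v, 0)"
    if "\<exists>W g. open W \<and> x \<in> W \<and> is_diff_quotient s s' UNIV W f g \<and> y = g (x, v, 0)" for y
    using that diff_quotient_unique[OF s s'] dq_domain_0[OF s] W by metis
qed

text \<open>
  The extended difference quotients found for the various orders \<open>k\<close> agree by uniqueness, so that a single
  one is of class \<open>C\<^sup>k\<close> for all \<open>k\<close>.
\<close>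

lemma smooth_at_diff_quotient:
  fixes s :: "'k::{comm_ring_1, topological_ab_group_add, topological_semigroup_mult}
      \<Rightarrow> 'e::{ab_group_add, topological_space} \<Rightarrow> 'e"
  assumes s: "cont_module s" and s': "calculus_module s'" and f: "smooth_at s s' f x"
  obtains W g where "open W" "x \<in> W" "is_diff_quotient s s' UNIV W f g"
    "\<And>p. p \<in> dq_domain s UNIV W \<Longrightarrow> smooth_at (prod_scale s (prod_scale s (*))) s' g p"
    "\<And>y v. y \<in> W \<Longrightarrow> differential s s' f y v = g (y, v, 0)"
proof -
  obtain W where W: "open W" "x \<in> W" "\<And>k. Ck s s' k W f" using f unfolding smooth_at_def by blast
  have "\<exists>g. is_diff_quotient s s' UNIV W f g \<and> Ck (prod_scale s (prod_scale s (*))) s' k (dq_domain s UNIV W) g" for k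
    using Ck_Suc_diff_quotient[OF s calculus_module_cont_module[OF s'] W(3)[of "Suc k"]] by metis
  then obtain G where G: "\<And>k. is_diff_quotient s s' UNIV W f (G k)"
    "\<And>k. Ck (prod_scale s (prod_scale s (*))) s' k (dq_domain s UNIV W) (G k)"
    by metis
  have "G k p = G 0 p" if "p \<in> dq_domain s UNIV W" for k p
    using that diff_quotient_unique[OF s s' W(1) G(1)[of k] _ W(1) G(1)[of 0]] by (cases p) auto
  then have Ck: "Ck (prod_scale s (prod_scale s (*))) s' k (dq_domain s UNIV W) (G 0)" for k
    by (rule Ck_cong[OF G(2)])
  show ?thesis
  proof (rule that[OF W(1,2) G(1)])
    show "smooth_at (prod_scale s (prod_scale s (*))) s' (G 0) p" if "p \<in> dq_domain s UNIV W" for p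
      using that Ck open_dq_domain[OF s W(1)] unfolding smooth_at_def by blast
  qed (rule differential_diff_quotient[OF s s' W(1) _ G(1)])
qed

lemma differential_eqI:
  assumes s: "cont_module s" and s': "calculus_module s'" and f: "smooth_at s s' f x"
    and T: "open T" "0 \<in> T" and y: "continuous_on T y"
    and eq: "\<And>t. t \<in> T \<Longrightarrow> f (x + s t v) - f x = s' t (y t)"
  shows "differential s s' f x v = y 0"
proof -
  obtain W g where W: "open W" "x \<in> W" "is_diff_quotient s s' UNIV W f g"
    "\<And>y v. y \<in> W \<Longrightarrow> differential s s' f y v = g (y, v, 0)"
    by (rule smooth_at_diff_quotient[OF s s' f]) blast
  show ?thesis
    unfolding W(4)[OF W(2)]
    by (rule diff_quotient_eqI[OF s s' W(1,3) dq_domain_0[OF s W(2)] T y eq])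
qed

text \<open>This applies to maps which are linear along the fibres of a bundle chart.\<close>

lemma differential_along_line:
  assumes "cont_module s" "calculus_module s'" "smooth_at s s' f x"
    and "\<And>t. f (x + s t v) - f x = s' t y"
  shows "differential s s' f x v = y"
  using differential_eqI[OF assms(1-3) open_UNIV UNIV_I continuous_on_const assms(4)] by simp

lemma differential_const: "cont_module s \<Longrightarrow> calculus_module s' \<Longrightarrow> differential s s' (\<lambda>x. c) x v = 0"
  by (rule differential_along_line)
    (auto simp: smooth_at_const calculus_module_cont_module calculus_module_def topological_module_def
      module.scale_zero_right)

lemma differential_linear:
  assumes s: "cont_module s" "calculus_module s'" and A: "continuous_linear s s' A"
  shows "differential s s' A x v = A v"
  by (rule differential_along_line[OF s smooth_at_linear[OF A]])
    (simp add: continuous_linearD(1,2)[OF A])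

lemma is_diff_quotient_subset:
  assumes g: "is_diff_quotient s s' V D f g" and sub: "D' \<subseteq> D" and eq: "\<And>x. x \<in> D' \<Longrightarrow> f x = f' x"
  shows "is_diff_quotient s s' V D' f' g"
  unfolding is_diff_quotient_def
proof (intro conjI ballI, goal_cases)
  case 1
  show ?case using g dq_domain_mono[OF sub, of s V] unfolding is_diff_quotient_def
    by (blast intro: continuous_on_subset)
next
  case (2 p)
  then obtain x v t where p: "p = (x, v, t)" "x \<in> D'" "x + s t v \<in> D'" by (auto simp: dq_domain_def)
  then have "f (x + s t v) - f x = s' t (g (x, v, t))"
    using g dq_domain_mono[OF sub, of s V] 2 unfolding is_diff_quotient_def by blast
  then show ?case using p eq by simp
qed

lemma differential_cong:
  assumes s: "cont_module s" "calculus_module s'" and f: "smooth_at s s' f x"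
    and eq: "\<forall>\<^sub>F y in nhds x. f y = f' y"
  shows "differential s s' f' x v = differential s s' f x v"
proof -
  obtain W g where W: "open W" "x \<in> W" "is_diff_quotient s s' UNIV W f g"
    "\<And>y v. y \<in> W \<Longrightarrow> differential s s' f y v = g (y, v, 0)"
    by (rule smooth_at_diff_quotient[OF s f]) blast
  obtain U where U: "open U" "x \<in> U" "\<And>y. y \<in> U \<Longrightarrow> f y = f' y"
    using eq unfolding eventually_nhds by blast
  have "is_diff_quotient s s' UNIV (W \<inter> U) f' g"
    by (rule is_diff_quotient_subset[OF W(3)]) (use U(3) in auto)
  from differential_diff_quotient[OF s _ _ this, of x v] W(1,2) U(1,2) W(4)[OF W(2)]
  show ?thesis by auto
qed

lemma differential_compose:
  assumes s: "cont_module s" and s': "calculus_module s'" and s'': "calculus_module s''"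
    and g: "smooth_at s' s'' g (f x)" and f: "smooth_at s s' f x"
  shows "differential s s'' (\<lambda>x. g (f x)) x v = differential s' s'' g (f x) (differential s s' f x v)"
proof -
  interpret s: cont_module s by (rule s)
  have c': "cont_module s'" by (rule calculus_module_cont_module[OF s'])
  obtain U f1 where U: "open U" "x \<in> U" "is_diff_quotient s s' UNIV U f f1"
    "\<And>y v. y \<in> U \<Longrightarrow> differential s s' f y v = f1 (y, v, 0)"
    by (rule smooth_at_diff_quotient[OF s s' f]) blast
  obtain V g1 where V: "open V" "f x \<in> V" "is_diff_quotient s' s'' UNIV V g g1"
    "\<And>y v. y \<in> V \<Longrightarrow> differential s' s'' g y v = g1 (y, v, 0)"
    by (rule smooth_at_diff_quotient[OF c' s'' g]) blast
  have "continuous_on U f" by (rule is_diff_quotient_imp_continuous_on[OF s c' U(3)]) simp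
  then have W: "open (U \<inter> f -` V)"
    using U(1) V(1) by (rule continuous_open_preimage)
  define h where "h = (\<lambda>(x, v, t). (f x, f1 (x, v, t), t))"
  have off: "f (x + s t v) = f x + s' t (f1 (x, v, t))" if "(x, v, t) \<in> dq_domain s UNIV U" for x v t
  proof -
    have "f (x + s t v) - f x = s' t (f1 (x, v, t))" using U(3) that by (auto simp: is_diff_quotient_def)
    then show ?thesis by (simp add: algebra_simps)
  qed
  have sub: "dq_domain s UNIV (U \<inter> f -` V) \<subseteq> dq_domain s UNIV U" by (rule dq_domain_mono) simp
  have h: "h p \<in> dq_domain s' UNIV V" if "p \<in> dq_domain s UNIV (U \<inter> f -` V)" for p
  proof (cases p)
    case (fields x v t)
    with that have "(x, v, t) \<in> dq_domain s UNIV U" "f x \<in> V" "f (x + s t v) \<in> V"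
      by (auto simp: dq_domain_def)
    with off show ?thesis by (simp add: fields h_def dq_domain_def)
  qed
  have "is_diff_quotient s s'' UNIV (U \<inter> f -` V) (\<lambda>x. g (f x)) (g1 \<circ> h)"
    unfolding is_diff_quotient_def
  proof (intro conjI ballI, goal_cases)
    case 1
    have "continuous_on (dq_domain s UNIV (U \<inter> f -` V)) (\<lambda>p. f (fst p))"
      by (rule continuous_on_compose2[OF \<open>continuous_on U f\<close> continuous_on_fst[OF continuous_on_id]])
        (auto simp: dq_domain_def)
    moreover have "continuous_on (dq_domain s UNIV (U \<inter> f -` V)) f1"
      using conjunct1[OF U(3)[unfolded is_diff_quotient_def]] sub by (rule continuous_on_subset)
    ultimately have "continuous_on (dq_domain s UNIV (U \<inter> f -` V)) h"
      unfolding h_def case_prod_unfold by (auto intro!: continuous_intros)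
    moreover have "h ` dq_domain s UNIV (U \<inter> f -` V) \<subseteq> dq_domain s' UNIV V" using h by blast
    moreover have "continuous_on (dq_domain s' UNIV V) g1" using V(3) by (simp add: is_diff_quotient_def)
    ultimately show ?case by (intro continuous_on_compose) (auto intro: continuous_on_subset)
  next
    case (2 p)
    obtain x v t where p: "p = (x, v, t)" by (cases p)
    with 2 sub have p: "p = (x, v, t)" "(x, v, t) \<in> dq_domain s UNIV U" by auto
    have "g (f x + s' t (f1 (x, v, t))) - g (f x) = s'' t (g1 (h p))"
      using V(3) h[OF 2] unfolding is_diff_quotient_def by (auto simp: p(1) h_def)
    with off[OF p(2)] show ?case by (simp add: p(1))
  qed
  from differential_diff_quotient[OF s s'' W _ this, of x v] U(2) V(2)
  show ?thesis by (simp add: U(4) V(4) h_def)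
qed

lemma differential_Pair:
  assumes s: "cont_module s" "calculus_module s'" "calculus_module s''"
    and f: "smooth_at s s' f x" and g: "smooth_at s s'' g x"
  shows "differential s (prod_scale s' s'') (\<lambda>x. (f x, g x)) x v =
    (differential s s' f x v, differential s s'' g x v)"
proof -
  have c: "cont_module s'" "cont_module s''" by (rule calculus_module_cont_module, fact)+
  note fg = smooth_at_Pair[OF c f g]
  note p = calculus_module_prod[OF s(2,3)]
  have "differential s s' (\<lambda>x. fst (f x, g x)) x v = fst (differential s (prod_scale s' s'') (\<lambda>x. (f x, g x)) x v)"
    by (subst differential_compose[OF s(1) p s(2) smooth_at_linear[OF continuous_linear_fst] fg])
      (rule differential_linear[OF calculus_module_cont_module[OF p] s(2) continuous_linear_fst])
  moreover have "differential s s'' (\<lambda>x. snd (f x, g x)) x v = snd (differential s (prod_scale s' s'') (\<lambda>x. (f x, g x)) x v)"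
    by (subst differential_compose[OF s(1) p s(3) smooth_at_linear[OF continuous_linear_snd] fg])
      (rule differential_linear[OF calculus_module_cont_module[OF p] s(3) continuous_linear_snd])
  ultimately show ?thesis by (simp add: prod_eq_iff)
qed

lemma differential_post_linear:
  assumes s: "cont_module s" "calculus_module s'" "calculus_module s''"
    and A: "continuous_linear s' s'' A" and f: "smooth_at s s' f x"
  shows "differential s s'' (\<lambda>x. A (f x)) x v = A (differential s s' f x v)"
  by (subst differential_compose[OF s smooth_at_linear[OF A] f])
    (rule differential_linear[OF calculus_module_cont_module[OF s(2)] s(3) A])

lemma differential_add:
  assumes s: "cont_module s" "calculus_module s'" and f: "smooth_at s s' f x" and g: "smooth_at s s' g x"
  shows "differential s s' (\<lambda>x. f x + g x) x v = differential s s' f x v + differential s s' g x v"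
proof -
  interpret cont_module s' by (rule calculus_module_cont_module[OF s(2)])
  have "continuous_linear (prod_scale s' s') s' (\<lambda>p. fst p + snd p)"
    by (auto simp: continuous_linear_def prod_scale_def scale_right_distrib
        intro!: continuous_on_plus continuous_intros)
  from differential_post_linear[OF s(1) calculus_module_prod[OF s(2,2)] s(2) this
      smooth_at_Pair[OF cont_module_axioms cont_module_axioms f g]]
  show ?thesis by (simp add: differential_Pair[OF s(1,2,2) f g])
qed

lemma differential_scale:
  assumes s: "cont_module s" "calculus_module s'" and f: "smooth_at s s' f x"
  shows "differential s s' (\<lambda>x. s' t (f x)) x v = s' t (differential s s' f x v)"
  by (rule differential_post_linear[OF s(1,2,2) _ f])
    (rule cont_module.continuous_linear_scale[OF calculus_module_cont_module[OF s(2)]])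

lemma differential_minus:
  assumes s: "cont_module s" "calculus_module s'" and f: "smooth_at s s' f x"
  shows "differential s s' (\<lambda>x. - f x) x v = - differential s s' f x v"
proof -
  interpret cont_module s' by (rule calculus_module_cont_module[OF s(2)])
  show ?thesis using differential_scale[OF assms, of "- 1"] by simp
qed

lemma differential_diff:
  assumes s: "cont_module s" "calculus_module s'" and f: "smooth_at s s' f x" and g: "smooth_at s s' g x"
  shows "differential s s' (\<lambda>x. f x - g x) x v = differential s s' f x v - differential s s' g x v"
  using differential_add[OF s f smooth_at_minus[OF calculus_module_cont_module[OF s(2)] g]]
  by (simp add: differential_minus[OF s g])

subsection \<open>Linearity in the direction\<close>

lemma continuous_on_line:
  assumes "cont_module s"
  shows "continuous_on UNIV (\<lambda>t. x + s (t * r) v)"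
proof -
  interpret cont_module s by fact
  have "continuous_on UNIV (\<lambda>t. t * r)"
    by (rule cont_module.continuous_on_scale[OF cont_module_ring]) (auto intro: continuous_intros)
  then show ?thesis by (intro continuous_on_plus continuous_on_scale) (auto intro: continuous_intros)
qed

text \<open>
  The increment of \<open>f\<close> along \<open>t (v + w)\<close> is split at the intermediate point \<open>x + t v\<close>.
\<close>

lemma differential_add_dir:
  assumes s: "cont_module s" and s': "calculus_module s'" and f: "smooth_at s s' f x"
  shows "differential s s' f x (v + w) = differential s s' f x v + differential s s' f x w"
proof -
  interpret s: cont_module s by (rule s)
  interpret s': cont_module s' by (rule calculus_module_cont_module[OF s'])
  obtain W g where W: "open W" "x \<in> W" "is_diff_quotient s s' UNIV W f g"
    "\<And>y v. y \<in> W \<Longrightarrow> differential s s' f y v = g (y, v, 0)"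
    by (rule smooth_at_diff_quotient[OF s s' f]) blast
  have g: "continuous_on (dq_domain s UNIV W) g" using W(3) by (simp add: is_diff_quotient_def)
  let ?T = "(\<lambda>t. x + s (t * 1) v) -` W \<inter> (\<lambda>t. x + s (t * 1) (v + w)) -` W"
  have "differential s s' f x (v + w) = g (x + s 0 v, w, 0) + g (x, v, 0)"
  proof (rule differential_eqI[OF s s' f])
    show "open ?T" by (intro open_Int open_vimage W(1) continuous_on_line[OF s])
    show "0 \<in> ?T" using W(2) by simp
    show "continuous_on ?T (\<lambda>t. g (x + s t v, w, t) + g (x, v, t))"
    proof (rule s'.continuous_on_plus)
      show "continuous_on ?T (\<lambda>t. g (x + s t v, w, t))"
        by (rule continuous_on_compose2[OF g])
          (auto simp: dq_domain_def s.scale_right_distrib add.assoc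
            intro!: continuous_on_Pair s.continuous_on_plus s.continuous_on_scale continuous_intros)
      show "continuous_on ?T (\<lambda>t. g (x, v, t))"
        by (rule continuous_on_compose2[OF g]) (auto simp: dq_domain_def W(2) intro!: continuous_intros)
    qed
    show "f (x + s t (v + w)) - f x = s' t (g (x + s t v, w, t) + g (x, v, t))" if "t \<in> ?T" for t
    proof -
      have dq: "(x, v, t) \<in> dq_domain s UNIV W" "(x + s t v, w, t) \<in> dq_domain s UNIV W"
        using that W(2) by (auto simp: dq_domain_def s.scale_right_distrib add.assoc)
      then have "f (x + s t v) - f x = s' t (g (x, v, t))"
        "f (x + s t v + s t w) - f (x + s t v) = s' t (g (x + s t v, w, t))"
        using W(3) unfolding is_diff_quotient_def by blast+
      then show ?thesis by (simp add: s.scale_right_distrib s'.scale_right_distrib add.assoc algebra_simps)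
    qed
  qed
  then show ?thesis by (simp add: W(2,4))
qed

text \<open>
  An increment along \<open>t (r v)\<close> with parameter \<open>t\<close> is one along \<open>v\<close> with parameter \<open>t r\<close>.
\<close>

lemma differential_scale_dir:
  assumes s: "cont_module s" and s': "calculus_module s'" and f: "smooth_at s s' f x"
  shows "differential s s' f x (s r v) = s' r (differential s s' f x v)"
proof -
  interpret s: cont_module s by (rule s)
  interpret s': cont_module s' by (rule calculus_module_cont_module[OF s'])
  obtain W g where W: "open W" "x \<in> W" "is_diff_quotient s s' UNIV W f g"
    "\<And>y v. y \<in> W \<Longrightarrow> differential s s' f y v = g (y, v, 0)"
    by (rule smooth_at_diff_quotient[OF s s' f]) blast
  have g: "continuous_on (dq_domain s UNIV W) g" using W(3) by (simp add: is_diff_quotient_def)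
  let ?T = "(\<lambda>t. x + s (t * r) v) -` W"
  have "differential s s' f x (s r v) = s' r (g (x, v, 0 * r))"
  proof (rule differential_eqI[OF s s' f])
    show "open ?T" by (intro open_vimage W(1) continuous_on_line[OF s])
    show "0 \<in> ?T" using W(2) by simp
    have "continuous_on ?T (\<lambda>t. t * r)"
      by (rule cont_module.continuous_on_scale[OF cont_module_ring]) (auto intro: continuous_intros)
    then show "continuous_on ?T (\<lambda>t. s' r (g (x, v, t * r)))"
      by (intro s'.continuous_on_scale continuous_on_const continuous_on_compose2[OF g])
          (auto simp: dq_domain_def W(2) intro!: continuous_intros)
    show "f (x + s t (s r v)) - f x = s' t (s' r (g (x, v, t * r)))" if "t \<in> ?T" for t
    proof -
      have "(x, v, t * r) \<in> dq_domain s UNIV W" using that W(2) by (auto simp: dq_domain_def)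
      then show ?thesis using W(3) unfolding is_diff_quotient_def by auto
    qed
  qed
  then show ?thesis by (simp add: W(2,4))
qed

lemma differential_0_dir:
  assumes s: "cont_module s" and s': "calculus_module s'" and f: "smooth_at s s' f x"
  shows "differential s s' f x 0 = 0"
  using differential_add_dir[OF assms, of 0 0] by simp

lemma differential_minus_dir:
  assumes s: "cont_module s" and s': "calculus_module s'" and f: "smooth_at s s' f x"
  shows "differential s s' f x (- v) = - differential s s' f x v"
  using differential_add_dir[OF assms, of v "- v"] differential_0_dir[OF assms]
  by (simp add: eq_neg_iff_add_eq_0 add.commute)

subsection \<open>Smoothness of the differential\<close>

text \<open>
  The differential is the restriction of the smooth extended difference quotient to the parameter 0.
\<close>

lemma smooth_at_differential:
  fixes s :: "'k::{comm_ring_1, topological_ab_group_add, topological_semigroup_mult}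
      \<Rightarrow> 'e::{ab_group_add, topological_space} \<Rightarrow> 'e"
    and s0 :: "'k \<Rightarrow> 'd::{ab_group_add, topological_space} \<Rightarrow> 'd"
  assumes s0: "cont_module s0" and s: "cont_module s" and s': "calculus_module s'"
    and f: "smooth_at s s' f (p x)" and p: "smooth_at s0 s p x" and v: "smooth_at s0 s v x"
  shows "smooth_at s0 s' (\<lambda>x. differential s s' f (p x) (v x)) x"
proof -
  obtain W g where W: "open W" "p x \<in> W" "is_diff_quotient s s' UNIV W f g"
    "\<And>p. p \<in> dq_domain s UNIV W \<Longrightarrow> smooth_at (prod_scale s (prod_scale s (*))) s' g p"
    "\<And>y v. y \<in> W \<Longrightarrow> differential s s' f y v = g (y, v, 0)"
    by (rule smooth_at_diff_quotient[OF s s' f]) blast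
  have c: "cont_module (prod_scale s ((*) :: 'k \<Rightarrow> _))" by (intro cont_module_prod s cont_module_ring)
  have "smooth_at s0 s' (\<lambda>x. g (p x, v x, 0)) x"
  proof (rule smooth_at_compose[OF s0 cont_module_prod[OF s c]])
    show "smooth_at (prod_scale s (prod_scale s (*))) s' g (p x, v x, 0)"
      by (rule W(4)[OF dq_domain_0[OF s W(2)]])
    show "smooth_at s0 (prod_scale s (prod_scale s (*))) (\<lambda>x. (p x, v x, 0)) x"
      by (intro smooth_at_Pair s c cont_module_ring p v smooth_at_const)
  qed
  then show ?thesis
  proof (rule smooth_at_cong)
    have "\<forall>\<^sub>F y in nhds x. p y \<in> W"
      by (rule smooth_at_eventually_comp[OF eventually_nhds_in_open[OF W(1,2)] p])
    then show "\<forall>\<^sub>F y in nhds x. g (p y, v y, 0) = differential s s' f (p y) (v y)"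
      by eventually_elim (simp add: W(5))
  qed
qed

lemma smooth_at_directional:
  assumes s: "cont_module s" and s': "calculus_module s'" and f: "smooth_at s s' f x"
  shows "smooth_at s s' (\<lambda>y. differential s s' f y v) x"
  by (rule smooth_at_differential[OF s s s' f smooth_at_id smooth_at_const[OF s]])

text \<open>
  Symmetry of second differentials: for units \<open>t\<close> and \<open>r\<close>, the second difference along \<open>t w\<close> and
  \<open>r v\<close> may be divided by \<open>t r\<close>, and both iterated difference quotients arise in this way.
\<close>

lemma second_differential_symmetric:
  fixes s :: "'k::{comm_ring_1, topological_ab_group_add, topological_semigroup_mult}
      \<Rightarrow> 'e::{ab_group_add, topological_space} \<Rightarrow> 'e"
    and s' :: "'k \<Rightarrow> 'f::{ab_group_add, t2_space} \<Rightarrow> 'f"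
  assumes s: "cont_module s" and s': "calculus_module s'" and f: "smooth_at s s' f x"
  shows "differential s s' (\<lambda>y. differential s s' f y v) x w =
    differential s s' (\<lambda>y. differential s s' f y w) x v"
proof -
  interpret s: cont_module s by (rule s)
  interpret s': calculus_module s' by (rule s')
  let ?S = "prod_scale s (prod_scale s ((*) :: 'k \<Rightarrow> _))"
  have S: "cont_module ?S" by (intro cont_module_prod s cont_module_ring)
  obtain W g where W: "open W" "x \<in> W" "is_diff_quotient s s' UNIV W f g"
    "\<And>p. p \<in> dq_domain s UNIV W \<Longrightarrow> smooth_at ?S s' g p"
    "\<And>y v. y \<in> W \<Longrightarrow> differential s s' f y v = g (y, v, 0)"
    by (rule smooth_at_diff_quotient[OF s s' f]) blast
  have step: "f (y + s t v) - f y = s' t (g (y, v, t))" if "y \<in> W" "y + s t v \<in> W" for y v t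
    using that W(3) unfolding is_diff_quotient_def dq_domain_def by blast
  have *: "\<exists>V g2. open V \<and> (x, v, 0) \<in> V \<and> is_diff_quotient ?S s' UNIV V g g2 \<and>
      differential s s' (\<lambda>y. differential s s' f y v) x w = g2 ((x, v, 0), (w, 0, 0), 0)" for v w
  proof -
    obtain V g2 where V: "open V" "(x, v, 0) \<in> V" "is_diff_quotient ?S s' UNIV V g g2"
      by (rule smooth_at_diff_quotient[OF S s' W(4)[OF dq_domain_0[OF s W(2)]]]) blast
    have g2: "continuous_on (dq_domain ?S UNIV V) g2" using V(3) by (simp add: is_diff_quotient_def)
    let ?T = "(\<lambda>t. x + s (t * 1) w) -` W \<inter> (\<lambda>t. (x + s (t * 1) w, v, 0)) -` V"
    have "differential s s' (\<lambda>y. differential s s' f y v) x w = g2 ((x, v, 0), (w, 0, 0), 0)"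
    proof (rule differential_eqI[OF s s' smooth_at_directional[OF s s' f],
          where y = "\<lambda>t. g2 ((x, v, 0), (w, 0, 0), t)"])
      show "open ?T"
        by (intro open_Int open_vimage W(1) V(1) continuous_on_Pair continuous_on_line[OF s] continuous_on_const)
      show "0 \<in> ?T" using W(2) V(2) by simp
      show "continuous_on ?T (\<lambda>t. g2 ((x, v, 0), (w, 0, 0), t))"
        by (rule continuous_on_compose2[OF g2])
          (auto simp: dq_domain_def prod_scale_def V(2) intro!: continuous_intros)
      fix t assume t: "t \<in> ?T"
      then have "((x, v, 0), (w, 0, 0), t) \<in> dq_domain ?S UNIV V"
        by (auto simp: dq_domain_def prod_scale_def V(2))
      then have "g ((x, v, 0) + ?S t (w, 0, 0)) - g (x, v, 0) = s' t (g2 ((x, v, 0), (w, 0, 0), t))"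
        using V(3) unfolding is_diff_quotient_def by blast
      then show "differential s s' f (x + s t w) v - differential s s' f x v = s' t (g2 ((x, v, 0), (w, 0, 0), t))"
        using t W(2) by (simp add: W(5) prod_scale_def)
    qed
    with V show ?thesis by blast
  qed
  obtain V g2 where V: "open V" "(x, v, 0) \<in> V" "is_diff_quotient ?S s' UNIV V g g2"
    "differential s s' (\<lambda>y. differential s s' f y v) x w = g2 ((x, v, 0), (w, 0, 0), 0)"
    using *[of v w] by blast
  obtain U g3 where U: "open U" "(x, w, 0) \<in> U" "is_diff_quotient ?S s' UNIV U g g3"
    "differential s s' (\<lambda>y. differential s s' f y w) x v = g3 ((x, w, 0), (v, 0, 0), 0)"
    using *[of w v] by blast
  have g2: "continuous_on (dq_domain ?S UNIV V) g2" using V(3) by (simp add: is_diff_quotient_def)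
  have g3: "continuous_on (dq_domain ?S UNIV U) g3" using U(3) by (simp add: is_diff_quotient_def)
  \<comment> \<open>The arguments of the iterated quotients for the increments \<open>t w\<close> and \<open>r v\<close>, taken in the two orders.\<close>
  define a where "a = (\<lambda>(t :: 'k, r :: 'k). ((x, v, r), (w, 0 :: 'e, 0 :: 'k), t))"
  define b where "b = (\<lambda>(t :: 'k, r :: 'k). ((x, w, t), (v, 0 :: 'e, 0 :: 'k), r))"
  define N where "N = {p. x + s (fst p) w \<in> W \<and> x + s (snd p) v \<in> W \<and>
    x + s (fst p) w + s (snd p) v \<in> W} \<inter> a -` dq_domain ?S UNIV V \<inter> b -` dq_domain ?S UNIV U"
  have ca: "continuous_on S a" and cb: "continuous_on S b" for S
    unfolding a_def b_def case_prod_unfold by (intro continuous_intros)+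
  have N: "open N"
  proof -
    have "{p. x + s (fst p) w \<in> W \<and> x + s (snd p) v \<in> W \<and> x + s (fst p) w + s (snd p) v \<in> W} =
      (\<lambda>p. x + s (fst p) w) -` W \<inter> (\<lambda>p. x + s (snd p) v) -` W \<inter> (\<lambda>p. x + s (fst p) w + s (snd p) v) -` W"
      by auto
    then show ?thesis unfolding N_def
      by (auto intro!: open_Int open_vimage W(1) open_dq_domain[OF S] V(1) U(1) ca cb
        s.continuous_on_plus s.continuous_on_scale continuous_intros)
  qed
  have N0: "(0, 0) \<in> N"
    using W(2) V(2) U(2) unfolding N_def by (simp add: a_def b_def dq_domain_0[OF S])
  have eq: "g2 (a (t, r)) = g3 (b (t, r))" if "(t, r) \<in> N" "t dvd 1" "r dvd 1" for t r
  proof -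
    have n: "x + s t w \<in> W" "x + s r v \<in> W" "x + s t w + s r v \<in> W" "x + s r v + s t w \<in> W"
      using that(1) by (auto simp: N_def ac_simps)
    have "a (t, r) \<in> dq_domain ?S UNIV V" "b (t, r) \<in> dq_domain ?S UNIV U" using that(1) by (auto simp: N_def)
    then have "g ((x, v, r) + ?S t (w, 0, 0)) - g (x, v, r) = s' t (g2 (a (t, r)))"
      "g ((x, w, t) + ?S r (v, 0, 0)) - g (x, w, t) = s' r (g3 (b (t, r)))"
      using V(3) U(3) unfolding is_diff_quotient_def a_def b_def by auto
    then have 1: "g (x + s t w, v, r) = g (x, v, r) + s' t (g2 (a (t, r)))"
      and 2: "g (x + s r v, w, t) = g (x, w, t) + s' r (g3 (b (t, r)))"
      by (auto simp: prod_scale_def algebra_simps)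
    have "s' r (s' t (g2 (a (t, r)))) = (f (x + s t w + s r v) - f (x + s t w)) - (f (x + s r v) - f x)"
      unfolding step[OF n(1,3)] step[OF W(2) n(2)] 1 by (simp add: s'.scale_right_distrib)
    also have "\<dots> = (f (x + s r v + s t w) - f (x + s r v)) - (f (x + s t w) - f x)"
      by (simp add: algebra_simps)
    also have "\<dots> = s' t (s' r (g3 (b (t, r))))"
      unfolding step[OF n(2,4)] step[OF W(2) n(1)] 2 by (simp add: s'.scale_right_distrib)
    also have "\<dots> = s' r (s' t (g3 (b (t, r))))" by (simp add: mult.commute)
    finally show ?thesis using that(2,3) s'.scale_unit_cancel by blast
  qed
  have cN: "continuous_on N (\<lambda>p. g2 (a p))" "continuous_on N (\<lambda>p. g3 (b p))"
    by (rule continuous_on_compose2[OF g2 ca] continuous_on_compose2[OF g3 cb]; auto simp: N_def)+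
  have "g2 (a (0, 0)) = g3 (b (0, 0))"
  proof (rule agree_on_units_imp_eq[OF s'.dense_units, where p = "\<lambda>r. g2 (a (0, r))" and q = "\<lambda>r. g3 (b (0, r))"])
    let ?T = "(\<lambda>r. (0, r)) -` N"
    show "open ?T" by (intro open_vimage N continuous_intros)
    show "0 \<in> ?T" using N0 by simp
    show "continuous_on ?T (\<lambda>r. g2 (a (0, r)))" "continuous_on ?T (\<lambda>r. g3 (b (0, r)))"
      by (rule continuous_on_compose2[OF cN(1)] continuous_on_compose2[OF cN(2)]; auto intro!: continuous_intros)+
    fix r :: 'k assume r: "r \<in> ?T" "r dvd 1"
    show "g2 (a (0, r)) = g3 (b (0, r))"
    proof (rule agree_on_units_imp_eq[OF s'.dense_units, where p = "\<lambda>t. g2 (a (t, r))" and q = "\<lambda>t. g3 (b (t, r))"])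
      let ?T = "(\<lambda>t. (t, r)) -` N"
      show "open ?T" by (intro open_vimage N continuous_intros)
      show "0 \<in> ?T" using r(1) by simp
      show "continuous_on ?T (\<lambda>t. g2 (a (t, r)))" "continuous_on ?T (\<lambda>t. g3 (b (t, r)))"
        by (rule continuous_on_compose2[OF cN(1)] continuous_on_compose2[OF cN(2)]; auto intro!: continuous_intros)+
    qed (use eq r(2) in auto)
  qed
  then show ?thesis by (simp add: V(4) U(4) a_def b_def)
qed

subsection \<open>Partial differentials\<close>

lemma differential_partial1:
  assumes s: "calculus_module s1" "calculus_module s2" and s': "calculus_module s'"
    and f: "smooth_at (prod_scale s1 s2) s' f (x, y)"
  shows "differential (prod_scale s1 s2) s' f (x, y) (v, 0) = differential s1 s' (\<lambda>x. f (x, y)) x v"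
proof -
  note c = s[THEN calculus_module_cont_module]
  have p: "smooth_at s1 (prod_scale s1 s2) (\<lambda>x. (x, y)) x"
    by (intro smooth_at_Pair c smooth_at_id smooth_at_const)
  have "differential s1 (prod_scale s1 s2) (\<lambda>x. (x, y)) x v = (v, 0)"
    by (simp add: differential_Pair[OF c(1) s smooth_at_id smooth_at_const[OF c(2)]]
      differential_linear[OF c(1) s(1) continuous_linear_id] differential_const[OF c(1) s(2)])
  then show ?thesis
    by (simp add: differential_compose[OF c(1) calculus_module_prod[OF s] s' f p])
qed

lemma differential_partial2:
  assumes s: "calculus_module s1" "calculus_module s2" and s': "calculus_module s'"
    and f: "smooth_at (prod_scale s1 s2) s' f (x, y)"
  shows "differential (prod_scale s1 s2) s' f (x, y) (0, w) = differential s2 s' (\<lambda>y. f (x, y)) y w"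
proof -
  note c = s[THEN calculus_module_cont_module]
  have p: "smooth_at s2 (prod_scale s1 s2) (\<lambda>y. (x, y)) y"
    by (intro smooth_at_Pair c smooth_at_id smooth_at_const)
  have "differential s2 (prod_scale s1 s2) (\<lambda>y. (x, y)) y w = (0, w)"
    by (simp add: differential_Pair[OF c(2) s smooth_at_const[OF c(1)] smooth_at_id]
      differential_linear[OF c(2) s(2) continuous_linear_id] differential_const[OF c(2) s(1)])
  then show ?thesis
    by (simp add: differential_compose[OF c(2) calculus_module_prod[OF s] s' f p])
qed

lemma differential_partials:
  assumes s: "calculus_module s1" "calculus_module s2" and s': "calculus_module s'"
    and f: "smooth_at (prod_scale s1 s2) s' f (x, y)"
  shows "differential (prod_scale s1 s2) s' f (x, y) (v, w) =
    differential s1 s' (\<lambda>x. f (x, y)) x v + differential s2 s' (\<lambda>y. f (x, y)) y w"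
  using differential_add_dir[OF calculus_module_cont_module[OF calculus_module_prod[OF s]] s' f, of "(v, 0)" "(0, w)"]
  by (simp add: differential_partial1[OF s s' f] differential_partial2[OF s s' f])

text \<open>
  The map \<open>(y, v) \<mapsto> df(y)v\<close> is linear in \<open>v\<close>, so that its partial differential in \<open>v\<close> is given by \<open>df(y)\<close> itself.
\<close>

lemma differential_differential:
  assumes s: "calculus_module s" and s': "calculus_module s'" and s0: "calculus_module s0"
    and f: "smooth_at s s' f (p x)" and p: "smooth_at s0 s p x" and a: "smooth_at s0 s a x"
  shows "differential s0 s' (\<lambda>y. differential s s' f (p y) (a y)) x w =
    differential s s' (\<lambda>y. differential s s' f y (a x)) (p x) (differential s0 s p x w) +
    differential s s' f (p x) (differential s0 s a x w)"
proof -
  note c = calculus_module_cont_module[OF s] and c0 = calculus_module_cont_module[OF s0]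
  have sm: "smooth_at (prod_scale s s) s' (\<lambda>q. differential s s' f (fst q) (snd q)) (p x, a x)"
    by (rule smooth_at_differential[OF cont_module_prod[OF c c] c s'])
      (simp_all add: f smooth_at_linear[OF continuous_linear_fst] smooth_at_linear[OF continuous_linear_snd])
  have 1: "differential s s' (\<lambda>v. differential s s' f (p x) v) v w = differential s s' f (p x) w" for v w
  proof (rule differential_along_line[OF c s'])
    show "smooth_at s s' (differential s s' f (p x)) v"
      by (rule smooth_at_differential[OF c c s', where p = "\<lambda>v. p x" and v = "\<lambda>v. v"])
        (simp_all add: f smooth_at_const[OF c] smooth_at_id)
  qed (simp add: differential_add_dir[OF c s' f] differential_scale_dir[OF c s' f])
  show ?thesis
    using differential_compose[OF c0 calculus_module_prod[OF s s] s' sm smooth_at_Pair[OF c c p a], of w]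
    by (simp add: differential_Pair[OF c0 s s p a] differential_partials[OF s s s' sm] 1)
qed

section \<open>Maps between manifolds near a point\<close>

text \<open>
  This notion refers to a pair of charts instead of atlases, so that it covers charts of the atlas,
  compatible charts and products of charts in the same way.
\<close>

definition smooth_near ::
  "('k::{comm_ring_1, topological_space}, 'm, 'e::{ab_group_add, topological_space}) mfd \<Rightarrow>
   ('k, 'n, 'f::{ab_group_add, topological_space}) mfd \<Rightarrow>
   ('m, 'e) chart \<Rightarrow> ('n, 'f) chart \<Rightarrow> ('m \<Rightarrow> 'n) \<Rightarrow> 'm \<Rightarrow> bool"
  where "smooth_near M N c c' f p \<longleftrightarrow> p \<in> fst c \<and> f p \<in> fst c' \<and>
    (\<forall>\<^sub>F y in nhds (snd c p). y \<in> local_dom c c' f) \<and>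
    smooth_at (scal M) (scal N) (local_map c c' f) (snd c p)"

lemma local_map_at:
  "inj_on (snd c) (fst c) \<Longrightarrow> p \<in> fst c \<Longrightarrow> local_map c c' f (snd c p) = snd c' (f p)"
  by (simp add: local_map_def)

lemma local_domE:
  assumes "y \<in> local_dom c c' f"
  obtains p where "p \<in> fst c" "f p \<in> fst c'" "y = snd c p"
  using assms by (auto simp: local_dom_def)

lemma local_domI: "p \<in> fst c \<Longrightarrow> f p \<in> fst c' \<Longrightarrow> snd c p \<in> local_dom c c' f"
  by (auto simp: local_dom_def)

lemma smooth_nearD:
  assumes "smooth_near M N c c' f p"
  shows "p \<in> fst c" "f p \<in> fst c'" "\<forall>\<^sub>F y in nhds (snd c p). y \<in> local_dom c c' f"
    "smooth_at (scal M) (scal N) (local_map c c' f) (snd c p)"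
  using assms by (auto simp: smooth_near_def)

lemma local_map_compose_near:
  fixes M :: "('k::{comm_ring_1, topological_ab_group_add, topological_semigroup_mult}, 'm,
    'e::{ab_group_add, topological_space}) mfd"
  assumes inj: "inj_on (snd c) (fst c)" "inj_on (snd c') (fst c')"
    and f: "smooth_near M N c c' f p" and g: "smooth_near N P c' c'' g (f p)"
  shows "\<forall>\<^sub>F y in nhds (snd c p). y \<in> local_dom c c'' (g \<circ> f) \<and>
    local_map c' c'' g (local_map c c' f y) = local_map c c'' (g \<circ> f) y"
proof -
  have "\<forall>\<^sub>F y in nhds (snd c p). local_map c c' f y \<in> local_dom c' c'' g"
  proof (rule smooth_at_eventually_comp[OF _ smooth_nearD(4)[OF f]])
    show "\<forall>\<^sub>F y in nhds (local_map c c' f (snd c p)). y \<in> local_dom c' c'' g"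
      using smooth_nearD[OF g] by (simp add: local_map_at[OF inj(1) smooth_nearD(1)[OF f]])
  qed
  with smooth_nearD(3)[OF f] show ?thesis
  proof eventually_elim
    case (elim y)
    then obtain q where q: "q \<in> fst c" "f q \<in> fst c'" "y = snd c q" by (elim local_domE)
    from elim(2) obtain q' where q': "q' \<in> fst c'" "g q' \<in> fst c''" "local_map c c' f y = snd c' q'"
      by (elim local_domE)
    have "q' = f q"
      using q q' inj by (auto simp: local_map_at dest: inj_onD)
    with q q' show ?case
      by (auto simp: local_map_at inj intro!: local_domI)
  qed
qed

lemma smooth_near_compose:
  assumes mod: "cont_module (scal M)" "cont_module (scal N)"
    and inj: "inj_on (snd c) (fst c)" "inj_on (snd c') (fst c')"
    and f: "smooth_near M N c c' f p" and g: "smooth_near N P c' c'' g (f p)"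
  shows "smooth_near M P c c'' (g \<circ> f) p"
  unfolding smooth_near_def
proof (intro conjI)
  note near = local_map_compose_near[OF inj f g]
  show "\<forall>\<^sub>F y in nhds (snd c p). y \<in> local_dom c c'' (g \<circ> f)"
    using near by eventually_elim simp
  have "smooth_at (scal M) (scal P) (\<lambda>y. local_map c' c'' g (local_map c c' f y)) (snd c p)"
    by (rule smooth_at_compose[OF mod _ smooth_nearD(4)[OF f]])
      (use smooth_nearD(4)[OF g] in \<open>simp add: local_map_at[OF inj(1) smooth_nearD(1)[OF f]]\<close>)
  then show "smooth_at (scal M) (scal P) (local_map c c'' (g \<circ> f)) (snd c p)"
    by (rule smooth_at_cong) (rule eventually_mono[OF near], simp)
qed (use smooth_nearD(1,2)[OF f] smooth_nearD(1,2)[OF g] in auto)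

lemma local_diff_compose:
  assumes mod: "cont_module (scal M)" "calculus_module (scal N)" "calculus_module (scal P)"
    and inj: "inj_on (snd c) (fst c)" "inj_on (snd c') (fst c')"
    and f: "smooth_near M N c c' f p" and g: "smooth_near N P c' c'' g (f p)"
  shows "local_diff M P c c'' (g \<circ> f) p v = local_diff N P c' c'' g (f p) (local_diff M N c c' f p v)"
proof -
  note near = local_map_compose_near[OF inj f g]
  note at = local_map_at[OF inj(1) smooth_nearD(1)[OF f]]
  have g': "smooth_at (scal N) (scal P) (local_map c' c'' g) (local_map c c' f (snd c p))"
    using smooth_nearD(4)[OF g] by (simp add: at)
  have "local_diff M P c c'' (g \<circ> f) p v =
      differential (scal M) (scal P) (\<lambda>y. local_map c' c'' g (local_map c c' f y)) (snd c p) v"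
    unfolding local_diff_def
    by (rule differential_cong[OF mod(1,3)
        smooth_at_compose[OF mod(1) calculus_module_cont_module[OF mod(2)] g' smooth_nearD(4)[OF f]]])
      (rule eventually_mono[OF near], simp)
  also have "\<dots> = local_diff N P c' c'' g (f p) (local_diff M N c c' f p v)"
    unfolding local_diff_def
    by (simp add: differential_compose[OF mod g' smooth_nearD(4)[OF f]] at)
  finally show ?thesis .
qed

subsection \<open>Smooth maps\<close>

lemma smooth_map_iff:
  assumes inj: "\<And>c. c \<in> atlas M \<Longrightarrow> inj_on (snd c) (fst c)"
  shows "smooth_map M N f \<longleftrightarrow>
    (\<forall>c\<in>atlas M. \<forall>c'\<in>atlas N. \<forall>p. p \<in> fst c \<longrightarrow> f p \<in> fst c' \<longrightarrow> smooth_near M N c c' f p)"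
proof
  assume f: "smooth_map M N f"
  show "\<forall>c\<in>atlas M. \<forall>c'\<in>atlas N. \<forall>p. p \<in> fst c \<longrightarrow> f p \<in> fst c' \<longrightarrow> smooth_near M N c c' f p"
  proof (intro ballI allI impI)
    fix c c' p assume c: "c \<in> atlas M" "c' \<in> atlas N" and p: "p \<in> fst c" "f p \<in> fst c'"
    have "locally_smooth (scal M) (scal N) (local_dom c c' f) (local_map c c' f)"
      using f c by (simp add: smooth_map_def)
    then show "smooth_near M N c c' f p"
      using p local_domI[of p c f c'] unfolding smooth_near_def locally_smooth_iff
      by (auto intro: eventually_nhds_in_open)
  qed
next
  assume near: "\<forall>c\<in>atlas M. \<forall>c'\<in>atlas N. \<forall>p. p \<in> fst c \<longrightarrow> f p \<in> fst c' \<longrightarrow> smooth_near M N c c' f p"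
  show "smooth_map M N f" unfolding smooth_map_def
  proof (intro ballI)
    fix c c' assume c: "c \<in> atlas M" "c' \<in> atlas N"
    have *: "(\<forall>\<^sub>F z in nhds y. z \<in> local_dom c c' f) \<and>
        smooth_at (scal M) (scal N) (local_map c c' f) y" if "y \<in> local_dom c c' f" for y
    proof -
      from that obtain p where "p \<in> fst c" "f p \<in> fst c'" "y = snd c p" by (rule local_domE)
      with near c have "smooth_near M N c c' f p" "y = snd c p" by auto
      then show ?thesis by (simp add: smooth_near_def)
    qed
    show "locally_smooth (scal M) (scal N) (local_dom c c' f) (local_map c c' f)"
      unfolding locally_smooth_iff
    proof
      show "open (local_dom c c' f)"
        by (rule iffD2[OF open_subopen]) (use * in \<open>force simp: eventually_nhds\<close>)
    qed (use * in blast)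
  qed
qed

section \<open>Charts and tangent vectors\<close>

definition calculus_manifold ::
  "('k::{comm_ring_1, topological_ab_group_add, topological_semigroup_mult}, 'm,
    'e::{ab_group_add, t2_space}) mfd \<Rightarrow> bool"
  where "calculus_manifold M \<longleftrightarrow> smooth_manifold M \<and> calculus_module (scal M)"

lemma calculus_manifold_smooth_manifold: "calculus_manifold M \<Longrightarrow> smooth_manifold M"
  and calculus_manifold_module: "calculus_manifold M \<Longrightarrow> calculus_module (scal M)"
  and calculus_manifold_cont_module: "calculus_manifold M \<Longrightarrow> cont_module (scal M)"
  by (auto simp: calculus_manifold_def calculus_module_cont_module)

lemma chart_at:
  assumes "smooth_manifold M"
  shows "chart_at M p \<in> atlas M" "p \<in> fst (chart_at M p)"
proof -
  have "p \<in> (\<Union>c\<in>atlas M. fst c)" using assms by (simp add: smooth_manifold_def)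
  then have "\<exists>c. c \<in> atlas M \<and> p \<in> fst c" by blast
  then show "chart_at M p \<in> atlas M" "p \<in> fst (chart_at M p)"
    unfolding chart_at_def by (rule someI2_ex, simp)+
qed

lemma atlas_compatible: "smooth_manifold M \<Longrightarrow> c \<in> atlas M \<Longrightarrow> compatible_chart M c"
  by (simp add: compatible_chart_def insert_absorb)

lemma chart_at_compatible: "smooth_manifold M \<Longrightarrow> compatible_chart M (chart_at M p)"
  by (intro atlas_compatible chart_at)

lemma compatible_inj: "compatible_chart M c \<Longrightarrow> inj_on (snd c) (fst c)"
  and compatible_open: "compatible_chart M c \<Longrightarrow> open (snd c ` fst c)"
  by (auto simp: compatible_chart_def smooth_manifold_def)

lemma smooth_near_scal:
  "scal M' = scal M \<Longrightarrow> scal N' = scal N \<Longrightarrow> smooth_near M' N' c c' f p = smooth_near M N c c' f p"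
  by (simp add: smooth_near_def)

lemma atlas_smooth_near:
  assumes M: "smooth_manifold M" "smooth_manifold N" "smooth_map M N f"
    and c: "c \<in> atlas M" "c' \<in> atlas N" "p \<in> fst c" "f p \<in> fst c'"
  shows "smooth_near M N c c' f p"
  using M(3) c compatible_inj[OF atlas_compatible[OF M(1)]] by (subst (asm) smooth_map_iff) auto

lemma compatible_atlas_transition:
  assumes c: "compatible_chart M c" and c': "c' \<in> atlas M" and p: "p \<in> fst c" "p \<in> fst c'"
  shows "smooth_near M M c c' id p" "smooth_near M M c' c id p"
proof -
  let ?M = "M\<lparr>atlas := insert c (atlas M)\<rparr>"
  have M: "smooth_manifold ?M" using c by (simp add: compatible_chart_def)
  then have id: "smooth_map ?M ?M id" by (simp add: smooth_manifold_def)
  have "smooth_near ?M ?M c c' id p" "smooth_near ?M ?M c' c id p"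
    by (rule atlas_smooth_near[OF M M id]; simp add: c' p)+
  then show "smooth_near M M c c' id p" "smooth_near M M c' c id p"
    by (simp_all add: smooth_near_scal[of ?M M ?M M])
qed

text \<open>
  The local representative is factored through charts of the atlases at \<open>p\<close> and \<open>f p\<close>.
\<close>

lemma compatible_smooth_near:
  assumes M: "smooth_manifold M" "smooth_manifold N"
    and mod: "cont_module (scal M)" "cont_module (scal N)" and f: "smooth_map M N f"
    and c: "compatible_chart M c" "compatible_chart N c'" "p \<in> fst c" "f p \<in> fst c'"
  shows "smooth_near M N c c' f p"
proof -
  let ?c = "chart_at M p" and ?c' = "chart_at N (f p)"
  have "smooth_near M N ?c ?c' f p"
    by (rule atlas_smooth_near[OF M f]) (intro chart_at M)+
  moreover have "smooth_near M M c ?c id p"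
    by (intro compatible_atlas_transition c chart_at M)
  ultimately have "smooth_near M N c ?c' (f \<circ> id) p"
    by (intro smooth_near_compose[OF mod(1,1) compatible_inj[OF c(1)] compatible_inj[OF chart_at_compatible[OF M(1)]]]) simp_all
  moreover have "smooth_near N N ?c' c' id (f p)"
    by (intro compatible_atlas_transition c chart_at M)
  ultimately have "smooth_near M N c c' (id \<circ> f) p"
    by (intro smooth_near_compose[OF mod compatible_inj[OF c(1)] compatible_inj[OF chart_at_compatible[OF M(2)]]]) simp_all
  then show ?thesis by simp
qed

lemma smooth_map_id: "smooth_manifold M \<Longrightarrow> smooth_map M M id"
  by (simp add: smooth_manifold_def)

lemma local_diff_id_same:
  assumes M: "calculus_manifold M" and c: "compatible_chart M c" "p \<in> fst c"
  shows "local_diff M M c c id p v = v"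
proof -
  have "\<forall>\<^sub>F y in nhds (snd c p). y \<in> snd c ` fst c"
    using c by (intro eventually_nhds_in_open compatible_open) auto
  then have "\<forall>\<^sub>F y in nhds (snd c p). y = local_map c c id y"
    by eventually_elim (auto simp: local_map_at compatible_inj[OF c(1)])
  from differential_cong[OF calculus_manifold_cont_module[OF M] calculus_manifold_module[OF M] smooth_at_id this]
  show ?thesis
    by (simp add: local_diff_def differential_linear[OF calculus_manifold_cont_module[OF M]
        calculus_manifold_module[OF M] continuous_linear_id])
qed

lemma chart_transition:
  assumes M: "calculus_manifold M" and c: "compatible_chart M c" "compatible_chart M c'" "p \<in> fst c" "p \<in> fst c'"
  shows "smooth_near M M c c' id p"
  using assms compatible_smooth_near[of M M id c c' p]
  by (simp add: calculus_manifold_smooth_manifold calculus_manifold_cont_module smooth_map_id)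

lemma local_diff_transition:
  assumes M: "calculus_manifold M"
    and c: "compatible_chart M c" "compatible_chart M c'" "compatible_chart M c''"
      "p \<in> fst c" "p \<in> fst c'" "p \<in> fst c''"
  shows "local_diff M M c' c'' id p (local_diff M M c c' id p v) = local_diff M M c c'' id p v"
  using local_diff_compose[OF calculus_manifold_cont_module[OF M] calculus_manifold_module[OF M]
      calculus_manifold_module[OF M] compatible_inj[OF c(1)] compatible_inj[OF c(2)]
      chart_transition[OF M c(1,2,4,5)], where c'' = c'' and g = id and v = v] chart_transition[OF M c(2,3,5,6)]
  by simp

lemma chart_vec_transition:
  assumes M: "calculus_manifold M" and c: "compatible_chart M c" "compatible_chart M c'" "p \<in> fst c" "p \<in> fst c'"
  shows "local_diff M M c c' id p (chart_vec M c p v) = chart_vec M c' p v"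
  unfolding chart_vec_def
  by (rule local_diff_transition[OF M _ c(1,2) _ c(3,4)])
    (simp_all add: chart_at chart_at_compatible calculus_manifold_smooth_manifold[OF M])

lemma chart_vec_chart_at: "calculus_manifold M \<Longrightarrow> chart_vec M (chart_at M p) p v = v"
  unfolding chart_vec_def
  by (simp add: local_diff_id_same chart_at chart_at_compatible calculus_manifold_smooth_manifold)

lemma chart_vec_inverse:
  assumes M: "calculus_manifold M" and c: "compatible_chart M c" "p \<in> fst c"
  shows "local_diff M M c (chart_at M p) id p (chart_vec M c p v) = v"
  using chart_vec_transition[OF M c(1) chart_at_compatible c(2) chart_at(2)]
  by (simp add: chart_vec_chart_at[OF M] calculus_manifold_smooth_manifold[OF M])

lemma chart_vec_inj:
  assumes "calculus_manifold M" "compatible_chart M c" "p \<in> fst c" "chart_vec M c p v = chart_vec M c p w"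
  shows "v = w"
  using chart_vec_inverse[OF assms(1-3)] assms(4) by metis

lemma chart_vec_surj:
  assumes M: "calculus_manifold M" and c: "compatible_chart M c" "p \<in> fst c"
  shows "chart_vec M c p (local_diff M M c (chart_at M p) id p v) = v"
  unfolding chart_vec_def
  using local_diff_transition[OF M c(1) chart_at_compatible c(1) c(2) chart_at(2) c(2), of v]
  by (simp add: calculus_manifold_smooth_manifold[OF M] local_diff_id_same[OF M c])

lemma local_diff_linear:
  assumes "cont_module (scal M)" "calculus_module (scal N)" "smooth_near M N c c' f p"
  shows "local_diff M N c c' f p (v + w) = local_diff M N c c' f p v + local_diff M N c c' f p w"
    "local_diff M N c c' f p (scal M t v) = scal N t (local_diff M N c c' f p v)"
    "local_diff M N c c' f p (- v) = - local_diff M N c c' f p v"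
    "local_diff M N c c' f p 0 = 0"
  unfolding local_diff_def
  by (rule differential_add_dir differential_scale_dir differential_minus_dir differential_0_dir;
    fact assms smooth_nearD(4)[OF assms(3)])+

lemma chart_vec_linear:
  assumes M: "calculus_manifold M" and c: "compatible_chart M c" "p \<in> fst c"
  shows "chart_vec M c p (v + w) = chart_vec M c p v + chart_vec M c p w"
    "chart_vec M c p (scal M t v) = scal M t (chart_vec M c p v)"
    "chart_vec M c p (- v) = - chart_vec M c p v"
    "chart_vec M c p 0 = 0"
    "chart_vec M c p (v - w) = chart_vec M c p v - chart_vec M c p w"
proof -
  have "smooth_near M M (chart_at M p) c id p"
    by (intro chart_transition[OF M _ c(1) _ c(2)] chart_at_compatible chart_at
        calculus_manifold_smooth_manifold[OF M])
  note lin = local_diff_linear[OF calculus_manifold_cont_module[OF M] calculus_manifold_module[OF M] this,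
      folded chart_vec_def]
  show "chart_vec M c p (v + w) = chart_vec M c p v + chart_vec M c p w"
    "chart_vec M c p (scal M t v) = scal M t (chart_vec M c p v)"
    "chart_vec M c p (- v) = - chart_vec M c p v"
    "chart_vec M c p 0 = 0"
    by (fact lin)+
  show "chart_vec M c p (v - w) = chart_vec M c p v - chart_vec M c p w"
    using lin(1)[of v "- w"] by (simp add: lin(3))
qed

lemma tangent_map_in_charts:
  assumes M: "calculus_manifold M" "calculus_manifold N" and f: "smooth_map M N f"
    and c: "compatible_chart M c" "compatible_chart N c'" "p \<in> fst c" "f p \<in> fst c'"
  shows "chart_vec N c' (f p) (snd (tangent_map M N f (p, v))) = local_diff M N c c' f p (chart_vec M c p v)"
proof -
  note sm = M[THEN calculus_manifold_smooth_manifold]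
    and cm = M[THEN calculus_manifold_cont_module] and dm = M[THEN calculus_manifold_module]
  note near = compatible_smooth_near[OF sm cm f]
  note inj = compatible_inj[OF chart_at_compatible[OF sm(1)]] compatible_inj[OF chart_at_compatible[OF sm(2)]]
    compatible_inj[OF c(1)] compatible_inj[OF c(2)]
  let ?c = "chart_at M p" and ?c' = "chart_at N (f p)"
  have "local_diff M N c c' (f \<circ> id) p (chart_vec M c p v) = chart_vec N c' (f p) (snd (tangent_map M N f (p, v)))"
  proof -
    have "local_diff M N c c' f p (chart_vec M c p v) = local_diff M N ?c c' (f \<circ> id) p v"
      unfolding chart_vec_def
      by (rule local_diff_compose[OF cm(1) dm(1,2), symmetric, where f = id and p = p, simplified id_apply])
        (simp_all add: inj chart_at_compatible sm chart_at c near chart_transition[OF M(1)])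
    also have "f \<circ> id = id \<circ> f" by simp
    also have "local_diff M N ?c c' (id \<circ> f) p v = chart_vec N c' (f p) (local_diff M N ?c ?c' f p v)"
      unfolding chart_vec_def
      by (rule local_diff_compose[OF cm(1) dm(2,2)])
        (simp_all add: inj chart_at_compatible sm chart_at c near chart_transition[OF M(2)])
    finally show ?thesis by (simp add: tangent_map_def)
  qed
  then show ?thesis by simp
qed

lemma tangent_map_compose:
  assumes M: "calculus_manifold M" "calculus_manifold N" "calculus_manifold P"
    and f: "smooth_map M N f" and g: "smooth_map N P g"
  shows "tangent_map N P g (tangent_map M N f \<xi>) = tangent_map M P (g \<circ> f) \<xi>"
proof (cases \<xi>)
  case (Pair p v)
  note sm = M[THEN calculus_manifold_smooth_manifold]
  show ?thesis
    using local_diff_compose[OF calculus_manifold_cont_module[OF M(1)] calculus_manifold_module[OF M(2)]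
        calculus_manifold_module[OF M(3)] compatible_inj[OF chart_at_compatible[OF sm(1)]]
        compatible_inj[OF chart_at_compatible[OF sm(2)]]
        atlas_smooth_near[OF sm(1,2) f chart_at(1)[OF sm(1)] chart_at(1)[OF sm(2)] chart_at(2)[OF sm(1)] chart_at(2)[OF sm(2)]]
        atlas_smooth_near[OF sm(2,3) g chart_at(1)[OF sm(2)] chart_at(1)[OF sm(3)] chart_at(2)[OF sm(2)] chart_at(2)[OF sm(3)]], of p v]
    by (simp add: tangent_map_def Pair)
qed

lemma tangent_map_0:
  assumes M: "calculus_manifold M" "calculus_manifold N" and f: "smooth_map M N f"
  shows "tangent_map M N f (p, 0) = (f p, 0)"
proof -
  note sm = M[THEN calculus_manifold_smooth_manifold]
  show ?thesis
    using local_diff_linear(4)[OF calculus_manifold_cont_module[OF M(1)] calculus_manifold_module[OF M(2)]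
        atlas_smooth_near[OF sm f chart_at(1)[OF sm(1)] chart_at(1)[OF sm(2)] chart_at(2)[OF sm(1)] chart_at(2)[OF sm(2)]], of p]
    by (simp add: tangent_map_def)
qed

section \<open>Vector fields and their bracket\<close>

lemma field_in_chart_at:
  "inj_on (snd c) (fst c) \<Longrightarrow> p \<in> fst c \<Longrightarrow> field_in_chart M c X (snd c p) = chart_vec M c p (X p)"
  by (simp add: field_in_chart_def)

lemma field_in_chart_change:
  assumes M: "calculus_manifold M" and c: "compatible_chart M c" "compatible_chart M c'" "p \<in> fst c" "p \<in> fst c'"
  shows "field_in_chart M c' X (snd c' p) =
    differential (scal M) (scal M) (local_map c c' id) (snd c p) (field_in_chart M c X (snd c p))"
  by (simp add: field_in_chart_at compatible_inj[OF c(1)] compatible_inj[OF c(2)] c(3,4)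
      chart_vec_transition[OF M c] flip: local_diff_def)

lemma smooth_field_change:
  assumes M: "calculus_manifold M" and c: "compatible_chart M c" "compatible_chart M c'" "p \<in> fst c" "p \<in> fst c'"
    and X: "smooth_at (scal M) (scal M) (field_in_chart M c X) (snd c p)"
  shows "smooth_at (scal M) (scal M) (field_in_chart M c' X) (snd c' p)"
proof -
  note cm = calculus_manifold_cont_module[OF M] and dm = calculus_manifold_module[OF M]
  let ?r = "local_map c' c id"
  note t = chart_transition[OF M c] and r = chart_transition[OF M c(2,1,4,3)]
  have rp: "?r (snd c' p) = snd c p" by (simp add: local_map_at compatible_inj[OF c(2)] c(4))
  have "smooth_at (scal M) (scal M) (\<lambda>y. field_in_chart M c X (?r y)) (snd c' p)"
    by (rule smooth_at_compose[OF cm cm _ smooth_nearD(4)[OF r]]) (simp add: rp X)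
  then have "smooth_at (scal M) (scal M)
      (\<lambda>y. differential (scal M) (scal M) (local_map c c' id) (?r y) (field_in_chart M c X (?r y))) (snd c' p)"
    by (intro smooth_at_differential[OF cm cm dm _ smooth_nearD(4)[OF r]])
      (simp_all add: rp smooth_nearD(4)[OF t])
  then show ?thesis
  proof (rule smooth_at_cong)
    show "\<forall>\<^sub>F y in nhds (snd c' p). differential (scal M) (scal M) (local_map c c' id) (?r y)
        (field_in_chart M c X (?r y)) = field_in_chart M c' X y"
      using smooth_nearD(3)[OF r]
    proof eventually_elim
      case (elim y)
      then obtain q where "q \<in> fst c'" "id q \<in> fst c" "y = snd c' q" by (rule local_domE)
      then show ?case
        by (simp add: local_map_at compatible_inj[OF c(2)] field_in_chart_change[OF M c(1,2)])
    qed
  qed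
qed

text \<open>
  In the charts \<open>c\<close> and \<open>Tc'\<close>, the section has the transition map from \<open>c\<close> to \<open>c'\<close> as first component, and
  the field in the chart \<open>c'\<close> after this transition as second component.
\<close>

lemma vector_field_iff:
  assumes M: "calculus_manifold M"
  shows "vector_field M X \<longleftrightarrow>
    (\<forall>c\<in>atlas M. \<forall>p\<in>fst c. smooth_at (scal M) (scal M) (field_in_chart M c X) (snd c p))"
proof -
  note sm = calculus_manifold_smooth_manifold[OF M]
  note cm = calculus_manifold_cont_module[OF M] and dm = calculus_manifold_module[OF M]
  have inj: "inj_on (snd c) (fst c)" if "c \<in> atlas M" for c
    using compatible_inj atlas_compatible[OF sm that] by blast
  define T where "T = (\<lambda>c :: ('b, 'c) chart. (fst c \<times> (UNIV :: 'c set), \<lambda>(p, v). (snd c p, chart_vec M c p v)))"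
  have aT: "atlas (tangent_mfd M) = T ` atlas M" "scal (tangent_mfd M) = prod_scale (scal M) (scal M)"
    unfolding tangent_mfd_def T_def by (auto simp only: mfd.simps)
  have dom: "local_dom c (T c') (\<lambda>p. (p, X p)) = local_dom c c' id" for c c'
    by (auto simp: local_dom_def T_def)
  have map: "local_map c (T c') (\<lambda>p. (p, X p)) (snd c p) = (snd c' p, field_in_chart M c' X (snd c' p))"
    if "c \<in> atlas M" "c' \<in> atlas M" "p \<in> fst c" "p \<in> fst c'" for c c' p
    using that by (simp add: local_map_def T_def inj field_in_chart_at)
  have near: "\<forall>\<^sub>F y in nhds (snd c p). local_map c (T c') (\<lambda>p. (p, X p)) y =
      (local_map c c' id y, field_in_chart M c' X (local_map c c' id y))"
    if "c \<in> atlas M" "c' \<in> atlas M" "p \<in> fst c" "p \<in> fst c'" for c c' p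
    using smooth_nearD(3)[OF chart_transition[OF M atlas_compatible[OF sm that(1)] atlas_compatible[OF sm that(2)] that(3,4)]]
  proof eventually_elim
    case (elim y)
    then obtain q where q: "q \<in> fst c" "id q \<in> fst c'" "y = snd c q" by (rule local_domE)
    with map[OF that(1,2), of q] local_map_at[OF inj[OF that(1)] q(1), of c' id]
    show ?case by simp
  qed
  show ?thesis
  proof
    assume X: "vector_field M X"
    show "\<forall>c\<in>atlas M. \<forall>p\<in>fst c. smooth_at (scal M) (scal M) (field_in_chart M c X) (snd c p)"
    proof (intro ballI)
      fix c p assume c: "c \<in> atlas M" and p: "p \<in> fst c"
      have "smooth_near M (tangent_mfd M) c (T c) (\<lambda>p. (p, X p)) p"
        using X c p inj unfolding vector_field_def by (subst (asm) smooth_map_iff) (auto simp: aT T_def)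
      from smooth_nearD(4)[OF this]
      have "smooth_at (scal M) (scal M) (\<lambda>y. snd (local_map c (T c) (\<lambda>p. (p, X p)) y)) (snd c p)"
        unfolding aT by (rule smooth_at_snd)
      then show "smooth_at (scal M) (scal M) (field_in_chart M c X) (snd c p)"
      proof (rule smooth_at_cong)
        have "\<forall>\<^sub>F y in nhds (snd c p). y \<in> snd c ` fst c"
          using c p compatible_open[OF atlas_compatible[OF sm]] by (intro eventually_nhds_in_open) auto
        then show "\<forall>\<^sub>F y in nhds (snd c p). snd (local_map c (T c) (\<lambda>p. (p, X p)) y) = field_in_chart M c X y"
          by eventually_elim (auto simp: map c)
      qed
    qed
  next
    assume X: "\<forall>c\<in>atlas M. \<forall>p\<in>fst c. smooth_at (scal M) (scal M) (field_in_chart M c X) (snd c p)"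
    show "vector_field M X"
      unfolding vector_field_def
    proof (subst smooth_map_iff[OF inj], assumption, intro ballI allI impI)
      fix c d p assume c: "c \<in> atlas M" and d: "d \<in> atlas (tangent_mfd M)"
        and p: "p \<in> fst c" "(p, X p) \<in> fst d"
      from d obtain c' where c': "c' \<in> atlas M" "d = T c'" by (auto simp: aT)
      have p': "p \<in> fst c'" using p(2) c'(2) by (simp add: T_def)
      note t = chart_transition[OF M atlas_compatible[OF sm c] atlas_compatible[OF sm c'(1)] p(1) p']
      have "smooth_at (scal M) (scal (tangent_mfd M))
          (\<lambda>y. (local_map c c' id y, field_in_chart M c' X (local_map c c' id y))) (snd c p)"
        unfolding aT
        by (rule smooth_at_Pair[OF cm cm smooth_nearD(4)[OF t]
            smooth_at_compose[OF cm cm _ smooth_nearD(4)[OF t]]])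
          (use X c'(1) p' in \<open>simp add: local_map_at inj c p\<close>)
      then have "smooth_at (scal M) (scal (tangent_mfd M)) (local_map c d (\<lambda>p. (p, X p))) (snd c p)"
        by (rule smooth_at_cong) (rule eventually_mono[OF near[OF c c'(1) p(1) p']], simp add: c'(2))
      then show "smooth_near M (tangent_mfd M) c d (\<lambda>p. (p, X p)) p"
        unfolding smooth_near_def using p smooth_nearD(3)[OF t] by (simp add: c'(2) dom)
    qed
  qed
qed

lemma vector_field_smooth_at:
  assumes M: "calculus_manifold M" and X: "vector_field M X" and c: "compatible_chart M c" "p \<in> fst c"
  shows "smooth_at (scal M) (scal M) (field_in_chart M c X) (snd c p)"
proof -
  note sm = calculus_manifold_smooth_manifold[OF M]
  show ?thesis
    by (rule smooth_field_change[OF M chart_at_compatible[OF sm] c(1) chart_at(2)[OF sm] c(2)])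
      (use X chart_at[OF sm, of p] in \<open>auto simp: vector_field_iff[OF M]\<close>)
qed

lemma vector_fieldI:
  assumes M: "calculus_manifold M"
    and X: "\<And>p. \<exists>c. compatible_chart M c \<and> p \<in> fst c \<and> smooth_at (scal M) (scal M) (field_in_chart M c X) (snd c p)"
  shows "vector_field M X"
  unfolding vector_field_iff[OF M]
proof (intro ballI)
  fix c p assume c: "c \<in> atlas M" "p \<in> fst c"
  from X[of p] obtain c' where "compatible_chart M c'" "p \<in> fst c'"
    "smooth_at (scal M) (scal M) (field_in_chart M c' X) (snd c' p)" by blast
  then show "smooth_at (scal M) (scal M) (field_in_chart M c X) (snd c p)"
    using smooth_field_change[OF M] c atlas_compatible[OF calculus_manifold_smooth_manifold[OF M]] by blast
qed

definition bracket ::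
  "('k::{zero, topological_space} \<Rightarrow> 'e::{ab_group_add, topological_space} \<Rightarrow> 'e) \<Rightarrow>
    ('e \<Rightarrow> 'e) \<Rightarrow> ('e \<Rightarrow> 'e) \<Rightarrow> 'e \<Rightarrow> 'e"
  where "bracket s A B x = differential s s A x (B x) - differential s s B x (A x)"

lemma bracket_cong:
  assumes s: "calculus_module s" and A: "smooth_at s s A x" "\<forall>\<^sub>F y in nhds x. A y = A' y"
    and B: "smooth_at s s B x" "\<forall>\<^sub>F y in nhds x. B y = B' y"
  shows "bracket s A' B' x = bracket s A B x"
  using differential_cong[OF calculus_module_cont_module[OF s] s A]
    differential_cong[OF calculus_module_cont_module[OF s] s B]
    eventually_nhds_x_imp_x[OF A(2)] eventually_nhds_x_imp_x[OF B(2)]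
  by (simp add: bracket_def)

lemma smooth_at_bracket:
  assumes s: "calculus_module s" and A: "smooth_at s s A x" and B: "smooth_at s s B x"
  shows "smooth_at s s (bracket s A B) x"
proof -
  note c = calculus_module_cont_module[OF s]
  have "smooth_at s s (\<lambda>x. differential s s A x (B x) - differential s s B x (A x)) x"
    by (intro smooth_at_diff smooth_at_differential c s A B smooth_at_id)
  then show ?thesis by (simp add: bracket_def[abs_def])
qed

text \<open>
  The bracket is compatible with changes of charts: the second differentials of the transition map
  cancel by symmetry.
\<close>

lemma lie_bracket_in_chart:
  assumes M: "calculus_manifold M" and X: "vector_field M X" and Y: "vector_field M Y"
    and c: "compatible_chart M c" "p \<in> fst c"
  shows "chart_vec M c p (lie_bracket M X Y p) =
    bracket (scal M) (field_in_chart M c X) (field_in_chart M c Y) (snd c p)"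
proof -
  note sm = calculus_manifold_smooth_manifold[OF M]
  note cm = calculus_manifold_cont_module[OF M] and dm = calculus_manifold_module[OF M]
  define s where "s = scal M"
  define c0 where "c0 = chart_at M p"
  have c0: "compatible_chart M c0" "p \<in> fst c0"
    by (simp_all add: c0_def chart_at chart_at_compatible sm)
  define f where "f = local_map c0 c id"
  define x where "x = snd c0 p"
  note t = chart_transition[OF M c0(1) c(1) c0(2) c(2)]
  have f: "smooth_at s s f x" using smooth_nearD(4)[OF t] by (simp add: f_def x_def s_def)
  have fx: "f x = snd c p" by (simp add: f_def x_def local_map_at compatible_inj[OF c0(1)] c0(2))
  have field: "differential s s (field_in_chart M c Z) (snd c p) (differential s s f x v) =
      differential s s (\<lambda>y. differential s s f y (field_in_chart M c0 Z x)) x v +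
      differential s s f x (differential s s (field_in_chart M c0 Z) x v)"
    if Z: "vector_field M Z" for Z v
  proof -
    have Z0: "smooth_at s s (field_in_chart M c0 Z) x"
      unfolding s_def x_def by (rule vector_field_smooth_at[OF M Z c0])
    have Z1: "smooth_at s s (field_in_chart M c Z) (f x)"
      unfolding s_def fx by (rule vector_field_smooth_at[OF M Z c])
    have eq: "\<forall>\<^sub>F y in nhds x. field_in_chart M c Z (f y) = differential s s f y (field_in_chart M c0 Z y)"
      using smooth_nearD(3)[OF t, folded x_def]
    proof eventually_elim
      case (elim y)
      then obtain q where q: "q \<in> fst c0" "q \<in> fst c" "y = snd c0 q" by (auto elim: local_domE)
      show ?case unfolding q(3) f_def s_def
        using field_in_chart_change[OF M c0(1) c(1) q(1,2)]
        by (simp add: local_map_at compatible_inj[OF c0(1)] q(1))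
    qed
    have "differential s s (\<lambda>y. differential s s f y (field_in_chart M c0 Z y)) x v =
        differential s s (\<lambda>y. field_in_chart M c Z (f y)) x v"
      unfolding s_def
      by (rule differential_cong[OF cm dm smooth_at_compose[OF cm cm]])
        (use Z1 f eq in \<open>simp_all add: s_def\<close>)
    also have "\<dots> = differential s s (field_in_chart M c Z) (snd c p) (differential s s f x v)"
      using differential_compose[of s s s "field_in_chart M c Z" f x v] cm dm Z1 f by (simp add: s_def fx)
    finally show ?thesis
      using differential_differential[of s s s f "\<lambda>x. x" x "field_in_chart M c0 Z" v] dm f Z0
      by (simp add: s_def smooth_at_id differential_linear[OF cm dm continuous_linear_id])
  qed
  have at: "field_in_chart M c Z (snd c p) = differential s s f x (field_in_chart M c0 Z x)" for Z
    unfolding s_def x_def f_def by (rule field_in_chart_change[OF M c0(1) c(1) c0(2) c(2)])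
  have "bracket s (field_in_chart M c X) (field_in_chart M c Y) (snd c p) =
      differential s s f x (differential s s (field_in_chart M c0 X) x (field_in_chart M c0 Y x)) -
      differential s s f x (differential s s (field_in_chart M c0 Y) x (field_in_chart M c0 X x))"
    unfolding bracket_def at field[OF X] field[OF Y]
    using second_differential_symmetric[of s s f x "field_in_chart M c0 X x" "field_in_chart M c0 Y x"] cm dm f
    by (simp add: s_def)
  also have "\<dots> = differential s s f x (bracket s (field_in_chart M c0 X) (field_in_chart M c0 Y) x)"
    using differential_add_dir[of s s f x "bracket s (field_in_chart M c0 X) (field_in_chart M c0 Y) x"
        "differential s s (field_in_chart M c0 Y) x (field_in_chart M c0 X x)"] cm dm f
    by (simp add: s_def bracket_def algebra_simps)
  also have "\<dots> = chart_vec M c p (lie_bracket M X Y p)"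
    unfolding chart_vec_def local_diff_def lie_bracket_def bracket_def Let_def s_def f_def x_def c0_def ..
  finally show ?thesis by (simp add: s_def)
qed

lemma field_in_chart_lie_bracket:
  assumes M: "calculus_manifold M" and X: "vector_field M X" and Y: "vector_field M Y"
    and c: "compatible_chart M c" "x \<in> snd c ` fst c"
  shows "field_in_chart M c (lie_bracket M X Y) x =
    bracket (scal M) (field_in_chart M c X) (field_in_chart M c Y) x"
  using c(2) lie_bracket_in_chart[OF M X Y c(1)] by (auto simp: field_in_chart_at compatible_inj[OF c(1)])

lemma vector_field_lie_bracket:
  assumes M: "calculus_manifold M" and X: "vector_field M X" and Y: "vector_field M Y"
  shows "vector_field M (lie_bracket M X Y)"
proof (rule vector_fieldI[OF M])
  fix p
  note sm = calculus_manifold_smooth_manifold[OF M]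
  let ?c = "chart_at M p"
  have c: "compatible_chart M ?c" "p \<in> fst ?c" by (simp_all add: chart_at chart_at_compatible sm)
  have "smooth_at (scal M) (scal M) (bracket (scal M) (field_in_chart M ?c X) (field_in_chart M ?c Y)) (snd ?c p)"
    by (intro smooth_at_bracket calculus_manifold_module[OF M] vector_field_smooth_at[OF M] X Y c)
  then have "smooth_at (scal M) (scal M) (field_in_chart M ?c (lie_bracket M X Y)) (snd ?c p)"
  proof (rule smooth_at_cong)
    have "\<forall>\<^sub>F y in nhds (snd ?c p). y \<in> snd ?c ` fst ?c"
      using c by (intro eventually_nhds_in_open compatible_open[OF c(1)]) auto
    then show "\<forall>\<^sub>F y in nhds (snd ?c p). bracket (scal M) (field_in_chart M ?c X) (field_in_chart M ?c Y) y =
        field_in_chart M ?c (lie_bracket M X Y) y"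
      by eventually_elim (simp add: field_in_chart_lie_bracket[OF M X Y c(1)])
  qed
  with c show "\<exists>c. compatible_chart M c \<and> p \<in> fst c \<and>
      smooth_at (scal M) (scal M) (field_in_chart M c (lie_bracket M X Y)) (snd c p)" by blast
qed

section \<open>Products of manifolds\<close>

lemma smooth_near_coordinates:
  assumes c: "inj_on (snd c) (fst c)" "open (snd c ` fst c)" "p \<in> fst c"
    and f: "\<And>q. q \<in> fst c \<Longrightarrow> f q \<in> fst c'" "\<And>q. q \<in> fst c \<Longrightarrow> snd c' (f q) = A (snd c q)"
    and A: "smooth_at (scal M) (scal N) A (snd c p)"
  shows "smooth_near M N c c' f p"
    and "cont_module (scal M) \<Longrightarrow> calculus_module (scal N) \<Longrightarrow>
      local_diff M N c c' f p v = differential (scal M) (scal N) A (snd c p) v"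
proof -
  have ev: "\<forall>\<^sub>F y in nhds (snd c p). y \<in> snd c ` fst c"
    using c by (intro eventually_nhds_in_open) auto
  then have eq: "\<forall>\<^sub>F y in nhds (snd c p). A y = local_map c c' f y"
    by eventually_elim (auto simp: local_map_at c(1) f(2))
  from ev have "\<forall>\<^sub>F y in nhds (snd c p). y \<in> local_dom c c' f"
    by eventually_elim (auto intro: local_domI f(1))
  with smooth_at_cong[OF A eq] show "smooth_near M N c c' f p"
    using c f by (simp add: smooth_near_def)
  show "local_diff M N c c' f p v = differential (scal M) (scal N) A (snd c p) v"
    if "cont_module (scal M)" "calculus_module (scal N)"
    unfolding local_diff_def by (rule differential_cong[OF that A eq])
qed

lemma smooth_near_linear:
  assumes mod: "calculus_module (scal M)" "calculus_module (scal N)"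
    and c: "inj_on (snd c) (fst c)" "open (snd c ` fst c)" "p \<in> fst c"
    and f: "\<And>q. q \<in> fst c \<Longrightarrow> f q \<in> fst c'" "\<And>q. q \<in> fst c \<Longrightarrow> snd c' (f q) = A (snd c q)"
    and A: "continuous_linear (scal M) (scal N) A"
  shows "smooth_near M N c c' f p" and "local_diff M N c c' f p v = A v"
proof -
  note cm = calculus_module_cont_module[OF mod(1)]
  note sm = smooth_at_linear[OF A, of "snd c p"]
  show "smooth_near M N c c' f p" using smooth_near_coordinates(1)[OF c f sm] .
  show "local_diff M N c c' f p v = A v"
    using smooth_near_coordinates(2)[OF c f sm cm mod(2)] differential_linear[OF cm mod(2) A] by simp
qed

lemma scal_prod_mfd [simp]: "scal (prod_mfd M N) = prod_scale (scal M) (scal N)"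
  by (simp add: prod_mfd_def)

lemma prod_chart_simps [simp]:
  "fst (prod_chart c c') = fst c \<times> fst c'" "snd (prod_chart c c') (p, q) = (snd c p, snd c' q)"
  by (simp_all add: prod_chart_def)

lemma prod_chart_inj:
  assumes "inj_on (snd c) (fst c)" "inj_on (snd c') (fst c')"
  shows "inj_on (snd (prod_chart c c')) (fst (prod_chart c c'))"
  using assms by (auto simp: inj_on_def)

lemma prod_chart_open:
  assumes "open (snd c ` fst c)" "open (snd c' ` fst c')"
  shows "open (snd (prod_chart c c') ` fst (prod_chart c c'))"
proof -
  have "snd (prod_chart c c') ` fst (prod_chart c c') = (snd c ` fst c) \<times> (snd c' ` fst c')"
    by force
  then show ?thesis using assms by (simp add: open_Times)
qed

lemma smooth_near_Pair:
  assumes mod: "cont_module (scal M)" "cont_module (scal N)" and inj: "inj_on (snd c) (fst c)"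
    and f: "smooth_near P M c c1 f p" and g: "smooth_near P N c c2 g p"
  shows "smooth_near P (prod_mfd M N) c (prod_chart c1 c2) (\<lambda>x. (f x, g x)) p"
proof -
  have map: "local_map c (prod_chart c1 c2) (\<lambda>x. (f x, g x)) = (\<lambda>y. (local_map c c1 f y, local_map c c2 g y))"
    by (simp add: local_map_def fun_eq_iff)
  have "\<forall>\<^sub>F y in nhds (snd c p). y \<in> local_dom c (prod_chart c1 c2) (\<lambda>x. (f x, g x))"
    using smooth_nearD(3)[OF f] smooth_nearD(3)[OF g]
  proof eventually_elim
    case (elim y)
    obtain q where q: "q \<in> fst c" "f q \<in> fst c1" "y = snd c q" using elim(1) by (rule local_domE)
    obtain q' where q': "q' \<in> fst c" "g q' \<in> fst c2" "y = snd c q'" using elim(2) by (rule local_domE)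
    have "q' = q" using inj q q' by (auto dest: inj_onD)
    with q q' show ?case by (auto intro!: local_domI)
  qed
  then show ?thesis
    using smooth_nearD(1,2)[OF f] smooth_nearD(1,2)[OF g]
      smooth_at_Pair[OF mod smooth_nearD(4)[OF f] smooth_nearD(4)[OF g]]
    by (simp add: smooth_near_def map)
qed

lemma local_diff_Pair:
  assumes mod: "cont_module (scal P)" "calculus_module (scal M)" "calculus_module (scal N)"
    and f: "smooth_near P M c c1 f p" and g: "smooth_near P N c c2 g p"
  shows "local_diff P (prod_mfd M N) c (prod_chart c1 c2) (\<lambda>x. (f x, g x)) p v =
    (local_diff P M c c1 f p v, local_diff P N c c2 g p v)"
proof -
  have "local_map c (prod_chart c1 c2) (\<lambda>x. (f x, g x)) = (\<lambda>y. (local_map c c1 f y, local_map c c2 g y))"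
    by (simp add: local_map_def fun_eq_iff)
  then show ?thesis unfolding local_diff_def
    by (simp add: differential_Pair[OF mod smooth_nearD(4)[OF f] smooth_nearD(4)[OF g]])
qed

context
  fixes M :: "('k::{comm_ring_1, topological_ab_group_add, topological_semigroup_mult}, 'm,
      'e::{ab_group_add, t2_space}) mfd"
    and N :: "('k, 'n, 'f::{ab_group_add, t2_space}) mfd"
    and c :: "('m, 'e) chart" and c' :: "('n, 'f) chart"
  assumes mod: "calculus_module (scal M)" "calculus_module (scal N)"
    and c: "inj_on (snd c) (fst c)" "open (snd c ` fst c)"
    and c': "inj_on (snd c') (fst c')" "open (snd c' ` fst c')"
begin

lemma smooth_near_fst:
  assumes p: "p \<in> fst c" "q \<in> fst c'"
  shows "smooth_near (prod_mfd M N) M (prod_chart c c') c fst (p, q)"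
    and "local_diff (prod_mfd M N) M (prod_chart c c') c fst (p, q) (v, w) = v"
proof -
  have "calculus_module (scal (prod_mfd M N))" "(p, q) \<in> fst (prod_chart c c')"
    "continuous_linear (scal (prod_mfd M N)) (scal M) fst"
    using p by (simp_all add: calculus_module_prod mod continuous_linear_fst)
  note * = smooth_near_linear[OF this(1) mod(1) prod_chart_inj[OF c(1) c'(1)]
      prod_chart_open[OF c(2) c'(2)] this(2) _ _ this(3)]
  show "smooth_near (prod_mfd M N) M (prod_chart c c') c fst (p, q)" by (rule *(1)) auto
  have "local_diff (prod_mfd M N) M (prod_chart c c') c fst (p, q) (v, w) = fst (v, w)"
    by (rule *(2)) auto
  then show "local_diff (prod_mfd M N) M (prod_chart c c') c fst (p, q) (v, w) = v" by simp
qed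

lemma smooth_near_snd:
  assumes p: "p \<in> fst c" "q \<in> fst c'"
  shows "smooth_near (prod_mfd M N) N (prod_chart c c') c' snd (p, q)"
    and "local_diff (prod_mfd M N) N (prod_chart c c') c' snd (p, q) (v, w) = w"
proof -
  have "calculus_module (scal (prod_mfd M N))" "(p, q) \<in> fst (prod_chart c c')"
    "continuous_linear (scal (prod_mfd M N)) (scal N) snd"
    using p by (simp_all add: calculus_module_prod mod continuous_linear_snd)
  note * = smooth_near_linear[OF this(1) mod(2) prod_chart_inj[OF c(1) c'(1)]
      prod_chart_open[OF c(2) c'(2)] this(2) _ _ this(3)]
  show "smooth_near (prod_mfd M N) N (prod_chart c c') c' snd (p, q)" by (rule *(1)) auto
  have "local_diff (prod_mfd M N) N (prod_chart c c') c' snd (p, q) (v, w) = snd (v, w)"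
    by (rule *(2)) auto
  then show "local_diff (prod_mfd M N) N (prod_chart c c') c' snd (p, q) (v, w) = w" by simp
qed

lemma smooth_near_const:
  assumes p: "p \<in> fst c" "q \<in> fst c'"
  shows "smooth_near M N c c' (\<lambda>x. q) p" and "local_diff M N c c' (\<lambda>x. q) p v = 0"
proof -
  note A = smooth_at_const[OF calculus_module_cont_module[OF mod(2)], of "scal M" "snd c' q" "snd c p"]
  show "smooth_near M N c c' (\<lambda>x. q) p"
    by (rule smooth_near_coordinates(1)[OF c p(1) _ _ A]) (use p in auto)
  have "local_diff M N c c' (\<lambda>x. q) p v = differential (scal M) (scal N) (\<lambda>x. snd c' q) (snd c p) v"
    by (rule smooth_near_coordinates(2)[OF c p(1) _ _ A calculus_module_cont_module[OF mod(1)] mod(2)])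
      (use p in auto)
  then show "local_diff M N c c' (\<lambda>x. q) p v = 0"
    by (simp add: differential_const[OF calculus_module_cont_module[OF mod(1)] mod(2)])
qed

end

section \<open>Infinitesimal automorphisms of symmetric spaces\<close>

locale calculus_symmetric_space =
  fixes M :: "('k::{comm_ring_1, topological_ab_group_add, topological_semigroup_mult}, 'm,
      'e::{ab_group_add, t2_space}) mfd"
    and \<mu> :: "'m \<Rightarrow> 'm \<Rightarrow> 'm"
  assumes module: "calculus_module (scal M)" and symmetric: "symmetric_space M \<mu>"
begin

lemma smooth: "smooth_manifold M"
  and manifold: "calculus_manifold M"
  and idem: "\<mu> x x = x"
  and invol: "\<mu> x (\<mu> x y) = y"
  and distrib: "\<mu> x (\<mu> y z) = \<mu> (\<mu> x y) (\<mu> x z)"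
  and tangent_symmetry: "tangent_map M M (\<mu> x) (x, v) = (x, - v)"
  using symmetric module by (auto simp: symmetric_space_def calculus_manifold_def)

lemma mod: "cont_module (scal M)" "calculus_module (scal (prod_mfd M M))" "cont_module (scal (prod_mfd M M))"
  by (simp_all add: module calculus_module_cont_module calculus_module_prod)

lemmas at = chart_at[OF smooth]
lemmas at_comp = chart_at_compatible[OF smooth]
lemmas inj = compatible_inj[OF atlas_compatible[OF smooth]]
lemmas opn = compatible_open[OF atlas_compatible[OF smooth]]

abbreviation mult :: "'m \<times> 'm \<Rightarrow> 'm"
  where "mult \<equiv> (\<lambda>(x, y). \<mu> x y)"

abbreviation mult_diff ::
  "('m, 'e) chart \<Rightarrow> ('m, 'e) chart \<Rightarrow> ('m, 'e) chart \<Rightarrow> 'm \<Rightarrow> 'm \<Rightarrow> 'e \<times> 'e \<Rightarrow> 'e"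
  where "mult_diff c1 c2 c3 p q \<equiv> local_diff (prod_mfd M M) M (prod_chart c1 c2) c3 mult (p, q)"

lemma smooth_near_mult:
  assumes "c1 \<in> atlas M" "c2 \<in> atlas M" "c3 \<in> atlas M" "p \<in> fst c1" "q \<in> fst c2" "\<mu> p q \<in> fst c3"
  shows "smooth_near (prod_mfd M M) M (prod_chart c1 c2) c3 mult (p, q)"
proof -
  have "smooth_map (prod_mfd M M) M mult" using symmetric by (simp add: symmetric_space_def)
  moreover have "inj_on (snd c) (fst c)" if "c \<in> atlas (prod_mfd M M)" for c
    using that inj by (auto simp: prod_mfd_def prod_chart_inj simp del: prod_chart_simps)
  ultimately have "\<forall>c\<in>atlas (prod_mfd M M). \<forall>c'\<in>atlas M. \<forall>p. p \<in> fst c \<longrightarrow> mult p \<in> fst c' \<longrightarrow>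
      smooth_near (prod_mfd M M) M c c' mult p"
    by (subst (asm) smooth_map_iff)
  moreover have "prod_chart c1 c2 \<in> atlas (prod_mfd M M)"
    using assms(1,2) unfolding prod_mfd_def mfd.simps by blast
  ultimately show ?thesis using assms(3-6) by simp
qed

text \<open>
  All identities for \<open>T\<mu>\<close> are obtained by differentiating identities for \<open>\<mu>\<close> with this form of the chain rule.
\<close>

lemma mult_chain:
  fixes P :: "('k, 'p, 'd::{ab_group_add, topological_space}) mfd"
  assumes P: "cont_module (scal P)" "inj_on (snd C) (fst C)"
    and c: "c1 \<in> atlas M" "c2 \<in> atlas M" "c3 \<in> atlas M"
    and f: "smooth_near P M C c1 f t" and g: "smooth_near P M C c2 g t"
    and fg: "\<mu> (f t) (g t) \<in> fst c3"
  shows "smooth_near P M C c3 (\<lambda>x. \<mu> (f x) (g x)) t"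
    and "local_diff P M C c3 (\<lambda>x. \<mu> (f x) (g x)) t v =
      mult_diff c1 c2 c3 (f t) (g t) (local_diff P M C c1 f t v, local_diff P M C c2 g t v)"
proof -
  note pair = smooth_near_Pair[OF mod(1,1) P(2) f g]
  have m: "smooth_near (prod_mfd M M) M (prod_chart c1 c2) c3 mult (f t, g t)"
    by (rule smooth_near_mult[OF c smooth_nearD(2)[OF f] smooth_nearD(2)[OF g] fg])
  note inj2 = prod_chart_inj[OF inj[OF c(1)] inj[OF c(2)]]
  have eq: "mult \<circ> (\<lambda>x. (f x, g x)) = (\<lambda>x. \<mu> (f x) (g x))" by auto
  show "smooth_near P M C c3 (\<lambda>x. \<mu> (f x) (g x)) t"
    using smooth_near_compose[OF P(1) mod(3) P(2) inj2 pair m] unfolding eq .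
  show "local_diff P M C c3 (\<lambda>x. \<mu> (f x) (g x)) t v =
      mult_diff c1 c2 c3 (f t) (g t) (local_diff P M C c1 f t v, local_diff P M C c2 g t v)"
    using local_diff_compose[OF P(1) mod(2) module P(2) inj2 pair m]
    unfolding eq local_diff_Pair[OF P(1) module module f g] .
qed

text \<open>A symmetry is the product with a constant map, whose differential is 0.\<close>

lemma smooth_near_symmetry:
  assumes c: "c \<in> atlas M" "c' \<in> atlas M" "q \<in> fst c" "\<mu> p q \<in> fst c'" and c0: "c0 \<in> atlas M" "p \<in> fst c0"
  shows "smooth_near M M c c' (\<mu> p) q"
    and "local_diff M M c c' (\<mu> p) q w = mult_diff c0 c c' p q (0, w)"
proof -
  note const = smooth_near_const[OF module module inj[OF c(1)] opn[OF c(1)] inj[OF c0(1)] opn[OF c0(1)] c(3) c0(2)]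
  note id = chart_transition[OF manifold atlas_compatible[OF smooth c(1)] atlas_compatible[OF smooth c(1)] c(3,3)]
  show "smooth_near M M c c' (\<mu> p) q"
    using mult_chain(1)[OF mod(1) inj[OF c(1)] c0(1) c(1,2) const(1) id] c(4) by simp
  show "local_diff M M c c' (\<mu> p) q w = mult_diff c0 c c' p q (0, w)"
    using mult_chain(2)[OF mod(1) inj[OF c(1)] c0(1) c(1,2) const(1) id, of w] c(4)
    by (simp add: const(2) local_diff_id_same[OF manifold atlas_compatible[OF smooth c(1)] c(3)])
qed

lemma smooth_map_symmetry: "smooth_map M M (\<mu> p)"
  by (subst smooth_map_iff) (auto intro!: inj smooth_near_symmetry(1)[OF _ _ _ _ at(1) at(2)])

text \<open>The tangent vector component of the product map \<open>T\<mu>\<close>.\<close>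

definition tmul :: "'m \<Rightarrow> 'e \<Rightarrow> 'm \<Rightarrow> 'e \<Rightarrow> 'e"
  where "tmul p v q w = mult_diff (chart_at M p) (chart_at M q) (chart_at M (\<mu> p q)) p q (v, w)"

lemma tangent_product_tmul: "tangent_product M \<mu> (p, v) (q, w) = (\<mu> p q, tmul p v q w)"
  by (simp add: tangent_product_def tmul_def)

lemma tmul_near:
  "smooth_near (prod_mfd M M) M (prod_chart (chart_at M p) (chart_at M q)) (chart_at M (\<mu> p q)) mult (p, q)"
  by (intro smooth_near_mult at)

lemma tmul_add: "tmul p (v + v') q (w + w') = tmul p v q w + tmul p v' q w'"
  and tmul_scale: "tmul p (scal M t v) q (scal M t w) = scal M t (tmul p v q w)"
  and tmul_zero: "tmul p 0 q 0 = 0"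
  unfolding tmul_def
  using local_diff_linear(1)[OF mod(3) module tmul_near, of p q "(v, w)" "(v', w')"]
    local_diff_linear(2)[OF mod(3) module tmul_near, of p q t "(v, w)"]
    local_diff_linear(4)[OF mod(3) module tmul_near, of p q]
  by (simp_all add: prod_scale_def zero_prod_def)

lemma tmul_minus: "tmul p (- v) q 0 = - tmul p v q 0"
  using tmul_add[of p v "- v" q 0 0] by (simp add: tmul_zero eq_neg_iff_add_eq_0 add.commute)

lemma tmul_in_charts:
  assumes c: "c1 \<in> atlas M" "c2 \<in> atlas M" "c3 \<in> atlas M" "p \<in> fst c1" "q \<in> fst c2" "\<mu> p q \<in> fst c3"
  shows "chart_vec M c3 (\<mu> p q) (tmul p v q w) =
    mult_diff c1 c2 c3 p q (chart_vec M c1 p v, chart_vec M c2 q w)"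
proof -
  let ?c1 = "chart_at M p" and ?c2 = "chart_at M q" and ?c3 = "chart_at M (\<mu> p q)"
  let ?C = "prod_chart ?c1 ?c2"
  note inj2 = prod_chart_inj[OF inj[OF at(1)] inj[OF at(1)]]
  note tr = chart_transition[OF manifold at_comp atlas_compatible[OF smooth] at(2)]
  note fst = smooth_near_fst[OF module module inj[OF at(1)] opn[OF at(1)] inj[OF at(1)] opn[OF at(1)] at(2) at(2), of p q]
  note snd = smooth_near_snd[OF module module inj[OF at(1)] opn[OF at(1)] inj[OF at(1)] opn[OF at(1)] at(2) at(2), of p q]
  have 1: "smooth_near (prod_mfd M M) M ?C c1 fst (p, q)"
    "local_diff (prod_mfd M M) M ?C c1 fst (p, q) (v, w) = chart_vec M c1 p v"
    using smooth_near_compose[OF mod(3,1) inj2 inj[OF at(1)] fst(1), where P = M and c'' = c1 and g = id]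
      local_diff_compose[OF mod(3) module module inj2 inj[OF at(1)] fst(1), where c'' = c1 and g = id and v = "(v, w)"]
      tr[OF c(1,4)] by (simp_all add: fst(2) chart_vec_def)
  have 2: "smooth_near (prod_mfd M M) M ?C c2 snd (p, q)"
    "local_diff (prod_mfd M M) M ?C c2 snd (p, q) (v, w) = chart_vec M c2 q w"
    using smooth_near_compose[OF mod(3,1) inj2 inj[OF at(1)] snd(1), where P = M and c'' = c2 and g = id]
      local_diff_compose[OF mod(3) module module inj2 inj[OF at(1)] snd(1), where c'' = c2 and g = id and v = "(v, w)"]
      tr[OF c(2,5)] by (simp_all add: snd(2) chart_vec_def)
  have "chart_vec M c3 (\<mu> p q) (tmul p v q w) =
      local_diff (prod_mfd M M) M ?C c3 (id \<circ> mult) (p, q) (v, w)"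
    unfolding chart_vec_def tmul_def
    using local_diff_compose[OF mod(3) module module inj2 inj[OF at(1)] tmul_near, where c'' = c3 and g = id and v = "(v, w)"]
      tr[OF c(3,6)] by simp
  also have "id \<circ> mult = (\<lambda>x. \<mu> (fst x) (snd x))" by auto
  also have "local_diff (prod_mfd M M) M ?C c3 (\<lambda>x. \<mu> (fst x) (snd x)) (p, q) (v, w) =
      mult_diff c1 c2 c3 p q (chart_vec M c1 p v, chart_vec M c2 q w)"
    using mult_chain(2)[OF mod(3) inj2 c(1-3) 1(1) 2(1), of "(v, w)"] c(6) by (simp add: 1(2) 2(2))
  finally show ?thesis .
qed

lemma tmul_const_left: "smooth_near M M (chart_at M q) (chart_at M (\<mu> p q)) (\<mu> p) q"
    "local_diff M M (chart_at M q) (chart_at M (\<mu> p q)) (\<mu> p) q w = tmul p 0 q w"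
  unfolding tmul_def by (rule smooth_near_symmetry[OF at(1) at(1) at(2) at(2) at(1) at(2)])+

lemma tangent_map_symmetry: "tangent_map M M (\<mu> p) (q, w) = (\<mu> p q, tmul p 0 q w)"
  by (simp add: tangent_map_def tmul_const_left)

lemma tmul_zero_same: "tmul p 0 p w = - w"
  using tangent_symmetry[of p w] by (simp add: tangent_map_symmetry)

lemma tmul_diag: "tmul p v p v = v"
proof -
  note id = chart_transition[OF manifold at_comp at_comp at(2) at(2), of p]
  show ?thesis
    using mult_chain(2)[OF mod(1) inj[OF at(1)] at(1) at(1) at(1) id id, of "\<mu> p p" v] at(2)[of p]
    by (simp add: tmul_def idem local_diff_id_same[OF manifold at_comp at(2)] flip: id_def)
qed

text \<open>This combines \<open>T\<mu>(v, v) = v\<close> with \<open>T\<mu>(0, v) = -v\<close>.\<close>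

lemma tmul_same_zero: "tmul p v p 0 = v + v"
  using tmul_add[of p v 0 p 0 v] by (simp add: tmul_diag tmul_zero_same eq_diff_eq)

text \<open>The distributive law for \<open>T\<mu>\<close>, by differentiating the one for \<open>\<mu>\<close>.\<close>

lemma tmul_distrib:
  "tmul p u (\<mu> q r) (tmul q v r w) = tmul (\<mu> p q) (tmul p u q v) (\<mu> p r) (tmul p u r w)"
proof -
  let ?P = "prod_mfd M (prod_mfd M M)"
  let ?C = "prod_chart (chart_at M p) (prod_chart (chart_at M q) (chart_at M r))"
  let ?t = "(p, q, r)" and ?v = "(u, v, w)"
  have P: "calculus_module (scal ?P)" by (simp add: calculus_module_prod module)
  note cP = calculus_module_cont_module[OF P]
  note i = inj[OF at(1)] opn[OF at(1)]
  note i2 = prod_chart_inj[OF i(1) i(1)] prod_chart_open[OF i(2) i(2)]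
  have i3: "inj_on (snd ?C) (fst ?C)" by (rule prod_chart_inj[OF i(1) i2(1)])
  have at2: "(q, r) \<in> fst (prod_chart (chart_at M q) (chart_at M r))" by (simp add: at)
  note x = smooth_near_fst[OF module mod(2) i i2 at(2) at2, of p]
  note yz = smooth_near_snd[OF module mod(2) i i2 at(2) at2, of p]
  note y0 = smooth_near_fst[OF module module i i at(2) at(2), of q r]
  note z0 = smooth_near_snd[OF module module i i at(2) at(2), of q r]
  have y: "smooth_near ?P M ?C (chart_at M q) (\<lambda>t. fst (snd t)) ?t"
    "local_diff ?P M ?C (chart_at M q) (\<lambda>t. fst (snd t)) ?t ?v = v"
    using smooth_near_compose[OF cP mod(3) i3 i2(1) yz(1), where P = M and g = fst] y0(1)
      local_diff_compose[OF cP mod(2) module i3 i2(1) yz(1), where g = fst and v = ?v]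
    by (simp_all add: yz(2) y0(2) comp_def)
  have z: "smooth_near ?P M ?C (chart_at M r) (\<lambda>t. snd (snd t)) ?t"
    "local_diff ?P M ?C (chart_at M r) (\<lambda>t. snd (snd t)) ?t ?v = w"
    using smooth_near_compose[OF cP mod(3) i3 i2(1) yz(1), where P = M and g = snd] z0(1)
      local_diff_compose[OF cP mod(2) module i3 i2(1) yz(1), where g = snd and v = ?v]
    by (simp_all add: yz(2) z0(2) comp_def)
  note chain = mult_chain[OF cP i3 at(1) at(1) at(1)]
  have yz': "smooth_near ?P M ?C (chart_at M (\<mu> q r)) (\<lambda>t. \<mu> (fst (snd t)) (snd (snd t))) ?t"
    "local_diff ?P M ?C (chart_at M (\<mu> q r)) (\<lambda>t. \<mu> (fst (snd t)) (snd (snd t))) ?t ?v = tmul q v r w"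
    using chain[OF y(1) z(1), of "\<mu> q r"] at(2) by (simp_all add: y(2) z(2) tmul_def)
  have xy: "smooth_near ?P M ?C (chart_at M (\<mu> p q)) (\<lambda>t. \<mu> (fst t) (fst (snd t))) ?t"
    "local_diff ?P M ?C (chart_at M (\<mu> p q)) (\<lambda>t. \<mu> (fst t) (fst (snd t))) ?t ?v = tmul p u q v"
    using chain[OF x(1) y(1), of "\<mu> p q"] at(2) by (simp_all add: x(2) y(2) tmul_def)
  have xz: "smooth_near ?P M ?C (chart_at M (\<mu> p r)) (\<lambda>t. \<mu> (fst t) (snd (snd t))) ?t"
    "local_diff ?P M ?C (chart_at M (\<mu> p r)) (\<lambda>t. \<mu> (fst t) (snd (snd t))) ?t ?v = tmul p u r w"
    using chain[OF x(1) z(1), of "\<mu> p r"] at(2) by (simp_all add: x(2) z(2) tmul_def)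
  let ?c = "chart_at M (\<mu> p (\<mu> q r))"
  have "local_diff ?P M ?C ?c (\<lambda>t. \<mu> (fst t) (\<mu> (fst (snd t)) (snd (snd t)))) ?t ?v =
      tmul p u (\<mu> q r) (tmul q v r w)"
    using chain(2)[OF x(1) yz'(1), of "\<mu> p (\<mu> q r)" ?v] at(2) by (simp add: x(2) yz'(2) tmul_def)
  moreover have "local_diff ?P M ?C ?c (\<lambda>t. \<mu> (\<mu> (fst t) (fst (snd t))) (\<mu> (fst t) (snd (snd t)))) ?t ?v =
      tmul (\<mu> p q) (tmul p u q v) (\<mu> p r) (tmul p u r w)"
    using chain(2)[OF xy(1) xz(1), of "\<mu> p (\<mu> q r)" ?v] at(2)
    by (simp add: xy(2) xz(2) tmul_def distrib[of p q r, symmetric])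
  moreover have "(\<lambda>t :: 'm \<times> 'm \<times> 'm. \<mu> (fst t) (\<mu> (fst (snd t)) (snd (snd t)))) =
      (\<lambda>t. \<mu> (\<mu> (fst t) (fst (snd t))) (\<mu> (fst t) (snd (snd t))))"
    by (rule ext, rule distrib)
  ultimately show ?thesis by (simp only:)
qed

subsection \<open>The derivation with prescribed value at a point\<close>

text \<open>
  For a tangent vector \<open>v\<close> at \<open>a\<close>, the composition of the symmetries of \<open>TM\<close> at \<open>v\<close> and at the zero vector
  over \<open>a\<close> is an automorphism of \<open>TM\<close> over the identity of \<open>M\<close>.  It maps the zero section to the vector
  field \<open>ext_field a v\<close>, which therefore is a homomorphism.  Its value at \<open>a\<close> is \<open>v + v\<close>, so that the
  derivation with value \<open>v\<close> is obtained from half of \<open>v\<close>.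
\<close>

definition ext_field :: "'m \<Rightarrow> 'e \<Rightarrow> 'm \<Rightarrow> 'e"
  where "ext_field a v p = tmul a v (\<mu> a p) 0"

text \<open>The zero section is a homomorphism, and so are the two symmetries of \<open>TM\<close>.\<close>

lemma ext_field_hom: "ext_field a v (\<mu> p q) = tmul p (ext_field a v p) q (ext_field a v q)"
proof -
  have "ext_field a v (\<mu> p q) = tmul a v (\<mu> (\<mu> a p) (\<mu> a q)) (tmul (\<mu> a p) 0 (\<mu> a q) 0)"
    by (simp only: ext_field_def distrib[of a p q] tmul_zero)
  also have "\<dots> = tmul (\<mu> a (\<mu> a p)) (ext_field a v p) (\<mu> a (\<mu> a q)) (ext_field a v q)"
    unfolding ext_field_def by (rule tmul_distrib)
  finally show ?thesis by (simp only: invol)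
qed

text \<open>
  The right hand side is visibly smooth as a function of \<open>p\<close>.  It is also the form in which derivations
  enter the computation in a bundle chart.
\<close>

lemma ext_field_in_chart:
  assumes c: "c0 \<in> atlas M" "c1 \<in> atlas M" "c \<in> atlas M" "a \<in> fst c0" "\<mu> a p \<in> fst c1" "p \<in> fst c"
  shows "field_in_chart M c (ext_field a v) (snd c p) =
    differential (scal (prod_mfd M M)) (scal M) (local_map (prod_chart c0 c1) c mult)
      (snd c0 a, snd c1 (\<mu> a p)) (chart_vec M c0 a v, 0)"
proof -
  have "chart_vec M c (\<mu> a (\<mu> a p)) (tmul a v (\<mu> a p) 0) =
      mult_diff c0 c1 c a (\<mu> a p) (chart_vec M c0 a v, chart_vec M c1 (\<mu> a p) 0)"
    by (rule tmul_in_charts) (use c in \<open>simp_all add: invol\<close>)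
  moreover have "chart_vec M c1 (\<mu> a p) 0 = 0"
    by (rule chart_vec_linear(4)[OF manifold atlas_compatible[OF smooth c(2)] c(5)])
  ultimately show ?thesis
    by (simp add: field_in_chart_at[OF inj[OF c(3)] c(6)] ext_field_def invol local_diff_def)
qed

lemma vector_field_ext_field: "vector_field M (ext_field a v)"
proof (rule vector_fieldI[OF manifold])
  fix p
  let ?ca = "chart_at M a" and ?cb = "chart_at M (\<mu> a p)" and ?c = "chart_at M p"
  let ?g = "local_map (prod_chart ?ca ?cb) ?c mult" and ?s = "local_map ?c ?cb (\<mu> a)"
  have s: "smooth_near M M ?c ?cb (\<mu> a) p" by (rule tmul_const_left(1))
  have "smooth_near (prod_mfd M M) M (prod_chart ?ca ?cb) ?c mult (a, \<mu> a p)"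
    by (rule smooth_near_mult[OF at(1) at(1) at(1) at(2) at(2)]) (simp add: at invol)
  then have g: "smooth_at (scal (prod_mfd M M)) (scal M) ?g (snd ?ca a, ?s (snd ?c p))"
    using smooth_nearD(4)[of "prod_mfd M M" M "prod_chart ?ca ?cb" ?c mult "(a, \<mu> a p)"]
    by (simp add: local_map_at[OF inj[OF at(1)] at(2)])
  have "smooth_at (scal M) (scal M)
      (\<lambda>y. differential (scal (prod_mfd M M)) (scal M) ?g (snd ?ca a, ?s y) (chart_vec M ?ca a v, 0)) (snd ?c p)"
    by (rule smooth_at_differential[OF mod(1,3) module, where p = "\<lambda>y. (snd ?ca a, ?s y)", OF g])
      (simp_all add: smooth_at_Pair smooth_at_const mod smooth_nearD(4)[OF s] mod(3)[simplified])
  then have "smooth_at (scal M) (scal M) (field_in_chart M ?c (ext_field a v)) (snd ?c p)"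
  proof (rule smooth_at_cong)
    show "\<forall>\<^sub>F y in nhds (snd ?c p). differential (scal (prod_mfd M M)) (scal M) ?g (snd ?ca a, ?s y)
        (chart_vec M ?ca a v, 0) = field_in_chart M ?c (ext_field a v) y"
      using smooth_nearD(3)[OF s]
    proof eventually_elim
      case (elim y)
      then obtain q where q: "q \<in> fst ?c" "\<mu> a q \<in> fst ?cb" "y = snd ?c q" by (rule local_domE)
      show ?case
        unfolding q(3) local_map_at[OF inj[OF at(1)] q(1)]
        by (rule ext_field_in_chart[symmetric]) (simp_all add: at q)
    qed
  qed
  then show "\<exists>c. compatible_chart M c \<and> p \<in> fst c \<and>
      smooth_at (scal M) (scal M) (field_in_chart M c (ext_field a v)) (snd c p)"
    using at_comp at by blast
qed

lemma ext_field_minus_derivation: "ext_field a v \<in> minus_derivations M \<mu> a"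
proof -
  have "ext_field a v \<in> derivations M \<mu>"
    using vector_field_ext_field[of a v]
    by (simp add: derivations_def symmetric_hom_def vector_field_def tangent_product_tmul ext_field_hom)
  moreover have "tmul a 0 (\<mu> a p) (ext_field a v (\<mu> a p)) = - ext_field a v p" for p
  proof -
    have "tmul a 0 (\<mu> a p) (ext_field a v (\<mu> a p)) = tmul a 0 (\<mu> a p) (tmul a v p 0)"
      by (simp only: ext_field_def invol)
    also have "\<dots> = tmul a (- v) (\<mu> a p) 0"
      using tmul_distrib[of a 0 a p v 0] by (simp add: idem tmul_zero_same tmul_zero)
    finally show ?thesis by (simp add: tmul_minus ext_field_def)
  qed
  ultimately show ?thesis
    by (simp add: minus_derivations_def tangent_map_symmetry invol)
qed

text \<open>
  Let \<open>q = \<sigma>\<^sub>a p\<close>.  As \<open>X\<close> is a homomorphism, \<open>X(p)\<close> is the product of \<open>X(a)\<close> and \<open>X(q)\<close> under \<open>T\<mu>\<close>, which is the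
  sum of the products of \<open>X(a)\<close> with 0 and of 0 with \<open>X(q)\<close>; the latter is \<open>- X(p)\<close>.
\<close>

lemma minus_derivation_double:
  assumes X: "X \<in> minus_derivations M \<mu> a"
  shows "X p + X p = ext_field a (X a) p"
proof -
  let ?q = "\<mu> a p"
  have "X (\<mu> a ?q) = tmul a (X a) ?q (X ?q)"
    using X by (simp add: minus_derivations_def derivations_def symmetric_hom_def tangent_product_tmul)
  also have "\<dots> = tmul a (X a) ?q 0 + tmul a 0 ?q (X ?q)"
    using tmul_add[of a "X a" 0 ?q 0 "X ?q"] by simp
  also have "tmul a 0 ?q (X ?q) = - X p"
    using X by (simp add: minus_derivations_def tangent_map_symmetry)
  finally show ?thesis by (simp add: invol ext_field_def eq_diff_eq)
qed

context
  fixes h :: 'k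
  assumes half: "h * 2 = 1"
begin

lemma scale_half: "scal M h x + scal M h x = x"
proof -
  interpret module: calculus_module "scal M" by (rule module)
  show ?thesis using half by (simp add: mult_2_right flip: module.scale_left_distrib)
qed

lemma half_unique: "x + x = y \<Longrightarrow> x = scal M h y"
proof -
  interpret module: calculus_module "scal M" by (rule module)
  assume "x + x = y"
  then show "x = scal M h y" using scale_half[of x] module.scale_right_distrib[of h x x] by simp
qed

lemma ext_field_at: "ext_field a (scal M h v) a = v"
  by (simp add: ext_field_def idem tmul_same_zero scale_half)

lemma ext_field_half: "ext_field a (scal M h v) p = scal M h (ext_field a v p)"
proof -
  interpret module: calculus_module "scal M" by (rule module)
  show ?thesis
    using tmul_scale[of a h v "\<mu> a p" 0] unfolding ext_field_def module.scale_zero_right .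
qed

text \<open>
  A field in the minus-one eigenspace is determined by its value at \<open>a\<close>, being half of \<open>ext_field\<close> of this
  value; conversely, this expression always is such a field.
\<close>

lemma ext_minus_derivations:
  "the_inv_into (minus_derivations M \<mu> a) (\<lambda>X. X a) v = ext_field a (scal M h v)"
proof (rule the_inv_into_f_eq)
  show "ext_field a (scal M h v) \<in> minus_derivations M \<mu> a" by (rule ext_field_minus_derivation)
  show "ext_field a (scal M h v) a = v" by (rule ext_field_at)
  have *: "ext_field a (scal M h (X a)) = X" if "X \<in> minus_derivations M \<mu> a" for X
    by (rule ext) (rule trans[OF ext_field_half half_unique[OF minus_derivation_double[OF that], symmetric]])
  show "inj_on (\<lambda>X. X a) (minus_derivations M \<mu> a)"
  proof (rule inj_onI)
    fix X Y assume X: "X \<in> minus_derivations M \<mu> a" and Y: "Y \<in> minus_derivations M \<mu> a"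
      and eq: "X a = Y a"
    show "X = Y" using *[OF X] *[OF Y] unfolding eq by (rule trans[OF sym])
  qed
qed

lemma lts_ext_field:
  "lts M \<mu> a u v w = lie_bracket M
    (lie_bracket M (ext_field a (scal M h u)) (ext_field a (scal M h v))) (ext_field a (scal M h w)) a"
  unfolding lts_def Let_def ext_minus_derivations ..

end

end

section \<open>The curvature in a bundle chart\<close>

text \<open>
  The curvature in a bundle chart, as a function of the connection form \<open>b\<close>, for which the horizontal
  vectors at \<open>(x, u)\<close> are the vectors \<open>(w, - b x w u)\<close>.
\<close>

definition chart_curvature ::
  "('k::{zero, topological_space} \<Rightarrow> 'e::{plus, topological_space} \<Rightarrow> 'e) \<Rightarrow>
   ('k \<Rightarrow> 'v::{ab_group_add, topological_space} \<Rightarrow> 'v) \<Rightarrow>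
   ('e \<Rightarrow> 'e \<Rightarrow> 'v \<Rightarrow> 'v) \<Rightarrow> 'e \<Rightarrow> 'e \<Rightarrow> 'e \<Rightarrow> 'v \<Rightarrow> 'v"
  where "chart_curvature sE sV b a v w u =
    differential sE sV (\<lambda>x. b x v u) a w - differential sE sV (\<lambda>x. b x w u) a v
    - b a v (b a w u) + b a w (b a v u)"

locale local_connection =
  fixes sE :: "'k::{comm_ring_1, topological_ab_group_add, topological_semigroup_mult}
      \<Rightarrow> 'e::{ab_group_add, t2_space} \<Rightarrow> 'e"
    and sV :: "'k \<Rightarrow> 'v::{ab_group_add, t2_space} \<Rightarrow> 'v"
    and a :: 'e and b :: "'e \<Rightarrow> 'e \<Rightarrow> 'v \<Rightarrow> 'v"
  assumes E: "calculus_module sE" and V: "calculus_module sV"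
    and smooth_b: "smooth_at (prod_scale sE (prod_scale sE sV)) sV (\<lambda>(x, v, u). b x v u) (a, v, u)"
    and bilinear: "\<forall>\<^sub>F x in nhds a. (\<forall>u. module_hom sE sV (\<lambda>v. b x v u)) \<and> (\<forall>v. module_hom sV sV (b x v))"
begin

abbreviation "sF \<equiv> prod_scale sE sV"
abbreviation "sT \<equiv> prod_scale sE (prod_scale sE sV)"

lemma modules:
  "cont_module sE" "cont_module sV" "calculus_module sF" "cont_module sF" "calculus_module sT" "cont_module sT"
  by (simp_all add: E V calculus_module_prod calculus_module_cont_module)

lemma bilinear_b:
  "b a (v + v') u = b a v u + b a v' u" "b a (- v) u = - b a v u" "b a (sE t v) u = sV t (b a v u)"
  "b a v (u + u') = b a v u + b a v u'" "b a v (- u) = - b a v u" "b a v (sV t u) = sV t (b a v u)"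
proof -
  have v: "module_hom sE sV (\<lambda>v. b a v u)" and u: "module_hom sV sV (b a v)" for u v
    using eventually_nhds_x_imp_x[OF bilinear] by auto
  show "b a (v + v') u = b a v u + b a v' u" "b a (- v) u = - b a v u" "b a (sE t v) u = sV t (b a v u)"
    using module_hom.add[OF v] module_hom.neg[OF v] module_hom.scale[OF v] by auto
  show "b a v (u + u') = b a v u + b a v u'" "b a v (- u) = - b a v u" "b a v (sV t u) = sV t (b a v u)"
    using module_hom.add[OF u] module_hom.neg[OF u] module_hom.scale[OF u] by auto
qed

lemma zero_b: "b a v 0 = 0" "b a 0 u = 0"
  using bilinear_b(4)[of v 0 0] bilinear_b(1)[of 0 0 u] by simp_all

lemma smooth_b_compose:
  assumes s: "cont_module s" and x: "p x = a" "smooth_at s sE p x" "smooth_at s sE v x" "smooth_at s sV u x"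
  shows "smooth_at s sV (\<lambda>x. b (p x) (v x) (u x)) x"
proof -
  have "smooth_at s sT (\<lambda>x. (p x, v x, u x)) x" by (intro smooth_at_Pair modules x)
  from smooth_at_compose[OF s modules(6) _ this, of sV "\<lambda>(x, v, u). b x v u"]
  show ?thesis by (simp add: x(1) smooth_b)
qed

lemma smooth_b_point: "smooth_at sE sV (\<lambda>x. b x v u) a"
  by (rule smooth_b_compose) (simp_all add: modules smooth_at_id smooth_at_const)

text \<open>Product rule for a map that is linear in two of its three arguments.\<close>

lemma differential_b:
  assumes s: "calculus_module s" and x: "p x = a" "smooth_at s sE p x" "smooth_at s sE v x" "smooth_at s sV u x"
  shows "differential s sV (\<lambda>x. b (p x) (v x) (u x)) x d =
    differential sE sV (\<lambda>y. b y (v x) (u x)) a (differential s sE p x d) +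
    b a (differential s sE v x d) (u x) + b a (v x) (differential s sV u x d)"
proof -
  note cs = calculus_module_cont_module[OF s]
  let ?b = "\<lambda>(x, v, u). b x v u" and ?b' = "\<lambda>p. b a (fst p) (snd p)"
  have sm: "smooth_at s sF (\<lambda>x. (v x, u x)) x" "smooth_at s sT (\<lambda>x. (p x, v x, u x)) x"
    by (intro smooth_at_Pair modules x)+
  have b': "smooth_at sF sV ?b' (v, u)" for v u
    by (rule smooth_b_compose)
      (simp_all add: modules smooth_at_const smooth_at_linear continuous_linear_fst continuous_linear_snd)
  have 1: "differential sE sV (\<lambda>v. b a v u) v w = b a w u" for u v w
    by (rule differential_along_line[OF modules(1) V])
      (simp_all add: bilinear_b smooth_b_compose modules smooth_at_id smooth_at_const)
  have 2: "differential sV sV (\<lambda>u. b a v u) u w = b a v w" for u v w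
    by (rule differential_along_line[OF modules(2) V])
      (simp_all add: bilinear_b smooth_b_compose modules smooth_at_id smooth_at_const)
  have b'd: "differential sF sV ?b' (v, u) (v', u') = b a v' u + b a v u'" for v u v' u'
    using differential_partials[OF E V V b', of v u v' u'] by (simp add: 1 2)
  have bd: "differential sT sV ?b (a, v, u) (x', v', u') =
      differential sE sV (\<lambda>y. b y v u) a x' + b a v' u + b a v u'" for v u x' v' u'
    using differential_partials[OF E modules(3) V smooth_b, of v u x' "(v', u')"] b'd[of v u v' u']
    by (simp add: case_prod_unfold)
  have "differential s sV (\<lambda>x. b (p x) (v x) (u x)) x d =
      differential sT sV ?b (a, v x, u x) (differential s sT (\<lambda>x. (p x, v x, u x)) x d)"
    using differential_compose[OF cs modules(5) V _ sm(2), of ?b d] by (simp add: x(1) smooth_b)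
  also have "differential s sT (\<lambda>x. (p x, v x, u x)) x d =
      (differential s sE p x d, differential s sE v x d, differential s sV u x d)"
    by (simp add: differential_Pair[OF cs E modules(3) x(2) sm(1)] differential_Pair[OF cs E V x(3,4)])
  finally show ?thesis by (simp add: bd)
qed

lemma chart_curvature_scale:
  "chart_curvature sE sV b a v w (sV t u) = sV t (chart_curvature sE sV b a v w u)"
proof -
  interpret V: calculus_module sV by (rule V)
  have "differential sE sV (\<lambda>x. b x v (sV t u)) a w = sV t (differential sE sV (\<lambda>x. b x v u) a w)" for v w
  proof -
    have "\<forall>\<^sub>F x in nhds a. sV t (b x v u) = b x v (sV t u)"
      using bilinear
    proof eventually_elim
      case (elim x)
      then have "module_hom sV sV (b x v)" by blast
      from module_hom.scale[OF this] show ?case by simp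
    qed
    from differential_cong[OF modules(1) V smooth_at_scale[OF modules(2) smooth_b_point] this]
    show ?thesis by (simp add: differential_scale[OF modules(1) V smooth_b_point])
  qed
  then show ?thesis
    unfolding chart_curvature_def bilinear_b by (simp add: V.scale_right_distrib V.scale_right_diff_distrib)
qed

subsection \<open>Brackets of horizontal lifts\<close>

definition hlift :: "('e \<Rightarrow> 'e) \<Rightarrow> 'e \<times> 'v \<Rightarrow> 'e \<times> 'v"
  where "hlift X = (\<lambda>(x, u). (X x, - b x (X x) u))"

lemma hlift_smooth:
  assumes X: "smooth_at sE sE X a"
  shows "smooth_at sF sF (hlift X) (a, u)"
    and "differential sF sF (hlift X) (a, u) (x', u') = (differential sE sE X a x',
      - (differential sE sV (\<lambda>x. b x (X a) u) a x' + b a (differential sE sE X a x') u + b a (X a) u'))"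
proof -
  have fst: "smooth_at sF sE fst (a, u)" and snd: "smooth_at sF sV snd (a, u)"
    by (simp_all add: smooth_at_linear continuous_linear_fst continuous_linear_snd)
  have Xf: "smooth_at sF sE (\<lambda>p. X (fst p)) (a, u)"
    by (rule smooth_at_compose[OF modules(4,1) _ fst]) (simp add: X)
  have dX: "differential sF sE (\<lambda>p. X (fst p)) (a, u) (x', u') = differential sE sE X a x'"
    using differential_compose[OF modules(4) E E _ fst, of X "(x', u')"] X
    by (simp add: differential_linear[OF modules(4) E continuous_linear_fst])
  have bX: "smooth_at sF sV (\<lambda>p. b (fst p) (X (fst p)) (snd p)) (a, u)"
    by (rule smooth_b_compose[OF modules(4) _ fst Xf snd]) simp
  have eq: "hlift X = (\<lambda>p. (X (fst p), - b (fst p) (X (fst p)) (snd p)))"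
    by (auto simp: hlift_def)
  show "smooth_at sF sF (hlift X) (a, u)"
    unfolding eq by (intro smooth_at_Pair smooth_at_minus modules Xf bX)
  show "differential sF sF (hlift X) (a, u) (x', u') = (differential sE sE X a x',
      - (differential sE sV (\<lambda>x. b x (X a) u) a x' + b a (differential sE sE X a x') u + b a (X a) u'))"
    unfolding eq
    by (simp add: differential_Pair[OF modules(4) E V Xf smooth_at_minus[OF modules(2) bX]]
        differential_minus[OF modules(4) V bX] differential_b[OF modules(3) _ fst Xf snd] dX
        differential_linear[OF modules(4) E continuous_linear_fst]
        differential_linear[OF modules(4) V continuous_linear_snd])
qed

text \<open>
  The derivatives of \<open>X\<close> and \<open>Y\<close> enter only through \<open>b([X,Y], u)\<close>, which is the fibre component of the lift of
  the bracket.
\<close>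

lemma bracket_hlift:
  assumes X: "smooth_at sE sE X a" and Y: "smooth_at sE sE Y a"
  shows "hlift (bracket sE X Y) (a, u) - bracket sF (hlift X) (hlift Y) (a, u) =
    (0, chart_curvature sE sV b a (X a) (Y a) u)"
proof -
  have at: "hlift Z (a, u) = (Z a, - b a (Z a) u)" for Z by (simp add: hlift_def)
  have "b a (v - w) u = b a v u - b a w u" for v w
    using bilinear_b(1)[of v "- w" u] by (simp add: bilinear_b)
  then show ?thesis
    unfolding bracket_def[of sF] at hlift_smooth(2)[OF X] hlift_smooth(2)[OF Y]
    by (simp add: bracket_def chart_curvature_def bilinear_b)
qed

end

section \<open>Derivations of a symmetric bundle in a bundle chart\<close>

text \<open>
  In a bundle chart, the product of a zero vector over \<open>x\<close> and a vector \<open>u\<close> over \<open>q\<close> is a map \<open>g (x, q, u)\<close>,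
  linear in \<open>u\<close>.  Invariance of the connection says that its differential in \<open>(q, u)\<close> maps the horizontal
  vectors \<open>(w, - b q w u)\<close> to horizontal vectors.
\<close>

locale local_symmetric_bundle = local_connection sE sV a b
  for sE :: "'k::{comm_ring_1, topological_ab_group_add, topological_semigroup_mult}
      \<Rightarrow> 'e::{ab_group_add, t2_space} \<Rightarrow> 'e"
    and sV :: "'k \<Rightarrow> 'v::{ab_group_add, t2_space} \<Rightarrow> 'v" and a b +
  fixes g :: "'e \<times> 'e \<times> 'v \<Rightarrow> 'e \<times> 'v" and h :: 'k
  assumes half: "h * 2 = 1"
    and smooth_g: "\<forall>\<^sub>F p in nhds (a, a). \<forall>u. smooth_at sT sF g (fst p, snd p, u)"
    and base_g: "\<forall>\<^sub>F p in nhds (a, a). \<forall>u. fst (g (fst p, snd p, u)) = fst (g (fst p, snd p, 0))"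
    and linear_g: "\<forall>\<^sub>F p in nhds (a, a). \<forall>u u' t.
      snd (g (fst p, snd p, u + u')) = snd (g (fst p, snd p, u)) + snd (g (fst p, snd p, u')) \<and>
      snd (g (fst p, snd p, sV t u)) = sV t (snd (g (fst p, snd p, u)))"
    and invariant_g: "\<forall>\<^sub>F p in nhds (a, a). \<forall>u w.
      snd (differential sT sF g (fst p, snd p, u) (0, w, - b (snd p) w u)) =
      - b (fst (g (fst p, snd p, u)))
        (fst (differential sT sF g (fst p, snd p, u) (0, w, - b (snd p) w u))) (snd (g (fst p, snd p, u)))"
    and diag_g: "\<forall>\<^sub>F x in nhds a. \<forall>u. g (x, x, u) = (x, - u)"
    and diag_diff_g: "\<forall>\<^sub>F x in nhds a. \<forall>w. fst (differential sT sF g (x, x, 0) (0, w, 0)) = - w"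
begin

abbreviation "m \<equiv> (\<lambda>P. fst (g P))"
abbreviation "n \<equiv> (\<lambda>P. snd (g P))"
abbreviation "dm \<equiv> differential sT sE m"
abbreviation "dn \<equiv> differential sT sV n"

lemma scale_half: "sE h x + sE h x = x"
proof -
  interpret s: calculus_module sE by (rule E)
  show ?thesis using half by (simp add: mult_2_right flip: s.scale_left_distrib)
qed

lemma half_sV: "sV h x + sV h x = x"
proof -
  interpret s: calculus_module sV by (rule V)
  show ?thesis using half by (simp add: mult_2_right flip: s.scale_left_distrib)
qed

lemma smooth_mn:
  assumes "smooth_at sT sF g P"
  shows "smooth_at sT sE m P" "smooth_at sT sV n P" "differential sT sF g P X = (dm P X, dn P X)"
proof -
  show *: "smooth_at sT sE m P" "smooth_at sT sV n P"
    using assms by (rule smooth_at_fst, rule smooth_at_snd)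
  show "differential sT sF g P X = (dm P X, dn P X)"
    using differential_Pair[OF modules(6) E V *] by simp
qed

lemma eventually_diag: "\<forall>\<^sub>F p in nhds (a, a). Q p \<Longrightarrow> \<forall>\<^sub>F x in nhds a. Q (x, x)"
  by (erule eventually_compose_filterlim) (intro tendsto_Pair filterlim_ident)

lemma eventually_left: "\<forall>\<^sub>F p in nhds (a, a). Q p \<Longrightarrow> \<forall>\<^sub>F x in nhds a. Q (x, a)"
  by (erule eventually_compose_filterlim) (intro tendsto_Pair filterlim_ident tendsto_const)

lemma smooth_a: "smooth_at sT sF g (a, a, u)"
  using eventually_nhds_x_imp_x[OF smooth_g] by simp

lemma g_diag: "g (a, a, u) = (a, - u)"
  using eventually_nhds_x_imp_x[OF diag_g] by simp

lemma differential_curve: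
  assumes s: "calculus_module s" and f: "smooth_at sT s f (a, a, u)"
  shows "differential sE s (\<lambda>x. f (x, x, u)) a v = differential sT s f (a, a, u) (v, v, 0)"
    and "differential sE s (\<lambda>x. f (x, a, u)) a v = differential sT s f (a, a, u) (v, 0, 0)"
    and "smooth_at sE s (\<lambda>x. f (x, x, u)) a" and "smooth_at sE s (\<lambda>x. f (x, a, u)) a"
proof -
  have i: "smooth_at sE sE (\<lambda>x. x) a" and c: "smooth_at sE sV (\<lambda>x. u) a" "smooth_at sE sE (\<lambda>x. a) a"
    by (simp_all add: smooth_at_id smooth_at_const modules)
  note p = smooth_at_Pair[OF modules(1,2) i c(1)] smooth_at_Pair[OF modules(1,2) c(2) c(1)]
  note q = smooth_at_Pair[OF modules(1,4) i p(1)] smooth_at_Pair[OF modules(1,4) i p(2)]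
  show "smooth_at sE s (\<lambda>x. f (x, x, u)) a" "smooth_at sE s (\<lambda>x. f (x, a, u)) a"
    by (rule smooth_at_compose[OF modules(1,6) _ q(1)], rule f, rule smooth_at_compose[OF modules(1,6) _ q(2)], rule f)
  have [simp]: "differential sE sE (\<lambda>x. x) a v = v"
    by (rule differential_linear[OF modules(1) E continuous_linear_id])
  show "differential sE s (\<lambda>x. f (x, x, u)) a v = differential sT s f (a, a, u) (v, v, 0)"
    using differential_compose[OF modules(1,5) s _ q(1), of f v] f
    by (simp add: differential_Pair[OF modules(1) E modules(3) i p(1)] differential_Pair[OF modules(1) E V i c(1)]
        differential_const[OF modules(1) V])
  show "differential sE s (\<lambda>x. f (x, a, u)) a v = differential sT s f (a, a, u) (v, 0, 0)"
    using differential_compose[OF modules(1,5) s _ q(2), of f v] f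
    by (simp add: differential_Pair[OF modules(1) E modules(3) i p(2)] differential_Pair[OF modules(1) E V c(2) c(1)]
        differential_const[OF modules(1) V] differential_const[OF modules(1) E] zero_prod_def)
qed

subsection \<open>First differentials\<close>

lemma diff_split:
  assumes s: "calculus_module s" and f: "smooth_at sT s f P"
  shows "differential sT s f P (v, w, y) =
    differential sT s f P (v, 0, 0) + differential sT s f P (0, w, 0) + differential sT s f P (0, 0, y)"
  using differential_add_dir[OF modules(6) s f, of "(v, w, 0)" "(0, 0, y)"]
    differential_add_dir[OF modules(6) s f, of "(v, 0, 0)" "(0, w, 0)"] by simp

text \<open>Along the fibres, \<open>n\<close> is linear and \<open>m\<close> is constant.\<close>

lemma fibre_diff:
  "\<forall>\<^sub>F p in nhds (a, a). \<forall>u y. dn (fst p, snd p, u) (0, 0, y) = n (fst p, snd p, y) \<and>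
    dm (fst p, snd p, u) (0, 0, y) = 0"
  using smooth_g linear_g base_g
proof eventually_elim
  case (elim p)
  interpret V: calculus_module sV by (rule V)
  interpret E: calculus_module sE by (rule E)
  show ?case
  proof (intro allI conjI)
    fix u y
    show "dn (fst p, snd p, u) (0, 0, y) = n (fst p, snd p, y)"
      by (rule differential_along_line[OF modules(6) V smooth_mn(2)])
        (use elim(1,2) in \<open>simp_all add: prod_scale_def\<close>)
    have m: "m (fst p, snd p, u) = m (fst p, snd p, 0)" for u using elim(3) by blast
    show "dm (fst p, snd p, u) (0, 0, y) = 0"
      by (rule differential_along_line[OF modules(6) E smooth_mn(1)])
        (use elim(1) m[of u] m[of "u + sV _ y"] in \<open>simp_all add: prod_scale_def\<close>)
  qed
qed

text \<open>
  The assumption about the zero vectors extends to all vectors, as \<open>m\<close> is constant along the fibres.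
\<close>

lemma m_diff_q: "\<forall>\<^sub>F x in nhds a. \<forall>u w. dm (x, x, u) (0, w, 0) = - w"
proof -
  have "\<forall>\<^sub>F p in nhds (a, a). \<forall>\<^sub>F q in nhds p. \<forall>u. m (fst q, snd q, u) = m (fst q, snd q, 0)"
    using base_g by (simp add: eventually_eventually)
  then have ev: "\<forall>\<^sub>F x in nhds a. \<forall>\<^sub>F q in nhds (x, x). \<forall>u. m (fst q, snd q, u) = m (fst q, snd q, 0)"
    by (rule eventually_diag)
  show ?thesis
    using ev eventually_diag[OF smooth_g] diag_diff_g
  proof eventually_elim
    case (elim x)
    show ?case
    proof (intro allI)
      fix u w
      have sm: "smooth_at sT sE m (x, x, u)" for u using elim(2) by (intro smooth_mn) simp
      have part: "dm (x, x, u) (0, w, 0) = differential sE sE (\<lambda>q. m (x, q, u)) x w"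
        and smp: "smooth_at sE sE (\<lambda>q. m (x, q, u)) x" for u
      proof -
        have i: "smooth_at sE sE (\<lambda>x. x) x" and c: "smooth_at sE sV (\<lambda>q. u) x" "smooth_at sE sE (\<lambda>q. x) x"
          by (simp_all add: smooth_at_id smooth_at_const modules)
        note p = smooth_at_Pair[OF modules(1,2) i c(1)]
        note q = smooth_at_Pair[OF modules(1,4) c(2) p]
        show "smooth_at sE sE (\<lambda>q. m (x, q, u)) x"
          by (rule smooth_at_compose[OF modules(1,6) _ q]) (rule sm)
        show "dm (x, x, u) (0, w, 0) = differential sE sE (\<lambda>q. m (x, q, u)) x w"
          using differential_compose[OF modules(1,5) E _ q, of m w] sm[of u]
          by (simp add: differential_Pair[OF modules(1) E modules(3) c(2) p]
              differential_Pair[OF modules(1) E V i c(1)] differential_const[OF modules(1) V]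
              differential_const[OF modules(1) E] differential_linear[OF modules(1) E continuous_linear_id])
      qed
      have "\<forall>\<^sub>F q in nhds x. m (x, q, 0) = m (x, q, u)"
      proof -
        have "filterlim (\<lambda>q. (x, q)) (nhds (x, x)) (nhds x)"
          by (intro tendsto_Pair filterlim_ident tendsto_const)
        from eventually_compose_filterlim[OF elim(1) this]
        show ?thesis by eventually_elim (metis fst_conv snd_conv)
      qed
      from differential_cong[OF modules(1) E smp this]
      have "dm (x, x, u) (0, w, 0) = dm (x, x, 0) (0, w, 0)" by (simp add: part)
      also have "\<dots> = - w" using elim(2,3) by (simp add: smooth_mn(3))
      finally show "dm (x, x, u) (0, w, 0) = - w" .
    qed
  qed
qed

text \<open>
  The partial differential with respect to \<open>x\<close> comes from \<open>m(x, x) = x\<close>.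
\<close>

lemma m_diff: "dm (a, a, u) (0, w, 0) = - w" "dm (a, a, u) (v, 0, 0) = v + v" "dm (a, a, u) (0, 0, y) = 0"
proof -
  show 2: "dm (a, a, u) (0, w, 0) = - w" for w using eventually_nhds_x_imp_x[OF m_diff_q] by blast
  show "dm (a, a, u) (0, 0, y) = 0" using eventually_nhds_x_imp_x[OF fibre_diff] by simp
  note sm = smooth_mn(1)[OF smooth_a[of u]]
  have "\<forall>\<^sub>F x in nhds a. x = m (x, x, u)" using diag_g by eventually_elim simp
  from differential_cong[OF modules(1) E smooth_at_id this, of v]
  have "dm (a, a, u) (v, v, 0) = v"
    by (simp add: differential_curve(1)[OF E sm] differential_linear[OF modules(1) E continuous_linear_id])
  then show "dm (a, a, u) (v, 0, 0) = v + v"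
    using differential_add_dir[OF modules(6) E sm, of "(v, 0, 0)" "(0, v, 0)"] by (simp add: 2 eq_diff_eq)
qed

text \<open>The invariance, with the horizontal vector split into its components.\<close>

lemma invariance:
  "\<forall>\<^sub>F p in nhds (a, a). \<forall>u w. dn (fst p, snd p, u) (0, w, 0) = n (fst p, snd p, b (snd p) w u)
    - b (m (fst p, snd p, u)) (dm (fst p, snd p, u) (0, w, 0)) (n (fst p, snd p, u))"
  using smooth_g linear_g invariant_g fibre_diff
proof eventually_elim
  case (elim p)
  show ?case
  proof (intro allI)
    fix u w
    let ?P = "(fst p, snd p, u)" and ?y = "b (snd p) w u"
    have sm: "smooth_at sT sF g ?P" using elim(1) by blast
    have neg: "n (fst p, snd p, - y) = - n (fst p, snd p, y)" for y
      using elim(2)[rule_format, of y "- y"] elim(2)[rule_format, of 0 0]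
      by (simp add: eq_neg_iff_add_eq_0 add.commute)
    have "dn ?P (0, w, - ?y) = dn ?P (0, w, 0) - n (fst p, snd p, ?y)"
      using differential_add_dir[OF modules(6) V smooth_mn(2)[OF sm], of "(0, w, 0)" "(0, 0, - ?y)"]
        elim(4) neg[of ?y] by simp
    moreover have "dm ?P (0, w, - ?y) = dm ?P (0, w, 0)"
      using differential_add_dir[OF modules(6) E smooth_mn(1)[OF sm], of "(0, w, 0)" "(0, 0, - ?y)"]
        elim(4) by simp
    moreover have "dn ?P (0, w, - ?y) = - b (m ?P) (dm ?P (0, w, - ?y)) (n ?P)"
      using elim(3)[rule_format, of u w] by (simp add: smooth_mn(3)[OF sm])
    ultimately show "dn ?P (0, w, 0) = n (fst p, snd p, ?y) - b (m ?P) (dm ?P (0, w, 0)) (n ?P)"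
      by (simp add: algebra_simps)
  qed
qed

text \<open>
  The invariance at \<open>x = q = a\<close> determines the partial differential with respect to \<open>q\<close>; the one with respect
  to \<open>x\<close> is its negative, because \<open>n(x, x)\<close> does not depend on \<open>x\<close>.
\<close>

lemma n_diff: "dn (a, a, u) (0, w, 0) = - (b a w u + b a w u)" "dn (a, a, u) (v, 0, 0) = b a v u + b a v u"
  "dn (a, a, u) (0, 0, y) = - y"
proof -
  show 2: "dn (a, a, u) (0, w, 0) = - (b a w u + b a w u)" for w
    using eventually_nhds_x_imp_x[OF invariance, rule_format, of u w]
    by (simp add: g_diag m_diff bilinear_b)
  show "dn (a, a, u) (0, 0, y) = - y"
    using eventually_nhds_x_imp_x[OF fibre_diff] by (simp add: g_diag)
  note sm = smooth_mn(2)[OF smooth_a[of u]]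
  have "\<forall>\<^sub>F x in nhds a. - u = n (x, x, u)" using diag_g by eventually_elim simp
  from differential_cong[OF modules(1) V smooth_at_const[OF modules(2)] this, of v]
  have "dn (a, a, u) (v, v, 0) = 0"
    by (simp add: differential_curve(1)[OF V sm] differential_const[OF modules(1) V])
  then show "dn (a, a, u) (v, 0, 0) = b a v u + b a v u"
    using differential_add_dir[OF modules(6) V sm, of "(v, 0, 0)" "(0, v, 0)"] by (simp add: 2 algebra_simps)
qed

subsection \<open>Second differentials\<close>

lemma smooth_second:
  assumes s: "calculus_module s" and f: "smooth_at sT s f P"
  shows "smooth_at sT s (\<lambda>P. differential sT s f P X) P"
  by (rule smooth_at_directional[OF modules(6) s f])

definition second_m :: "'v \<Rightarrow> 'e \<Rightarrow> 'e \<Rightarrow> 'e"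
  where "second_m u v w = differential sT sE (\<lambda>P. dm P (0, w, 0)) (a, a, u) (v, 0, 0)"

text \<open>
  The identity \<open>\<partial>\<^sub>2 m(x, x) w = - w\<close> is differentiated in \<open>x\<close>.  It follows that the mixed second differential is
  the negative of the second differential in \<open>q\<close> alone, which is symmetric.
\<close>

lemma second_m_sym: "second_m u v w = second_m u w v"
proof -
  note sm = smooth_mn(1)[OF smooth_a[of u]]
  let ?H = "\<lambda>X Y. differential sT sE (\<lambda>P. dm P X) (a, a, u) Y"
  have sym: "?H X Y = ?H Y X" for X Y
    by (rule second_differential_symmetric[OF modules(6) E sm])
  have "second_m u v w = - ?H (0, w, 0) (0, v, 0)" for v w
  proof -
    note sm2 = smooth_second[OF E sm, of "(0, w, 0)"]
    have "\<forall>\<^sub>F x in nhds a. - w = dm (x, x, u) (0, w, 0)"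
      using m_diff_q by eventually_elim simp
    from differential_cong[OF modules(1) E smooth_at_const[OF modules(1)] this, of v]
    have "?H (0, w, 0) (v, v, 0) = 0"
      by (simp add: differential_curve(1)[OF E sm2] differential_const[OF modules(1) E])
    then show ?thesis
      using differential_add_dir[OF modules(6) E sm2, of "(v, 0, 0)" "(0, v, 0)"]
      by (simp add: second_m_def eq_neg_iff_add_eq_0)
  qed
  then show ?thesis using sym by metis
qed

lemma second_m_scale: "second_m u (sE t v) w = sE t (second_m u v w)"
proof -
  interpret V: calculus_module sV by (rule V)
  interpret E: calculus_module sE by (rule E)
  show ?thesis
    using differential_scale_dir[OF modules(6) E smooth_second[OF E smooth_mn(1)[OF smooth_a[of u]]], of "(0, w, 0)" t "(v, 0, 0)"]
    by (simp add: second_m_def prod_scale_def)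
qed

lemma b_twice_neg: "differential sE sV (\<lambda>y. b y (- w) (- u)) a v = differential sE sV (\<lambda>y. b y w u) a v"
proof (rule differential_cong[OF modules(1) V smooth_b_point])
  show "\<forall>\<^sub>F y in nhds a. b y w u = b y (- w) (- u)"
    using bilinear
  proof eventually_elim
    case (elim y)
    then have "b y (- w) (- u) = - b y w (- u)" "b y w (- u) = - b y w u"
      using module_hom.neg[of sE sV "\<lambda>v. b y v (- u)" w] module_hom.neg[of sV sV "b y w" u] by auto
    then show ?case by simp
  qed
qed

text \<open>Differentiating the invariance at \<open>q = a\<close> with respect to \<open>x\<close>.\<close>

lemma second_n:
  "differential sT sV (\<lambda>P. dn P (0, w, 0)) (a, a, u) (v, 0, 0) =
    b a v (b a w u) + b a v (b a w u)
    - (differential sE sV (\<lambda>y. b y w u) a v + differential sE sV (\<lambda>y. b y w u) a v)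
    + b a (second_m u v w) u + b a w (b a v u) + b a w (b a v u)"
proof -
  note mu = smooth_mn(1)[OF smooth_a] and nu = smooth_mn(2)[OF smooth_a]
  note dmu = smooth_second[OF E mu[of u], where X = "(0, w, 0)"] and dnu = smooth_second[OF V nu[of u], where X = "(0, w, 0)"]
  note cm = differential_curve[OF E mu] and cn = differential_curve[OF V nu]
  let ?r1 = "\<lambda>x. n (x, a, b a w u)"
  let ?r2 = "\<lambda>x. b (m (x, a, u)) (dm (x, a, u) (0, w, 0)) (n (x, a, u))"
  have p: "m (a, a, u) = a" by (simp add: g_diag)
  have r2: "smooth_at sE sV ?r2 a"
    by (rule smooth_b_compose[OF modules(1) p cm(4) differential_curve(4)[OF E dmu] cn(4)])
  have "\<forall>\<^sub>F x in nhds a. ?r1 x - ?r2 x = dn (x, a, u) (0, w, 0)"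
    using eventually_left[OF invariance] by eventually_elim simp
  from differential_cong[OF modules(1) V smooth_at_diff[OF modules(2) cn(4) r2] this, of v]
  have "differential sT sV (\<lambda>P. dn P (0, w, 0)) (a, a, u) (v, 0, 0) =
      differential sE sV ?r1 a v - differential sE sV ?r2 a v"
    by (simp add: differential_curve(2)[OF V dnu] differential_diff[OF modules(1) V cn(4) r2])
  also have "differential sE sV ?r1 a v = b a v (b a w u) + b a v (b a w u)"
    by (simp add: cn(2) n_diff)
  also have "differential sE sV ?r2 a v =
      differential sE sV (\<lambda>y. b y (dm (a, a, u) (0, w, 0)) (n (a, a, u))) a (v + v) +
      b a (second_m u v w) (n (a, a, u)) + b a (dm (a, a, u) (0, w, 0)) (b a v u + b a v u)"
    using differential_b[OF E p cm(4) differential_curve(4)[OF E dmu] cn(4), where d = v]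
    by (simp add: cm(2) cn(2) differential_curve(2)[OF E dmu] m_diff n_diff second_m_def)
  also have "\<dots> = differential sE sV (\<lambda>y. b y w u) a v + differential sE sV (\<lambda>y. b y w u) a v
      - b a (second_m u v w) u - b a w (b a v u) - b a w (b a v u)"
    by (simp add: m_diff g_diag b_twice_neg bilinear_b differential_add_dir[OF modules(1) V smooth_b_point])
  finally show ?thesis by (simp add: algebra_simps)
qed

subsection \<open>The bracket of two derivations\<close>

text \<open>
  In the chart, this is the derivation of \<open>F\<close> with value \<open>(v, 0)\<close> at the zero vector over the base point: the
  product of half of this tangent vector with the zero tangent vector at the image of \<open>y\<close> under the symmetry.
\<close>

definition deriv :: "'e \<Rightarrow> 'e \<times> 'v \<Rightarrow> 'e \<times> 'v"
  where "deriv v y = differential sT sF g (a, g (a, y)) (sE h v, 0, 0)"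

lemma half_b: "b a (sE h v) u + b a (sE h v) u = b a v u"
  by (simp add: scale_half flip: bilinear_b(1))

text \<open>Over the base point, derivations of this kind are horizontal.\<close>

lemma deriv_at: "deriv v (a, u) = (v, - b a v u)"
proof -
  have "- b a (sE h v) u - b a (sE h v) u = - b a v u"
    using half_b[of v u] by (simp add: algebra_simps flip: minus_add_distrib)
  then show ?thesis
    by (simp add: deriv_def g_diag smooth_mn(3)[OF smooth_a] m_diff n_diff scale_half bilinear_b)
qed

text \<open>
  The map \<open>y \<mapsto> g (a, y)\<close> is the symmetry at the zero vector over the base point.
\<close>

lemma symmetry_smooth:
  "smooth_at sF sT (\<lambda>y. (a, g (a, y))) (a, u)"
  "differential sF sT (\<lambda>y. (a, g (a, y))) (a, u) (w, y) = (0, - w, - (b a w u + b a w u) - y)"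
proof -
  have c: "smooth_at sF sE (\<lambda>y. a) (a, u)" by (rule smooth_at_const[OF modules(1)])
  note p = smooth_at_Pair[OF modules(1,4) c smooth_at_id]
  have gp: "smooth_at sF sF (\<lambda>y. g (a, y)) (a, u)"
    by (rule smooth_at_compose[OF modules(4,6) _ p]) (rule smooth_a)
  show "smooth_at sF sT (\<lambda>y. (a, g (a, y))) (a, u)" by (rule smooth_at_Pair[OF modules(1,4) c gp])
  have "differential sF sF (\<lambda>y. g (a, y)) (a, u) (w, y) = differential sT sF g (a, a, u) (0, w, y)"
    using differential_compose[OF modules(4,5,3) _ p, of g "(w, y)"] smooth_a
    by (simp add: differential_Pair[OF modules(4) E modules(3) c smooth_at_id] differential_const[OF modules(4) E]
        differential_linear[OF modules(4,3) continuous_linear_id])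
  also have "\<dots> = (- w, - (b a w u + b a w u) - y)"
    unfolding smooth_mn(3)[OF smooth_a]
    using diff_split[OF E smooth_mn(1)[OF smooth_a], of u 0 w y] diff_split[OF V smooth_mn(2)[OF smooth_a], of u 0 w y]
    by (simp add: m_diff n_diff zero_b)
  finally show "differential sF sT (\<lambda>y. (a, g (a, y))) (a, u) (w, y) = (0, - w, - (b a w u + b a w u) - y)"
    by (simp add: differential_Pair[OF modules(4) E modules(3) c gp] differential_const[OF modules(4) E])
qed

lemma deriv_smooth:
  "smooth_at sF sF (deriv v) (a, u)"
  "differential sF sF (deriv v) (a, u) Y = differential sT sF (\<lambda>P. differential sT sF g P (sE h v, 0, 0))
    (a, a, - u) (differential sF sT (\<lambda>y. (a, g (a, y))) (a, u) Y)"
proof -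
  have d: "smooth_at sT sF (\<lambda>P. differential sT sF g P (sE h v, 0, 0)) (a, g (a, a, u))"
    unfolding g_diag by (rule smooth_at_directional[OF modules(6,3) smooth_a])
  have eq: "deriv v = (\<lambda>y. differential sT sF g (a, g (a, y)) (sE h v, 0, 0))"
    by (simp add: deriv_def fun_eq_iff)
  show "smooth_at sF sF (deriv v) (a, u)"
    unfolding eq by (rule smooth_at_compose[OF modules(4,6) d symmetry_smooth(1)])
  show "differential sF sF (deriv v) (a, u) Y = differential sT sF (\<lambda>P. differential sT sF g P (sE h v, 0, 0))
    (a, a, - u) (differential sF sT (\<lambda>y. (a, g (a, y))) (a, u) Y)"
    unfolding eq using differential_compose[OF modules(4,5,3) d symmetry_smooth(1), of Y] by (simp add: g_diag)
qed

text \<open>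
  The symmetry maps the value \<open>(w, - b a w u)\<close> of \<open>deriv w\<close> to \<open>(- w, - b a w u)\<close>, and \<open>deriv v\<close> is the composition
  of the symmetry with a partial differential of \<open>g\<close>.  Thus two second differentials of \<open>g\<close> at
  \<open>(a, a, - u)\<close> occur.  The one along the fibre is known from the first differentials; the other one is the
  mixed second differential in the base directions.
\<close>

lemma deriv_diff_deriv:
  "differential sF sF (deriv v) (a, u) (deriv w (a, u)) =
    (- sE h (second_m (- u) v w),
     - differential sE sV (\<lambda>y. b y w u) a v + b a (sE h (second_m (- u) v w)) u + b a w (b a v u))"
proof -
  interpret V: calculus_module sV by (rule V)
  interpret E: calculus_module sE by (rule E)
  let ?P = "(a, a, - u)" and ?X = "(sE h v, 0, 0)" and ?y = "- b a w u"
  note mu = smooth_mn(1)[OF smooth_a, of "- u"] and nu = smooth_mn(2)[OF smooth_a, of "- u"]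
  note dmu = smooth_second[OF E mu] and dnu = smooth_second[OF V nu]
  have ev: "\<forall>\<^sub>F P in nhds ?P. (dm P ?X, dn P ?X) = differential sT sF g P ?X"
    using smooth_at_eventually[OF smooth_a] by eventually_elim (simp add: smooth_mn(3))
  have fm: "differential sT sE (\<lambda>P. dm P ?X) ?P (0, 0, ?y) = 0"
    by (rule differential_along_line[OF modules(6) E dmu]) (simp add: prod_scale_def m_diff)
  have "dn (?P + sT t (0, 0, ?y)) ?X - dn ?P ?X = sV t (- b a v (b a w u))" for t
  proof -
    have "dn (a, a, z) ?X = b a v z" for z by (simp only: n_diff half_b)
    moreover have "b a v (- u + sV t ?y) - b a v (- u) = sV t (- b a v (b a w u))"
      by (simp only: bilinear_b) simp
    ultimately show ?thesis by (simp add: prod_scale_def)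
  qed
  then have fn: "differential sT sV (\<lambda>P. dn P ?X) ?P (0, 0, ?y) = - b a v (b a w u)"
    by (rule differential_along_line[OF modules(6) V dnu])
  have hm: "differential sT sE (\<lambda>P. dm P ?X) ?P (0, - w, 0) = - sE h (second_m (- u) v w)"
    using differential_minus_dir[OF modules(6) E dmu, of ?X "(0, w, 0)"]
      second_differential_symmetric[OF modules(6) E mu, of ?X "(0, w, 0)"] second_m_scale[of "- u" h v w]
    by (simp add: second_m_def)
  have hn: "differential sT sV (\<lambda>P. dn P ?X) ?P (0, - w, 0) =
      b a v (b a w u) - differential sE sV (\<lambda>y. b y w u) a v + b a (sE h (second_m (- u) v w)) u + b a w (b a v u)"
  proof -
    have D: "differential sE sV (\<lambda>y. b y w (- u)) a (sE h v) + differential sE sV (\<lambda>y. b y w (- u)) a (sE h v) =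
        - differential sE sV (\<lambda>y. b y w u) a v"
    proof -
      have "differential sE sV (\<lambda>y. b y w (- u)) a v = - differential sE sV (\<lambda>y. b y w u) a v"
      proof -
        have "\<forall>\<^sub>F y in nhds a. - b y w u = b y w (- u)"
          using bilinear
        proof eventually_elim
          case (elim y)
          then show ?case using module_hom.neg[of sV sV "b y w" u] by simp
        qed
        from differential_cong[OF modules(1) V smooth_at_minus[OF modules(2) smooth_b_point] this]
        show ?thesis by (simp add: differential_minus[OF modules(1) V smooth_b_point])
      qed
      then show ?thesis
        by (simp add: scale_half flip: differential_add_dir[OF modules(1) V smooth_b_point])
    qed
    have "differential sT sV (\<lambda>P. dn P ?X) ?P (0, - w, 0) =
        - differential sT sV (\<lambda>P. dn P (0, w, 0)) ?P (sE h v, 0, 0)"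
      using differential_minus_dir[OF modules(6) V dnu, of ?X "(0, w, 0)"]
        second_differential_symmetric[OF modules(6) V nu, of ?X "(0, w, 0)"] by simp
    also have "\<dots> = - (- b a v (b a w u) + differential sE sV (\<lambda>y. b y w u) a v
        - b a (sE h (second_m (- u) v w)) u - b a w (b a v u))"
      unfolding second_n D half_b second_m_scale
      using half_b[of v "b a w u"] bilinear_b(4)[of w "b a (sE h v) u" "b a (sE h v) u"]
      by (simp add: half_b bilinear_b algebra_simps) (rule half_sV)
    finally show ?thesis by (simp add: algebra_simps)
  qed
  have "differential sF sF (deriv v) (a, u) (deriv w (a, u)) =
      differential sT sF (\<lambda>P. differential sT sF g P ?X) ?P (0, - w, ?y)"
    by (simp add: deriv_smooth(2) deriv_at symmetry_smooth(2))
  also have "\<dots> = (differential sT sE (\<lambda>P. dm P ?X) ?P (0, - w, ?y), differential sT sV (\<lambda>P. dn P ?X) ?P (0, - w, ?y))"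
    using differential_cong[OF modules(6,3) smooth_at_Pair[OF modules(1,2) dmu dnu] ev]
    by (simp add: differential_Pair[OF modules(6) E V dmu dnu])
  also have "\<dots> = (- sE h (second_m (- u) v w),
     - differential sE sV (\<lambda>y. b y w u) a v + b a (sE h (second_m (- u) v w)) u + b a w (b a v u))"
    using diff_split[OF E dmu, of ?X 0 "- w" ?y] diff_split[OF V dnu, of ?X 0 "- w" ?y]
      differential_0_dir[OF modules(6) E dmu, of ?X] differential_0_dir[OF modules(6) V dnu, of ?X]
    by (simp add: fm fn hm hn zero_prod_def)
  finally show ?thesis .
qed

text \<open>
  The terms with \<open>second_m\<close> are symmetric in \<open>v\<close> and \<open>w\<close>, so that they cancel in both components.
\<close>

lemma bracket_deriv:
  "bracket sF (deriv v) (deriv w) (a, u) = (0, chart_curvature sE sV b a v w u)"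
  unfolding bracket_def deriv_diff_deriv chart_curvature_def second_m_sym[of "- u" w v]
  by (simp add: algebra_simps)

end

section \<open>Symmetric bundles\<close>

locale calculus_symmetric_bundle =
  fixes F :: "('k::{comm_ring_1, topological_ab_group_add, topological_semigroup_mult}, 'm,
      'e::{ab_group_add, t2_space}, 'b, 'v::{ab_group_add, t2_space}) vbundle"
    and \<mu> :: "'b \<Rightarrow> 'b \<Rightarrow> 'b"
    and \<mu>M :: "'m \<Rightarrow> 'm \<Rightarrow> 'm"
    and L :: "('k, 'b, 'e \<times> 'v) connection"
    and h :: 'k
  assumes dense: "closure {t :: 'k. t dvd 1} = UNIV"
    and half: "h * 2 = 1"
    and sym_bundle: "symmetric_bundle F \<mu> \<mu>M"
    and connection: "linear_connection F L"
    and invariance: "\<And>x. invariant_connection F L (\<mu> (fzero F x))"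
begin

abbreviation "sE \<equiv> scal (base F)"
abbreviation "sV \<equiv> fibre_scal F"
abbreviation "sF \<equiv> prod_scale sE sV"
abbreviation "T \<equiv> total F"
abbreviation "B \<equiv> base F"

lemma total_simps [simp]: "scal T = sF" "atlas T = batlas F"
  by (simp_all add: total_def)

lemma bundle_facts: "vector_bundle F" "symmetric_space T \<mu>" "symmetric_space B \<mu>M"
  "smooth_map T B (proj F)" "proj F (\<mu> u w) = \<mu>M (proj F u) (proj F w)"
  and mult_add: "proj F u = proj F u' \<Longrightarrow> proj F w = proj F w' \<Longrightarrow>
    \<mu> (fadd F u u') (fadd F w w') = fadd F (\<mu> u w) (\<mu> u' w')"
  and mult_smult: "\<mu> (fsmult F t u) (fsmult F t w) = fsmult F t (\<mu> u w)"
  using sym_bundle by (auto simp: symmetric_bundle_def symmetric_hom_def)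

lemma modules: "calculus_module sE" "calculus_module sV" "calculus_module sF" "cont_module sE" "cont_module sV" "cont_module sF"
proof -
  show E: "calculus_module sE" and V: "calculus_module sV"
    using bundle_facts(1) dense
    by (simp_all add: vector_bundle_def smooth_manifold_def calculus_module_def calculus_module_axioms_def)
  then show "calculus_module sF" "cont_module sE" "cont_module sV" "cont_module sF"
    by (simp_all add: calculus_module_prod calculus_module_cont_module)
qed

sublocale T: calculus_symmetric_space T \<mu>
  by (rule calculus_symmetric_space.intro) (simp_all add: modules bundle_facts)

sublocale B: calculus_symmetric_space B \<mu>M
  by (rule calculus_symmetric_space.intro) (simp_all add: modules bundle_facts)

lemma proj_simps [simp]: "proj F (fzero F x) = x" "proj F (fsmult F t u) = proj F u"
  and proj_add: "proj F u = proj F u' \<Longrightarrow> proj F (fadd F u u') = proj F u"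
  using bundle_facts(1) by (auto simp: vector_bundle_def)

lemma connection_proj: "proj F (fst \<xi>) = proj F (fst \<eta>) \<Longrightarrow> proj F (fst (cadd L \<xi> \<eta>)) = proj F (fst \<xi>)"
  using connection unfolding linear_connection_def by blast

end

text \<open>A chart \<open>c\<close> of the bundle over the chart \<open>d\<close> of the base, with the connection form \<open>b\<close>.\<close>

locale symmetric_bundle_chart = calculus_symmetric_bundle F \<mu> \<mu>M L h
  for F :: "('k::{comm_ring_1, topological_ab_group_add, topological_semigroup_mult}, 'm,
      'e::{ab_group_add, t2_space}, 'b, 'v::{ab_group_add, t2_space}) vbundle"
    and \<mu> \<mu>M L h +
  fixes c :: "('b, 'e \<times> 'v) chart" and d :: "('m, 'e) chart" and b :: "'e \<Rightarrow> 'e \<Rightarrow> 'v \<Rightarrow> 'v"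
  assumes c: "c \<in> batlas F" and d: "compatible_chart B d"
    and dom: "fst c = proj F -` fst d"
    and img: "snd c ` fst c = snd d ` fst d \<times> UNIV"
    and base_coord: "u \<in> fst c \<Longrightarrow> fst (snd c u) = snd d (proj F u)"
    and coord_zero: "x \<in> fst d \<Longrightarrow> snd (snd c (fzero F x)) = 0"
    and coord_add: "u \<in> fst c \<Longrightarrow> u' \<in> fst c \<Longrightarrow> proj F u = proj F u' \<Longrightarrow>
      snd (snd c (fadd F u u')) = snd (snd c u) + snd (snd c u')"
    and coord_smult: "u \<in> fst c \<Longrightarrow> snd (snd c (fsmult F t u)) = sV t (snd (snd c u))"
    and b_linear: "y \<in> snd d ` fst d \<Longrightarrow> module_hom sE sV (\<lambda>v. b y v z)"
      "y \<in> snd d ` fst d \<Longrightarrow> module_hom sV sV (b y v)"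
    and b_smooth: "locally_smooth (prod_scale sE (prod_scale sE sV)) sV (snd d ` fst d \<times> UNIV) (\<lambda>(x, v, u). b x v u)"
    and connection_add: "fst \<xi> \<in> fst c \<Longrightarrow> proj F (fst \<xi>) = proj F (fst \<eta>) \<Longrightarrow>
      (case tangent_coords F c (cadd L \<xi> \<eta>) of (u, v, z) \<Rightarrow> (u, v, z + b (fst (snd c (fst (cadd L \<xi> \<eta>)))) v u)) =
      (case tangent_coords F c \<xi> of (u, v, z) \<Rightarrow> (u, v, z + b (fst (snd c (fst \<xi>))) v u)) +
      (case tangent_coords F c \<eta> of (u, v, z) \<Rightarrow> (u, v, z + b (fst (snd c (fst \<eta>))) v u))"
begin

abbreviation "fib u \<equiv> snd (snd c u)"

lemma in_dom: "u \<in> fst c \<longleftrightarrow> proj F u \<in> fst d" by (simp add: dom)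

lemma c_inj: "inj_on (snd c) (fst c)" and c_open: "open (snd c ` fst c)"
  and d_inj: "inj_on (snd d) (fst d)" and d_open: "open (snd d ` fst d)"
  and c_comp: "compatible_chart T c"
  using c T.inj T.opn compatible_inj[OF d] compatible_open[OF d] atlas_compatible[OF T.smooth] by auto

lemma fibre_eqI: "u \<in> fst c \<Longrightarrow> proj F u = proj F u' \<Longrightarrow> fib u = fib u' \<Longrightarrow> u = u'"
  by (rule inj_onD[OF c_inj]) (simp_all add: prod_eq_iff base_coord in_dom)

lemma fibre_point:
  assumes "x \<in> fst d"
  obtains u where "u \<in> fst c" "proj F u = x" "fib u = y"
proof -
  have "(snd d x, y) \<in> snd c ` fst c" using assms by (auto simp: img)
  then obtain u where u: "u \<in> fst c" "snd c u = (snd d x, y)" by auto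
  then have "snd d (proj F u) = snd d x" "fib u = y" using base_coord[OF u(1)] by simp_all
  moreover have "proj F u = x"
    using inj_onD[OF d_inj calculation(1)] assms u(1) by (simp add: in_dom)
  ultimately show ?thesis using u(1) that by blast
qed

lemma coords_zero: "x \<in> fst d \<Longrightarrow> fzero F x \<in> fst c" "x \<in> fst d \<Longrightarrow> snd c (fzero F x) = (snd d x, 0)"
  by (simp_all add: in_dom prod_eq_iff base_coord coord_zero)

lemma zero_smult: "x \<in> fst d \<Longrightarrow> fsmult F t (fzero F x) = fzero F x"
proof -
  assume x: "x \<in> fst d"
  interpret V: calculus_module sV by (rule modules)
  show ?thesis by (rule fibre_eqI) (simp_all add: in_dom x coord_smult coord_zero coords_zero)
qed

lemma smult_zero: "u \<in> fst c \<Longrightarrow> fsmult F 0 u = fzero F (proj F u)"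
proof -
  assume u: "u \<in> fst c"
  interpret V: calculus_module sV by (rule modules)
  show ?thesis by (rule fibre_eqI) (use u in \<open>simp_all add: in_dom coord_smult coord_zero\<close>)
qed

lemma zero_add: "x \<in> fst d \<Longrightarrow> fadd F (fzero F x) (fzero F x) = fzero F x"
  by (rule fibre_eqI) (simp_all add: in_dom coord_add coord_zero coords_zero proj_add)

lemma smooth_near_zero:
  assumes x: "x \<in> fst d"
  shows "smooth_near B T d c (fzero F) x" and "local_diff B T d c (fzero F) x v = (v, 0)"
proof -
  have "calculus_module (scal B)" "calculus_module (scal T)" "continuous_linear (scal B) (scal T) (\<lambda>y. (y, 0))"
    by (simp_all add: modules continuous_linear_inl)
  note * = smooth_near_linear[OF this(1,2) d_inj d_open x _ _ this(3)]
  show "smooth_near B T d c (fzero F) x" by (rule *(1)) (simp_all add: coords_zero)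
  show "local_diff B T d c (fzero F) x v = (v, 0)" by (rule *(2)) (simp_all add: coords_zero)
qed

text \<open>Vertical vectors have the same form in all bundle charts, as chart transitions are linear along the fibres.\<close>

lemma chart_vec_vertical_of:
  assumes c': "symmetric_bundle_chart F \<mu> \<mu>M L h c' d' b'" and u: "u \<in> fst c" "u \<in> fst c'" and z: "proj F z = proj F u"
  shows "local_diff T T c' c id u (0, snd (snd c' z)) = (0, fib z)"
proof -
  interpret c': symmetric_bundle_chart F \<mu> \<mu>M L h c' d' b' by (rule c')
  interpret V: calculus_module sV by (rule modules)
  interpret E: calculus_module sE by (rule modules)
  note near = chart_transition[OF T.manifold c'.c_comp c_comp u(2,1)]
  have zc: "z \<in> fst c" "z \<in> fst c'" using u z by (simp_all add: in_dom c'.in_dom)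
  have "local_map c' c id (snd c' u + sF t (0, snd (snd c' z))) - local_map c' c id (snd c' u) = sF t (0, fib z)" for t
  proof -
    \<comment> \<open>This vector has the argument of the transition map as its coordinates in \<open>c'\<close>.\<close>
    let ?w = "fadd F u (fsmult F t z)"
    have w: "?w \<in> fst c" "?w \<in> fst c'" "proj F ?w = proj F u" using u z by (simp_all add: in_dom c'.in_dom proj_add)
    have t: "fsmult F t z \<in> fst c" "fsmult F t z \<in> fst c'" using zc by (simp_all add: in_dom c'.in_dom)
    have "snd c' u + sF t (0, snd (snd c' z)) = snd c' ?w"
      using u z zc t w by (simp add: prod_eq_iff c'.base_coord prod_scale_def c'.coord_add c'.coord_smult)
    moreover have "snd c ?w - snd c u = sF t (0, fib z)"
      using u z zc t w by (simp add: prod_eq_iff base_coord prod_scale_def coord_add coord_smult)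
    ultimately show ?thesis by (simp add: local_map_at[OF c'.c_inj] u w)
  qed
  then show ?thesis
    unfolding local_diff_def
    using differential_along_line[OF modules(6,3), of "local_map c' c id" "snd c' u"] smooth_nearD(4)[OF near] by simp
qed

subsection \<open>Horizontal vectors\<close>

abbreviation "T0 \<equiv> tangent_map B T (fzero F)"

lemma T0_in_chart:
  assumes sm: "smooth_map B T (fzero F)" and x: "x \<in> fst d"
  shows "chart_vec T c (fzero F x) (snd (T0 (x, v))) = (chart_vec B d x v, 0)"
  using tangent_map_in_charts[OF B.manifold T.manifold sm d c_comp x coords_zero(1)[OF x], of v]
  by (simp add: smooth_near_zero(2)[OF x])

text \<open>
  The zero vector at \<open>u\<close> has coordinates \<open>(u, 0, 0)\<close>, and the image of \<open>v\<close> under the zero section has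
  coordinates \<open>(0, v, 0)\<close>.  Both are fixed by the transport map of the connection, so that their sum is mapped
  to \<open>(u, v, 0)\<close>.
\<close>

lemma horizontal_in_chart:
  assumes sm: "smooth_map B T (fzero F)" and u: "u \<in> fst c"
  shows "fst (cadd L (u, 0) (T0 (proj F u, v))) = u"
    and "chart_vec T c u (snd (cadd L (u, 0) (T0 (proj F u, v)))) =
      (chart_vec B d (proj F u) v, - b (snd d (proj F u)) (chart_vec B d (proj F u) v) (fib u))"
proof -
  interpret V: calculus_module sV by (rule modules)
  let ?x = "proj F u"
  have x: "?x \<in> fst d" using u by (simp add: in_dom)
  have b0: "b (snd d ?x) 0 w = 0" "b (snd d ?x) v 0 = 0" for v w
    using module_hom.zero[OF b_linear(1), of "snd d ?x" w] module_hom.zero[OF b_linear(2), of "snd d ?x" v] x by auto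
  obtain \<tau> where T0: "T0 (?x, v) = (fzero F ?x, \<tau>)" by (auto simp: tangent_map_def)
  define \<zeta> where "\<zeta> = cadd L (u, 0) (T0 (?x, v))"
  have p: "proj F (fst \<zeta>) = ?x"
    using connection_proj[of "(u, 0)" "T0 (?x, v)"] by (simp add: \<zeta>_def T0)
  then have zc: "fst \<zeta> \<in> fst c" using x by (simp add: in_dom)
  have z0: "chart_vec T c u 0 = (0, 0)"
    using chart_vec_linear(4)[OF T.manifold c_comp u] by (simp add: zero_prod_def)
  have "(case tangent_coords F c \<zeta> of (u', v', z) \<Rightarrow> (u', v', z + b (fst (snd c (fst \<zeta>))) v' u')) =
      (case tangent_coords F c (u, 0) of (u', v', z) \<Rightarrow> (u', v', z + b (fst (snd c u)) v' u')) +
      (case tangent_coords F c (T0 (?x, v)) of (u', v', z) \<Rightarrow> (u', v', z + b (fst (snd c (fst (T0 (?x, v))))) v' u'))"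
    using connection_add[of "(u, 0)" "T0 (?x, v)"] u unfolding \<zeta>_def T0 fst_conv by simp
  also have "\<dots> = (fib u, chart_vec B d ?x v, 0)"
    unfolding T0 tangent_coords_def
    using T0_in_chart[OF sm x, of v] unfolding T0
    by (simp add: z0 coords_zero x base_coord u b0)
  finally have *: "fib (fst \<zeta>) = fib u"
    "chart_vec T c (fst \<zeta>) (snd \<zeta>) = (chart_vec B d ?x v, - b (snd d ?x) (chart_vec B d ?x v) (fib u))"
    by (auto simp: tangent_coords_def case_prod_unfold base_coord zc p prod_eq_iff eq_neg_iff_add_eq_0)
  show **: "fst (cadd L (u, 0) (T0 (?x, v))) = u"
    using fibre_eqI[OF zc p *(1)] by (simp add: \<zeta>_def)
  show "chart_vec T c u (snd (cadd L (u, 0) (T0 (?x, v)))) =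
      (chart_vec B d ?x v, - b (snd d ?x) (chart_vec B d ?x v) (fib u))"
    using *(2) ** by (simp add: \<zeta>_def)
qed

end

context calculus_symmetric_bundle
begin

lemma bundle_chart_exists:
  assumes c: "c \<in> batlas F"
  obtains d b where "symmetric_bundle_chart F \<mu> \<mu>M L h c d b"
proof -
  have "bundle_chart F c" using bundle_facts(1) c by (simp add: vector_bundle_def)
  then obtain U \<phi> where d: "compatible_chart B (U, \<phi>)" and dom: "fst c = proj F -` U"
    and img: "snd c ` fst c = \<phi> ` U \<times> UNIV"
    and co: "\<forall>u\<in>fst c. fst (snd c u) = \<phi> (proj F u)"
      "\<forall>x\<in>U. snd (snd c (fzero F x)) = 0"
      "\<forall>u\<in>fst c. \<forall>u'\<in>fst c. proj F u = proj F u' \<longrightarrow>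
        snd (snd c (fadd F u u')) = snd (snd c u) + snd (snd c u')"
      "\<forall>t. \<forall>u\<in>fst c. snd (snd c (fsmult F t u)) = sV t (snd (snd c u))"
    unfolding bundle_chart_def by blast
  have D: "fst ` snd c ` fst c = \<phi> ` U" unfolding img by simp
  obtain b where b:
    "\<forall>x\<in>\<phi> ` U. (\<forall>u. module_hom sE sV (\<lambda>v. b x v u)) \<and> (\<forall>v. module_hom sV sV (b x v))"
    "locally_smooth (prod_scale sE (prod_scale sE sV)) sV (\<phi> ` U \<times> UNIV) (\<lambda>(x, v, u). b x v u)"
    "\<forall>\<xi> \<eta>. fst \<xi> \<in> fst c \<and> proj F (fst \<xi>) = proj F (fst \<eta>) \<longrightarrow>
      (case tangent_coords F c (cadd L \<xi> \<eta>) of (u, v, z) \<Rightarrow> (u, v, z + b (fst (snd c (fst (cadd L \<xi> \<eta>)))) v u)) =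
      (case tangent_coords F c \<xi> of (u, v, z) \<Rightarrow> (u, v, z + b (fst (snd c (fst \<xi>))) v u)) +
      (case tangent_coords F c \<eta> of (u, v, z) \<Rightarrow> (u, v, z + b (fst (snd c (fst \<eta>))) v u))"
    using bspec[OF conjunct2[OF conjunct2[OF connection[unfolded linear_connection_def Let_def]]] c, unfolded D]
    by (elim exE conjE) (rule that; assumption)
  have "symmetric_bundle_chart F \<mu> \<mu>M L h c (U, \<phi>) b"
  proof (rule symmetric_bundle_chart.intro[OF calculus_symmetric_bundle_axioms],
      rule symmetric_bundle_chart_axioms.intro, goal_cases)
    case (9 y z)
    then show ?case using b(1) by simp blast
  next
    case (10 y v)
    then show ?case using b(1) by simp blast
  next
    case (12 \<xi> \<eta>)
    then show ?case using b(3) by blast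
  qed (use c d dom img co b(1,2) in \<open>simp_all\<close>)
  then show ?thesis by (rule that)
qed

lemma smooth_zero: "smooth_map B T (fzero F)"
proof (subst smooth_map_iff[OF B.inj], assumption, intro ballI allI impI)
  fix c' c x assume c': "c' \<in> atlas B" and "c \<in> atlas T" and x: "x \<in> fst c'" "fzero F x \<in> fst c"
  then have "c \<in> batlas F" by simp
  then obtain d b where "symmetric_bundle_chart F \<mu> \<mu>M L h c d b"
    by (rule bundle_chart_exists)
  then interpret symmetric_bundle_chart F \<mu> \<mu>M L h c d b .
  have xd: "x \<in> fst d" using x(2) by (simp add: in_dom)
  note c'' = atlas_compatible[OF B.smooth c']
  have "smooth_near B T c' c (fzero F \<circ> id) x"
    by (rule smooth_near_compose[OF B.mod(1,1) compatible_inj[OF c''] d_inj chart_transition[OF B.manifold c'' d x(1) xd]])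
      (simp add: smooth_near_zero(1)[OF xd])
  then show "smooth_near B T c' c (fzero F) x" by simp
qed

lemma obtain_chart_at:
  obtains c d b where "symmetric_bundle_chart F \<mu> \<mu>M L h c d b" "u \<in> fst c"
proof -
  have "chart_at T u \<in> batlas F" using T.at(1)[of u] by simp
  then obtain d b where "symmetric_bundle_chart F \<mu> \<mu>M L h (chart_at T u) d b"
    by (rule bundle_chart_exists)
  then show ?thesis using T.at(2) by (rule that)
qed

lemma fsmult_0: "fsmult F 0 u = fzero F (proj F u)"
proof -
  obtain c d b where "symmetric_bundle_chart F \<mu> \<mu>M L h c d b" and u: "u \<in> fst c" by (rule obtain_chart_at)
  then interpret symmetric_bundle_chart F \<mu> \<mu>M L h c d b by simp
  show ?thesis using u by (rule smult_zero)
qed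

text \<open>
  Zero vectors are 0-fold multiples, and the product of \<open>F\<close> is compatible with multiplication by scalars.
\<close>

lemma mult_zero: "\<mu> (fzero F x) (fzero F y) = fzero F (\<mu>M x y)"
  using mult_smult[of 0 "fzero F x" "fzero F y"] by (simp add: fsmult_0 bundle_facts(5))

end

context symmetric_bundle_chart
begin

definition hor :: "'b \<Rightarrow> 'e \<Rightarrow> 'e \<times> 'v"
  where "hor u v = snd (cadd L (u, 0) (T0 (proj F u, v)))"

lemma hor_eq: "u \<in> fst c \<Longrightarrow> cadd L (u, 0) (T0 (proj F u, v)) = (u, hor u v)"
  using horizontal_in_chart(1)[OF smooth_zero, of u v] by (simp add: hor_def prod_eq_iff)

lemma hor_in_chart:
  "u \<in> fst c \<Longrightarrow> chart_vec T c u (hor u v) =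
    (chart_vec B d (proj F u) v, - b (snd d (proj F u)) (chart_vec B d (proj F u) v) (fib u))"
  unfolding hor_def by (rule horizontal_in_chart(2)[OF smooth_zero])

text \<open>
  A horizontal vector is a sum in a fibre of \<open>TF \<rightarrow> M\<close>, and symmetries at zero vectors preserve such sums, zero
  tangent vectors and the image of the zero section.
\<close>

lemma symmetry_hor:
  assumes w: "w \<in> fst c" "\<mu> (fzero F p) w \<in> fst c"
  shows "tangent_map T T (\<mu> (fzero F p)) (w, hor w v) =
    (\<mu> (fzero F p) w, hor (\<mu> (fzero F p) w) (snd (tangent_map B B (\<mu>M p) (proj F w, v))))"
proof -
  let ?f = "\<mu> (fzero F p)"
  have f: "smooth_map T T ?f" by (rule T.smooth_map_symmetry)
  have add: "tangent_map T T ?f (cadd L \<xi> \<eta>) = cadd L (tangent_map T T ?f \<xi>) (tangent_map T T ?f \<eta>)"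
    if "proj F (fst \<xi>) = proj F (fst \<eta>)" for \<xi> \<eta>
    using invariance[of p] that unfolding invariant_connection_def Let_def by blast
  have "?f \<circ> fzero F = fzero F \<circ> \<mu>M p" by (simp add: fun_eq_iff mult_zero)
  then have T0: "tangent_map T T ?f (T0 (proj F w, v)) = T0 (tangent_map B B (\<mu>M p) (proj F w, v))"
    by (simp add: tangent_map_compose[OF B.manifold T.manifold T.manifold smooth_zero f]
        tangent_map_compose[OF B.manifold B.manifold T.manifold B.smooth_map_symmetry smooth_zero])
  have "tangent_map T T ?f (w, hor w v) = tangent_map T T ?f (cadd L (w, 0) (T0 (proj F w, v)))"
    by (simp only: hor_eq[OF w(1)])
  also have "\<dots> = cadd L (tangent_map T T ?f (w, 0)) (tangent_map T T ?f (T0 (proj F w, v)))"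
    by (rule add) (simp add: tangent_map_def)
  also have "tangent_map T T ?f (w, 0) = (?f w, 0)"
    by (rule tangent_map_0[OF T.manifold T.manifold f])
  also note T0
  also have "tangent_map B B (\<mu>M p) (proj F w, v) =
      (proj F (?f w), snd (tangent_map B B (\<mu>M p) (proj F w, v)))"
    by (simp add: tangent_map_def bundle_facts(5))
  finally show ?thesis
    by (simp only: hor_eq[OF w(2)])
qed

lemma local_connection_at:
  assumes a: "a \<in> fst d"
  shows "local_connection sE sV (snd d a) b"
proof (rule local_connection.intro)
  show "smooth_at (prod_scale sE (prod_scale sE sV)) sV (\<lambda>(x, v, u). b x v u) (snd d a, v, u)" for v u
    using b_smooth a unfolding locally_smooth_iff by blast
  have "\<forall>\<^sub>F x in nhds (snd d a). x \<in> snd d ` fst d" using a by (intro eventually_nhds_in_open d_open) auto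
  then show "\<forall>\<^sub>F x in nhds (snd d a). (\<forall>u. module_hom sE sV (\<lambda>v. b x v u)) \<and> (\<forall>v. module_hom sV sV (b x v))"
    by eventually_elim (simp add: b_linear)
qed (rule modules)+

abbreviation "sT \<equiv> prod_scale sE (prod_scale sE sV)"

subsection \<open>The product in a bundle chart\<close>

text \<open>The zero vector over \<open>x\<close> and the vector with coordinates \<open>(q, u)\<close>, as arguments of the product in the chart.\<close>

definition embed :: "'e \<times> 'e \<times> 'v \<Rightarrow> ('e \<times> 'v) \<times> ('e \<times> 'v)"
  where "embed = (\<lambda>(x, y). ((x, 0), y))"

definition g :: "'e \<times> 'e \<times> 'v \<Rightarrow> 'e \<times> 'v"
  where "g P = local_map (prod_chart c c) c T.mult (embed P)"

lemma embed_linear: "continuous_linear sT (prod_scale sF sF) embed"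
proof -
  interpret V: calculus_module sV by (rule modules)
  show ?thesis
    by (auto simp: continuous_linear_def prod_scale_def embed_def case_prod_unfold intro!: continuous_intros)
qed

lemma product_module: "calculus_module sT" "cont_module sT" "calculus_module (prod_scale sF sF)"
  "cont_module (prod_scale sF sF)"
  by (intro calculus_module_cont_module calculus_module_prod modules)+

lemma embed_at: "p \<in> fst d \<Longrightarrow> w \<in> fst c \<Longrightarrow>
    embed (snd d p, snd d (proj F w), fib w) = snd (prod_chart c c) (fzero F p, w)"
  by (simp add: embed_def prod_eq_iff coords_zero base_coord)

lemma g_at: "p \<in> fst d \<Longrightarrow> w \<in> fst c \<Longrightarrow> g (snd d p, snd d (proj F w), fib w) = snd c (\<mu> (fzero F p) w)"
  unfolding g_def embed_at
  by (simp add: local_map_at[OF prod_chart_inj[OF c_inj c_inj]] coords_zero del: prod_chart_simps(2))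

text \<open>
  The domain of the product of \<open>F\<close> in the chart is open, and over the zero section it is described by the
  product of the base.
\<close>

lemma near_points:
  assumes a: "a \<in> fst d"
  shows "\<forall>\<^sub>F P in nhds (snd d a, snd d a). \<exists>p r. p \<in> fst d \<and> r \<in> fst d \<and> \<mu>M p r \<in> fst d \<and>
    P = (snd d p, snd d r)"
proof -
  have "smooth_near (prod_mfd T T) T (prod_chart c c) c T.mult (fzero F a, fzero F a)"
    by (rule T.smooth_near_mult) (simp_all add: c coords_zero a mult_zero B.idem)
  from smooth_nearD(3)[OF this]
  have "\<forall>\<^sub>F Q in nhds ((snd d a, 0), (snd d a, 0)). Q \<in> local_dom (prod_chart c c) c T.mult"
    by (simp add: coords_zero a)
  moreover have "filterlim (\<lambda>P. ((fst P, 0), (snd P, 0))) (nhds ((snd d a, 0), (snd d a, 0))) (nhds (snd d a, snd d a))"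
    by (intro tendsto_Pair tendsto_const tendsto_eq_intros(1)) (auto intro!: tendsto_eq_intros filterlim_ident)
  ultimately have "\<forall>\<^sub>F P in nhds (snd d a, snd d a). ((fst P, 0), (snd P, 0)) \<in> local_dom (prod_chart c c) c T.mult"
    by (rule eventually_compose_filterlim)
  then show ?thesis
  proof eventually_elim
    case (elim P)
    then obtain U where U: "U \<in> fst (prod_chart c c)" "T.mult U \<in> fst c"
      "((fst P, 0), (snd P, 0)) = snd (prod_chart c c) U" by (rule local_domE)
    obtain u w where uw: "U = (u, w)" by (cases U)
    show ?case
      by (rule exI[of _ "proj F u"], rule exI[of _ "proj F w"])
        (use U uw base_coord[of u] base_coord[of w] in \<open>auto simp: in_dom bundle_facts(5) prod_eq_iff\<close>)
  qed
qed

lemma smooth_g_at: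
  assumes p: "p \<in> fst d" "w \<in> fst c" "\<mu>M p (proj F w) \<in> fst d"
  shows "smooth_at (prod_scale sF sF) sF (local_map (prod_chart c c) c T.mult) (embed (snd d p, snd d (proj F w), fib w))"
    and "smooth_at sT sF g (snd d p, snd d (proj F w), fib w)"
    and "differential sT sF g (snd d p, snd d (proj F w), fib w) X =
      differential (prod_scale sF sF) sF (local_map (prod_chart c c) c T.mult)
        (embed (snd d p, snd d (proj F w), fib w)) (embed X)"
    and "differential sT sF g (snd d p, snd d (proj F w), fib w) (0, Y) = local_diff T T c c (\<mu> (fzero F p)) w Y"
proof -
  let ?P = "(snd d p, snd d (proj F w), fib w)" and ?G = "local_map (prod_chart c c) c T.mult"
  have mult: "smooth_near (prod_mfd T T) T (prod_chart c c) c T.mult (fzero F p, w)"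
    by (rule T.smooth_near_mult) (use p in \<open>simp_all add: c coords_zero in_dom bundle_facts(5)\<close>)
  show G: "smooth_at (prod_scale sF sF) sF ?G (embed ?P)"
    using smooth_nearD(4)[OF mult] unfolding embed_at[OF p(1,2)] by simp
  have g: "g = (\<lambda>P. ?G (embed P))" by (simp add: g_def fun_eq_iff)
  note emb = smooth_at_linear[OF embed_linear]
  show "smooth_at sT sF g ?P"
    unfolding g by (rule smooth_at_compose[OF product_module(2,4) G emb])
  show *: "differential sT sF g ?P X = differential (prod_scale sF sF) sF ?G (embed ?P) (embed X)" for X
    unfolding g
    by (simp add: differential_compose[OF product_module(2,3) modules(3) G emb]
        differential_linear[OF product_module(2,3) embed_linear])
  have "local_diff T T c c (\<mu> (fzero F p)) w Y = T.mult_diff c c c (fzero F p) w (0, Y)"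
    by (rule T.smooth_near_symmetry(2)) (use p in \<open>simp_all add: c in_dom bundle_facts(5)\<close>)
  then show "differential sT sF g ?P (0, Y) = local_diff T T c c (\<mu> (fzero F p)) w Y"
    unfolding * embed_at[OF p(1,2)] local_diff_def by (simp add: embed_def zero_prod_def)
qed

lemma g_base:
  assumes p: "p \<in> fst d" "w \<in> fst c" "\<mu>M p (proj F w) \<in> fst d"
  shows "g (snd d p, snd d (proj F w), fib w) = (snd d (\<mu>M p (proj F w)), fib (\<mu> (fzero F p) w))"
  using assms by (simp add: g_at prod_eq_iff base_coord in_dom bundle_facts(5))

lemma g_linear:
  assumes p: "p \<in> fst d" "r \<in> fst d" "\<mu>M p r \<in> fst d"
  shows "fst (g (snd d p, snd d r, u)) = snd d (\<mu>M p r)"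
    and "snd (g (snd d p, snd d r, u + u')) = snd (g (snd d p, snd d r, u)) + snd (g (snd d p, snd d r, u'))"
    and "snd (g (snd d p, snd d r, sV t u)) = sV t (snd (g (snd d p, snd d r, u)))"
proof -
  obtain w where w: "w \<in> fst c" "proj F w = r" "fib w = u" using fibre_point[OF p(2)] by blast
  obtain w' where w': "w' \<in> fst c" "proj F w' = r" "fib w' = u'" using fibre_point[OF p(2)] by blast
  have add: "fadd F w w' \<in> fst c" "proj F (fadd F w w') = r" "fib (fadd F w w') = u + u'"
    using w w' by (simp_all add: in_dom proj_add coord_add)
  have sm: "fsmult F t w \<in> fst c" "proj F (fsmult F t w) = r" "fib (fsmult F t w) = sV t u"
    using w by (simp_all add: in_dom coord_smult)
  have in_c: "\<mu> (fzero F p) v \<in> fst c" if "proj F v = r" for v using that p by (simp add: in_dom bundle_facts(5))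
  have "\<mu> (fzero F p) (fadd F w w') = fadd F (\<mu> (fzero F p) w) (\<mu> (fzero F p) w')"
    using mult_add[of "fzero F p" "fzero F p" w w'] w w' by (simp add: zero_add p)
  moreover have "\<mu> (fzero F p) (fsmult F t w) = fsmult F t (\<mu> (fzero F p) w)"
    using mult_smult[of t "fzero F p" w] by (simp add: zero_smult p)
  ultimately show "fst (g (snd d p, snd d r, u)) = snd d (\<mu>M p r)"
    "snd (g (snd d p, snd d r, u + u')) = snd (g (snd d p, snd d r, u)) + snd (g (snd d p, snd d r, u'))"
    "snd (g (snd d p, snd d r, sV t u)) = sV t (snd (g (snd d p, snd d r, u)))"
    using g_at[OF p(1) w(1)] g_at[OF p(1) w'(1)] g_at[OF p(1) add(1)] g_at[OF p(1) sm(1)]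
      w w' add sm in_c p by (simp_all add: base_coord coord_add coord_smult bundle_facts(5))
qed

text \<open>
  At the zero vector over \<open>p\<close>, its own symmetry has differential minus the identity.  Being linear on the
  fibre over \<open>p\<close>, this symmetry agrees with its differential there, so it is minus the identity on the fibre.
\<close>

lemma g_diag:
  assumes p: "p \<in> fst d"
  shows "differential sT sF g (snd d p, snd d p, 0) (0, Y) = - Y" and "g (snd d p, snd d p, u) = (snd d p, - u)"
proof -
  let ?z = "fzero F p"
  interpret V: calculus_module sV by (rule modules)
  interpret E: calculus_module sE by (rule modules)
  have z: "?z \<in> fst c" "\<mu>M p p \<in> fst d" using p by (simp_all add: coords_zero B.idem)
  have zz: "\<mu> ?z ?z = ?z" by (rule T.idem)
  show *: "differential sT sF g (snd d p, snd d p, 0) (0, Y) = - Y" for Y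
  proof -
    obtain \<xi> where \<xi>: "chart_vec T c ?z \<xi> = Y" using chart_vec_surj[OF T.manifold c_comp z(1)] by blast
    have "local_diff T T c c (\<mu> ?z) ?z Y = chart_vec T c ?z (snd (tangent_map T T (\<mu> ?z) (?z, \<xi>)))"
      using tangent_map_in_charts[OF T.manifold T.manifold T.smooth_map_symmetry c_comp c_comp z(1), of ?z \<xi>]
      by (simp add: zz z \<xi>)
    also have "\<dots> = - Y"
      using T.tangent_symmetry[of ?z \<xi>] chart_vec_linear(3)[OF T.manifold c_comp z(1), of \<xi>] \<xi> by simp
    finally show ?thesis using smooth_g_at(4)[OF p z(1), of Y] z by (simp add: coords_zero p)
  qed
  have z0: "g (snd d p, snd d p, 0) = (snd d p, 0)"
    using g_at[OF p z(1)] by (simp add: coords_zero p zz)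
  \<comment> \<open>On the line through the zero vector in the direction \<open>u\<close> of the fibre, \<open>g\<close> is linear.\<close>
  have "differential sT sF g (snd d p, snd d p, 0) (0, 0, u) = (0, snd (g (snd d p, snd d p, u)))"
  proof (rule differential_along_line[OF product_module(2) modules(3)])
    show "smooth_at sT sF g (snd d p, snd d p, 0)"
      using smooth_g_at(2)[OF p z(1)] z by (simp add: coords_zero p)
    show "g ((snd d p, snd d p, 0) + sT t (0, 0, u)) - g (snd d p, snd d p, 0) = sF t (0, snd (g (snd d p, snd d p, u)))" for t
      using g_linear(1,3)[OF p p z(2)] by (simp add: prod_scale_def prod_eq_iff z0 B.idem)
  qed
  then show "g (snd d p, snd d p, u) = (snd d p, - u)"
    using *[of "(0, u)"] g_linear(1)[OF p p z(2), of u] by (simp add: prod_eq_iff B.idem)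
qed

lemma g_invariant:
  assumes p: "p \<in> fst d" "r \<in> fst d" "\<mu>M p r \<in> fst d"
  shows "snd (differential sT sF g (snd d p, snd d r, u) (0, w, - b (snd d r) w u)) =
    - b (fst (g (snd d p, snd d r, u)))
      (fst (differential sT sF g (snd d p, snd d r, u) (0, w, - b (snd d r) w u))) (snd (g (snd d p, snd d r, u)))"
proof -
  obtain z where z: "z \<in> fst c" "proj F z = r" "fib z = u" using fibre_point[OF p(2)] by blast
  obtain v where v: "chart_vec B d r v = w" using chart_vec_surj[OF B.manifold d p(2)] by blast
  have fz: "\<mu> (fzero F p) z \<in> fst c" using z p by (simp add: in_dom bundle_facts(5))
  let ?v' = "snd (tangent_map B B (\<mu>M p) (proj F z, v))"
  have "differential sT sF g (snd d p, snd d r, u) (0, w, - b (snd d r) w u) =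
      local_diff T T c c (\<mu> (fzero F p)) z (chart_vec T c z (hor z v))"
    using smooth_g_at(4)[OF p(1) z(1), of "(w, - b (snd d r) w u)"] p z by (simp add: hor_in_chart v)
  also have "\<dots> = chart_vec T c (\<mu> (fzero F p) z) (hor (\<mu> (fzero F p) z) ?v')"
    using tangent_map_in_charts[OF T.manifold T.manifold T.smooth_map_symmetry c_comp c_comp z(1) fz, of "hor z v"]
    by (simp add: symmetry_hor[OF z(1) fz])
  also have "\<dots> = (chart_vec B d (\<mu>M p r) ?v', - b (snd d (\<mu>M p r)) (chart_vec B d (\<mu>M p r) ?v') (fib (\<mu> (fzero F p) z)))"
    by (simp add: hor_in_chart fz bundle_facts(5) z(2))
  finally show ?thesis using g_base[OF p(1) z(1)] z p by simp
qed

lemma local_symmetric_bundle_at: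
  assumes a: "a \<in> fst d"
  shows "local_symmetric_bundle sE sV (snd d a) b g h"
proof -
  note near = near_points[OF a]
  have diag: "\<forall>\<^sub>F x in nhds (snd d a). x \<in> snd d ` fst d" using a by (intro eventually_nhds_in_open d_open) auto
  show ?thesis
  proof (rule local_symmetric_bundle.intro[OF local_connection_at[OF a]], rule local_symmetric_bundle_axioms.intro)
    show "h * 2 = 1" by (rule half)
    show "\<forall>\<^sub>F p in nhds (snd d a, snd d a). \<forall>u. smooth_at sT sF g (fst p, snd p, u)"
      using near
    proof eventually_elim
      case (elim P)
      then obtain p r where p: "p \<in> fst d" "r \<in> fst d" "\<mu>M p r \<in> fst d" "P = (snd d p, snd d r)" by blast
      show ?case
      proof
        fix u
        obtain w where "w \<in> fst c" "proj F w = r" "fib w = u" using fibre_point[OF p(2)] by blast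
        with smooth_g_at(2)[OF p(1), of w] p show "smooth_at sT sF g (fst P, snd P, u)" by simp
      qed
    qed
    show "\<forall>\<^sub>F p in nhds (snd d a, snd d a). \<forall>u. fst (g (fst p, snd p, u)) = fst (g (fst p, snd p, 0))"
      using near by eventually_elim (auto simp: g_linear(1))
    show "\<forall>\<^sub>F p in nhds (snd d a, snd d a). \<forall>u u' t.
      snd (g (fst p, snd p, u + u')) = snd (g (fst p, snd p, u)) + snd (g (fst p, snd p, u')) \<and>
      snd (g (fst p, snd p, sV t u)) = sV t (snd (g (fst p, snd p, u)))"
      using near by eventually_elim (auto simp: g_linear(2,3))
    show "\<forall>\<^sub>F p in nhds (snd d a, snd d a). \<forall>u w.
      snd (differential sT sF g (fst p, snd p, u) (0, w, - b (snd p) w u)) =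
      - b (fst (g (fst p, snd p, u)))
        (fst (differential sT sF g (fst p, snd p, u) (0, w, - b (snd p) w u))) (snd (g (fst p, snd p, u)))"
      using near by eventually_elim (auto simp: g_invariant)
    show "\<forall>\<^sub>F x in nhds (snd d a). \<forall>u. g (x, x, u) = (x, - u)"
      using diag by eventually_elim (auto simp: g_diag)
    show "\<forall>\<^sub>F x in nhds (snd d a). \<forall>w. fst (differential sT sF g (x, x, 0) (0, w, 0)) = - w"
      using diag by eventually_elim (auto simp: g_diag)
  qed
qed

end

context symmetric_bundle_chart
begin

section \<open>Comparison of curvature and triple product\<close>

lemma chart_vec_vertical:
  assumes u: "u \<in> fst c" and z: "proj F z = proj F u"
  shows "chart_vec T c u (vertical F u z) = (0, fib z)"
proof -
  have "chart_at T u \<in> batlas F" using T.at(1)[of u] by simp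
  then obtain d' b' where "symmetric_bundle_chart F \<mu> \<mu>M L h (chart_at T u) d' b'"
    by (rule bundle_chart_exists)
  from chart_vec_vertical_of[OF this u T.at(2) z] show ?thesis
    by (simp add: chart_vec_def vertical_def)
qed

lemma fibre_part_eqI:
  assumes u: "u \<in> fst c" and z: "proj F z = proj F u" and \<xi>: "chart_vec T c u \<xi> = (0, fib z)"
  shows "fibre_part F u \<xi> = z"
  unfolding fibre_part_def
proof (rule the_equality)
  show "proj F z = proj F u \<and> vertical F u z = \<xi>"
    using chart_vec_inj[OF T.manifold c_comp u, of "vertical F u z" \<xi>] \<xi> by (simp add: chart_vec_vertical u z)
  show "z' = z" if "proj F z' = proj F u \<and> vertical F u z' = \<xi>" for z'
  proof (rule fibre_eqI)
    show "z' \<in> fst c" "proj F z' = proj F z" using that u z by (simp_all add: in_dom)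
    show "fib z' = fib z" using chart_vec_vertical[OF u, of z'] that \<xi> by simp
  qed
qed

abbreviation "curv a v w \<equiv> chart_curvature sE sV b (snd d a) (chart_vec B d a v) (chart_vec B d a w)"

abbreviation "base_field a v \<equiv> T.ext_field (fzero F a) (sF h (snd (T0 (a, v))))"

text \<open>
  Near the fibre over \<open>a\<close>, the derivations of \<open>F\<close> are those of the local computation.
\<close>

lemma base_field_in_chart:
  assumes a: "a \<in> fst d" and z: "proj F z = a"
  shows "\<forall>\<^sub>F y in nhds (snd c z). local_symmetric_bundle.deriv sE sV (snd d a) g h (chart_vec B d a v) y =
    field_in_chart T c (base_field a v) y"
proof -
  interpret ls: local_symmetric_bundle sE sV "snd d a" b g h by (rule local_symmetric_bundle_at[OF a])
  interpret V: calculus_module sV by (rule modules)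
  let ?o = "fzero F a" and ?v = "chart_vec B d a v"
  have zc: "z \<in> fst c" using a z by (simp add: in_dom)
  have o: "?o \<in> fst c" by (rule coords_zero(1)[OF a])
  have vec: "chart_vec T c ?o (sF h (snd (T0 (a, v)))) = (sE h ?v, 0)"
    using chart_vec_linear(2)[OF T.manifold c_comp o, of h "snd (T0 (a, v))"]
    by (simp add: T0_in_chart[OF smooth_zero a] prod_scale_def)
  have "\<forall>\<^sub>F y in nhds (snd c z). y \<in> snd c ` fst c" using zc by (intro eventually_nhds_in_open c_open) auto
  moreover have "filterlim (\<lambda>y. (snd d a, fst y)) (nhds (snd d a, snd d a)) (nhds (snd c z))"
    using base_coord[OF zc] z
    by (intro tendsto_Pair tendsto_const) (auto intro!: tendsto_eq_intros filterlim_ident)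
  note eventually_compose_filterlim[OF near_points[OF a] this]
  ultimately show ?thesis
  proof eventually_elim
    case (elim y)
    from elim(1) obtain u where u: "u \<in> fst c" "y = snd c u" by blast
    from elim(2) obtain p r where p: "p \<in> fst d" "r \<in> fst d" "\<mu>M p r \<in> fst d" "snd d a = snd d p" "fst y = snd d r"
      by auto
    have "p = a" using inj_onD[OF d_inj, of p a] p a by simp
    moreover have "r = proj F u"
      using inj_onD[OF d_inj, of r "proj F u"] p u base_coord[OF u(1)] by (simp add: in_dom)
    ultimately have r: "\<mu>M a (proj F u) \<in> fst d" using p(3) by simp
    let ?u = "\<mu> ?o u"
    have u': "?u \<in> fst c" "proj F ?u = \<mu>M a (proj F u)" using r by (simp_all add: in_dom bundle_facts(5))
    have inv: "\<mu>M a (proj F ?u) \<in> fst d" using u(1) by (simp add: u'(2) B.invol in_dom)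
    have gy: "g (snd d a, y) = (snd d (proj F ?u), fib ?u)"
    proof -
      have "g (snd d a, y) = snd c ?u" using g_at[OF a u(1)] by (simp add: u(2) flip: base_coord[OF u(1)])
      then show ?thesis by (simp add: prod_eq_iff base_coord[OF u'(1)])
    qed
    have "ls.deriv ?v y = differential (prod_scale sF sF) sF (local_map (prod_chart c c) c T.mult)
        (embed (snd d a, snd d (proj F ?u), fib ?u)) (embed (sE h ?v, 0, 0))"
      unfolding ls.deriv_def gy by (rule smooth_g_at(3)[OF a u'(1) inv])
    also have "embed (snd d a, snd d (proj F ?u), fib ?u) = (snd c ?o, snd c ?u)"
      by (simp add: embed_at[OF a u'(1)])
    also have "embed (sE h ?v, 0, 0) = ((sE h ?v, 0), 0)" by (simp add: embed_def zero_prod_def)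
    also have "differential (prod_scale sF sF) sF (local_map (prod_chart c c) c T.mult) (snd c ?o, snd c ?u)
        ((sE h ?v, 0), 0) = field_in_chart T c (base_field a v) (snd c u)"
      using T.ext_field_in_chart[of c c c ?o u "sF h (snd (T0 (a, v)))"] c o u(1) u'(1)
      by (simp add: vec)
    finally show ?case by (simp only: u(2))
  qed
qed

lemma bracket_base_fields:
  assumes a: "a \<in> fst d" and z: "proj F z = a"
  shows "chart_vec T c z (lie_bracket T (base_field a v) (base_field a w) z) = (0, curv a v w (fib z))"
proof -
  interpret ls: local_symmetric_bundle sE sV "snd d a" b g h by (rule local_symmetric_bundle_at[OF a])
  have "z \<in> fst c" using a z by (simp add: in_dom)
  then obtain y where zc: "z \<in> fst c" "snd c z = (snd d a, y)"
    using base_coord[of z] z by (cases "snd c z") auto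
  note near = base_field_in_chart[OF a z, unfolded zc(2)]
  have "chart_vec T c z (lie_bracket T (base_field a v) (base_field a w) z) =
      bracket sF (field_in_chart T c (base_field a v)) (field_in_chart T c (base_field a w)) (snd d a, y)"
    using lie_bracket_in_chart[OF T.manifold T.vector_field_ext_field T.vector_field_ext_field c_comp zc(1)]
    by (simp add: zc(2))
  also have "\<dots> = bracket sF (ls.deriv (chart_vec B d a v)) (ls.deriv (chart_vec B d a w)) (snd d a, y)"
    by (rule bracket_cong[OF modules(3) ls.deriv_smooth(1) near ls.deriv_smooth(1) near])
  also have "\<dots> = (0, curv a v w (y))" by (rule ls.bracket_deriv)
  finally show ?thesis by (simp add: zc(2))
qed

text \<open>
  Let \<open>A\<close> and \<open>C\<close> be the two fields \<open>[V,W]\<close> and \<open>Z\<close> in the chart.  In \<open>[[V,W],Z] = dA C - dC A\<close> the second term is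
  zero at the zero vector, because \<open>A\<close> vanishes there.  In the first one, \<open>A\<close> is linear along the fibre, in
  the direction of which \<open>C\<close> points.
\<close>

lemma lts_in_chart:
  assumes a: "a \<in> fst d" and z: "proj F z = a"
  shows "chart_vec T c (fzero F a) (lts T \<mu> (fzero F a) (snd (T0 (a, v))) (snd (T0 (a, w)))
    (vertical F (fzero F a) z)) = (0, curv a v w (fib z))"
proof -
  interpret lc: local_connection sE sV "snd d a" b by (rule local_connection_at[OF a])
  interpret V: calculus_module sV by (rule modules)
  interpret E: calculus_module sE by (rule modules)
  let ?o = "fzero F a"
  have o: "?o \<in> fst c" "snd c ?o = (snd d a, 0)" using a by (simp_all add: coords_zero)
  define W where "W = lie_bracket T (base_field a v) (base_field a w)"
  define Z where "Z = T.ext_field ?o (sF h (vertical F ?o z))"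
  have W: "vector_field T W" and Z: "vector_field T Z"
    unfolding W_def Z_def by (intro vector_field_lie_bracket T.manifold T.vector_field_ext_field)+
  let ?A = "field_in_chart T c W" and ?C = "field_in_chart T c Z" and ?x = "(snd d a, 0)"
  have sA: "smooth_at sF sF ?A ?x" and sC: "smooth_at sF sF ?C ?x"
    using vector_field_smooth_at[OF T.manifold W c_comp o(1)] vector_field_smooth_at[OF T.manifold Z c_comp o(1)]
    by (simp_all add: o(2))
  have A: "?A (snd d a, y) = (0, curv a v w y)" for y
  proof -
    obtain u where u: "u \<in> fst c" "proj F u = a" "fib u = y" using fibre_point[OF a] by blast
    have "snd c u = (snd d a, y)" using u by (simp add: prod_eq_iff base_coord)
    then show ?thesis
      using field_in_chart_at[OF c_inj u(1), of T W] bracket_base_fields[OF a u(2), of v w] u(3)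
      by (simp add: W_def)
  qed
  have curv0: "curv a v w 0 = 0"
    using lc.chart_curvature_scale[of "chart_vec B d a v" "chart_vec B d a w" 0 0] by simp
  have "Z ?o = vertical F ?o z"
    using T.ext_field_at[OF half, of ?o "vertical F ?o z"] by (simp add: Z_def)
  then have C: "?C ?x = (0, fib z)"
    using field_in_chart_at[OF c_inj o(1), of T Z] chart_vec_vertical[OF o(1), of z] z by (simp add: o(2))
  have "lts T \<mu> ?o (snd (T0 (a, v))) (snd (T0 (a, w))) (vertical F ?o z) = lie_bracket T W Z ?o"
    using T.lts_ext_field[OF half, of ?o "snd (T0 (a, v))" "snd (T0 (a, w))" "vertical F ?o z"]
    by (simp add: W_def Z_def)
  then have "chart_vec T c ?o (lts T \<mu> ?o (snd (T0 (a, v))) (snd (T0 (a, w))) (vertical F ?o z)) =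
      bracket sF ?A ?C ?x"
    using lie_bracket_in_chart[OF T.manifold W Z c_comp o(1)] by (simp add: o(2))
  also have "\<dots> = differential sF sF ?A ?x (0, fib z)"
    using differential_0_dir[OF modules(6,3) sC] by (simp add: bracket_def A C curv0 zero_prod_def)
  also have "\<dots> = (0, curv a v w (fib z))"
    by (rule differential_along_line[OF modules(6,3) sA])
      (simp add: prod_scale_def A curv0 lc.chart_curvature_scale)
  finally show ?thesis .
qed

lemma horizontal_lift_in_chart:
  assumes u: "u \<in> fst c"
  shows "chart_vec T c u (horizontal_lift F L X u) = local_connection.hlift b (field_in_chart B d X) (snd c u)"
proof -
  interpret lc: local_connection sE sV "snd d (proj F u)" b
    by (rule local_connection_at) (use u in \<open>simp add: in_dom\<close>)
  have "horizontal_lift F L X u = hor u (X (proj F u))" by (simp add: horizontal_lift_def hor_def)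
  moreover have "field_in_chart B d X (snd d (proj F u)) = chart_vec B d (proj F u) (X (proj F u))"
    using u by (intro field_in_chart_at d_inj) (simp add: in_dom)
  ultimately show ?thesis by (simp add: hor_in_chart[OF u] lc.hlift_def case_prod_unfold base_coord[OF u])
qed

lemma horizontal_lift_near:
  assumes u: "u \<in> fst c"
  shows "\<forall>\<^sub>F y in nhds (snd c u). local_connection.hlift b (field_in_chart B d X) y =
    field_in_chart T c (horizontal_lift F L X) y"
proof -
  have "\<forall>\<^sub>F y in nhds (snd c u). y \<in> snd c ` fst c" using u by (intro eventually_nhds_in_open c_open) auto
  then show ?thesis
    by eventually_elim (auto simp: field_in_chart_at c_inj horizontal_lift_in_chart)
qed

lemma hlift_smooth_at:
  assumes X: "vector_field B X" and u: "u \<in> fst c"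
  shows "smooth_at sF sF (local_connection.hlift b (field_in_chart B d X)) (snd c u)"
proof -
  have x: "proj F u \<in> fst d" using u by (simp add: in_dom)
  interpret lc: local_connection sE sV "snd d (proj F u)" b by (rule local_connection_at[OF x])
  have "(snd d (proj F u), fib u) = snd c u" using u by (simp add: prod_eq_iff base_coord)
  then show ?thesis
    using lc.hlift_smooth(1)[OF vector_field_smooth_at[OF B.manifold X d x], of "fib u"] by (simp only:)
qed

lemma curvature_in_chart:
  assumes X: "vector_field B X" and Y: "vector_field B Y"
    and lift: "vector_field T (horizontal_lift F L X)" "vector_field T (horizontal_lift F L Y)"
    and a: "a \<in> fst d" and z: "proj F z = a"
  shows "chart_vec T c z (curvature_field F L X Y z) = (0, curv a (X a) (Y a) (fib z))"
proof -
  interpret lc: local_connection sE sV "snd d a" b by (rule local_connection_at[OF a])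
  have "z \<in> fst c" using a z by (simp add: in_dom)
  then obtain y where zc: "z \<in> fst c" "snd c z = (snd d a, y)"
    using base_coord[of z] z by (cases "snd c z") auto
  let ?X = "field_in_chart B d X" and ?Y = "field_in_chart B d Y"
  have "chart_vec T c z (lie_bracket T (horizontal_lift F L X) (horizontal_lift F L Y) z) =
      bracket sF (field_in_chart T c (horizontal_lift F L X)) (field_in_chart T c (horizontal_lift F L Y)) (snd c z)"
    using lie_bracket_in_chart[OF T.manifold lift c_comp zc(1)] by simp
  also have "\<dots> = bracket sF (lc.hlift ?X) (lc.hlift ?Y) (snd c z)"
    by (rule bracket_cong[OF modules(3) hlift_smooth_at[OF X zc(1)] horizontal_lift_near[OF zc(1)]
        hlift_smooth_at[OF Y zc(1)] horizontal_lift_near[OF zc(1)]])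
  finally have "chart_vec T c z (curvature_field F L X Y z) =
      lc.hlift (field_in_chart B d (lie_bracket B X Y)) (snd d a, y) - bracket sF (lc.hlift ?X) (lc.hlift ?Y) (snd d a, y)"
    by (simp add: curvature_field_def chart_vec_linear(5)[OF T.manifold c_comp zc(1)]
        horizontal_lift_in_chart[OF zc(1)] zc(2))
  also have "lc.hlift (field_in_chart B d (lie_bracket B X Y)) (snd d a, y) = lc.hlift (bracket sE ?X ?Y) (snd d a, y)"
    using field_in_chart_lie_bracket[OF B.manifold X Y d, of "snd d a"] a by (simp add: lc.hlift_def)
  also have "lc.hlift (bracket sE ?X ?Y) (snd d a, y) - bracket sF (lc.hlift ?X) (lc.hlift ?Y) (snd d a, y) =
      (0, chart_curvature sE sV b (snd d a) (?X (snd d a)) (?Y (snd d a)) (y))"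
    by (rule lc.bracket_hlift[OF vector_field_smooth_at[OF B.manifold X d a] vector_field_smooth_at[OF B.manifold Y d a]])
  finally show ?thesis by (simp add: field_in_chart_at[OF d_inj a] zc(2))
qed

end

context calculus_symmetric_bundle
begin

lemma vector_field_horizontal_lift:
  assumes X: "vector_field B X"
  shows "vector_field T (horizontal_lift F L X)"
proof (rule vector_fieldI[OF T.manifold])
  fix u
  obtain c d b where "symmetric_bundle_chart F \<mu> \<mu>M L h c d b" and u: "u \<in> fst c" by (rule obtain_chart_at)
  then interpret symmetric_bundle_chart F \<mu> \<mu>M L h c d b by simp
  have "smooth_at sF sF (field_in_chart T c (horizontal_lift F L X)) (snd c u)"
    by (rule smooth_at_cong[OF hlift_smooth_at[OF X u] horizontal_lift_near[OF u]])
  then show "\<exists>c. compatible_chart T c \<and> u \<in> fst c \<and>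
      smooth_at (scal T) (scal T) (field_in_chart T c (horizontal_lift F L X)) (snd c u)"
    using c_comp u unfolding total_simps by blast
qed

lemma curvature_eq_r_component:
  assumes X: "vector_field B X" and Y: "vector_field B Y" and z: "proj F z = a"
  shows "curvature F L X Y z = r_component F \<mu> a (X a) (Y a) z"
proof -
  obtain c d b where "symmetric_bundle_chart F \<mu> \<mu>M L h c d b" and o: "fzero F a \<in> fst c" by (rule obtain_chart_at)
  then interpret symmetric_bundle_chart F \<mu> \<mu>M L h c d b by simp
  have a: "a \<in> fst d" using o by (simp add: in_dom)
  have zc: "z \<in> fst c" using a z by (simp add: in_dom)
  obtain z' where z': "z' \<in> fst c" "proj F z' = a" "fib z' = curv a (X a) (Y a) (fib z)"
    using fibre_point[OF a] by blast
  have "curvature F L X Y z = z'"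
    unfolding curvature_def
    by (rule fibre_part_eqI[OF zc])
      (simp_all add: z z' curvature_in_chart[OF X Y vector_field_horizontal_lift[OF X] vector_field_horizontal_lift[OF Y] a z])
  moreover have "r_component F \<mu> a (X a) (Y a) z = z'"
    unfolding r_component_def Let_def
    by (rule fibre_part_eqI[OF o]) (simp_all add: z' lts_in_chart[OF a z])
  ultimately show ?thesis by simp
qed

text \<open>
  The value of the curvature does not depend on the fields that extend \<open>v\<close> and \<open>w\<close>, and such fields exist:
  the derivations of the base.
\<close>

lemma curvature_at_eq_r_component:
  assumes z: "proj F z = a"
  shows "curvature_at F L a v w z = r_component F \<mu> a v w z"
  unfolding curvature_at_def
proof (rule the_equality)
  show "\<forall>X Y. vector_field B X \<and> vector_field B Y \<and> X a = v \<and> Y a = w \<longrightarrow>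
      curvature F L X Y z = r_component F \<mu> a v w z"
    using curvature_eq_r_component[OF _ _ z] by blast
  show "z' = r_component F \<mu> a v w z"
    if "\<forall>X Y. vector_field B X \<and> vector_field B Y \<and> X a = v \<and> Y a = w \<longrightarrow> curvature F L X Y z = z'" for z'
  proof -
    let ?X = "B.ext_field a (sE h v)" and ?Y = "B.ext_field a (sE h w)"
    have "?X a = v" "?Y a = w" by (rule B.ext_field_at[OF half])+
    with that curvature_eq_r_component[OF B.vector_field_ext_field B.vector_field_ext_field z] show ?thesis
      using B.vector_field_ext_field by metis
  qed
qed

end

theorem theorem5p3:
  fixes F :: "('k::{comm_ring_1, topological_ab_group_add, topological_semigroup_mult}, 'm,
      'e::{ab_group_add, t2_space}, 'b, 'v::{ab_group_add, t2_space}) vbundle"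
    and \<mu> :: "'b \<Rightarrow> 'b \<Rightarrow> 'b"
    and \<mu>M :: "'m \<Rightarrow> 'm \<Rightarrow> 'm"
    and L :: "('k, 'b, 'e \<times> 'v) connection"
  assumes "closure {t :: 'k. t dvd 1} = UNIV"
    and "(2 :: 'k) dvd 1"
    and "symmetric_bundle F \<mu> \<mu>M"
    and "linear_connection F L"
    and "\<And>x. invariant_connection F L (\<mu> (fzero F x))"
  shows "(\<forall>X Y \<zeta>. vector_field (base F) X \<and> vector_field (base F) Y \<and> smooth_section F \<zeta> \<longrightarrow>
            (\<forall>a. curvature F L X Y (\<zeta> a) = r_component F \<mu> a (X a) (Y a) (\<zeta> a))) \<and>
         (\<forall>a v w z. proj F z = a \<longrightarrow> curvature_at F L a v w z = r_component F \<mu> a v w z)"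
proof -
  from assms(2) obtain h :: 'k where "1 = 2 * h" by (rule dvdE)
  then have "h * 2 = 1" by (simp only: mult.commute)
  then interpret calculus_symmetric_bundle F \<mu> \<mu>M L h
    by (intro calculus_symmetric_bundle.intro assms)
  show ?thesis
  proof (intro conjI allI impI)
    fix X Y \<zeta> a
    assume "vector_field (base F) X \<and> vector_field (base F) Y \<and> smooth_section F \<zeta>"
    then show "curvature F L X Y (\<zeta> a) = r_component F \<mu> a (X a) (Y a) (\<zeta> a)"
      by (intro curvature_eq_r_component) (simp_all add: smooth_section_def)
  qed (rule curvature_at_eq_r_component)
qed

end
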